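(* Let $k$ be a commutative ring, let $G$ be a finite cyclic group and let $\pi$ be an element of $G$. Let $m_\pi$ be the index in $G$ of the cyclic subgroup generated by $\pi$. Then $$HC_n^{\pi,\varepsilon,\varepsilon}(kG)\cong\begin{cases}k\oplus \mathrm{Ann}(m_\pi)^{n/2}&\text{if } n\ge0 \text{ is even},\\ (k/m_\pi k)^{(n+1)/2}&\text{if } n \text{ is odd},\end{cases}$$ where $\mathrm{Ann}(m_\pi)=\{\lambda\in k: m_\pi\lambda=0\}$.
   Context: For a group $L$ and a central element $\pi\in L$, $HC_*^{\pi,\varepsilon,\varepsilon}(kL)$ is the cyclic homology of the cyclic $k$-module $C_n^{(\pi,\varepsilon,\varepsilon)}(kL)=(kL)^{\otimes n}$ ($n\ge0$) given on group elements by: $d_0(g_1\otimes\cdots\otimes g_n)=g_2\otimes\cdots\otimes g_n$; $d_i(g_1\otimes\cdots\otimes g_n)=g_1\otimes\cdots\otimes g_ig_{i+1}\otimes\cdots\otimes g_n$ for $1\le i\le n-1$; $d_n(g_1\otimes\cdots\otimes g_n)=g_1\otimes\cdots\otimes g_{n-1}$; degeneracies $s_i$ ($0\le i\le n$) inserting $1$ after $g_i$ (at the front if $i=0$); $t_n(g_1\otimes\cdots\otimes g_n)=\pi(g_1\cdots g_n)^{-1}\otimes g_1\otimes\cdots\otimes g_{n-1}$, $t_0=\mathrm{id}_k$. (This is the Connes–Moscovici cyclic homology of the Hopf algebra $kL$ for the grouplike $\pi$ and both characters equal to the counit $\varepsilon$.) The cyclic homology of a cyclic module $(C_n,d_i,s_i,t_n)$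 is the homology of the total complex of the first-quadrant bicomplex whose columns are alternately $(C_*,b)$ and $(C_*,-b')$, $b=\sum_{i=0}^n(-1)^id_i$, $b'=\sum_{i=0}^{n-1}(-1)^id_i$, with horizontal maps alternately $1-\tau_n$ and $\sum_{i=0}^n\tau_n^i$, where $\tau_n=(-1)^nt_n$. *)

theory Defs
  imports "HOL-Algebra.Module" "HOL-Algebra.AbelCoset" "HOL-Algebra.Elementary_Groups"
begin

section \<open>Modules over a commutative ring\<close>

text \<open>In the records below the ring fields \<open>mult\<close> and \<open>one\<close> play no role: the locale
  \<^locale>\<open>module\<close> does not refer to them.\<close>

definition self_module :: "('a, 'r) ring_scheme \<Rightarrow> ('a, 'a) module" where
  "self_module R =
    \<lparr>carrier = carrier R, mult = undefined, one = undefined,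
     zero = \<zero>\<^bsub>R\<^esub>, add = add R, smult = mult R\<rparr>"

definition dsum_module :: "('a, 'm) module \<Rightarrow> ('a, 'n) module \<Rightarrow> ('a, 'm \<times> 'n) module" where
  "dsum_module M N =
    \<lparr>carrier = carrier M \<times> carrier N, mult = undefined, one = undefined,
     zero = (\<zero>\<^bsub>M\<^esub>, \<zero>\<^bsub>N\<^esub>),
     add = (\<lambda>(x, y) (x', y'). (x \<oplus>\<^bsub>M\<^esub> x', y \<oplus>\<^bsub>N\<^esub> y')),
     smult = (\<lambda>a (x, y). (a \<odot>\<^bsub>M\<^esub> x, a \<odot>\<^bsub>N\<^esub> y))\<rparr>"

text \<open>Only used for finite \<open>I\<close>, where the product is also the direct sum.\<close>

definition prod_module :: "'i set \<Rightarrow> ('i \<Rightarrow> ('a, 'm) module) \<Rightarrow> ('a, 'i \<Rightarrow> 'm) module" where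
  "prod_module I M =
    \<lparr>carrier = (\<Pi>\<^sub>E i\<in>I. carrier (M i)), mult = undefined, one = undefined,
     zero = (\<lambda>i\<in>I. \<zero>\<^bsub>M i\<^esub>),
     add = (\<lambda>x y. \<lambda>i\<in>I. x i \<oplus>\<^bsub>M i\<^esub> y i),
     smult = (\<lambda>a x. \<lambda>i\<in>I. a \<odot>\<^bsub>M i\<^esub> x i)\<rparr>"

definition power_module :: "('a, 'm) module \<Rightarrow> nat \<Rightarrow> ('a, nat \<Rightarrow> 'm) module" where
  "power_module M j = prod_module {..<j} (\<lambda>_. M)"

text \<open>The quotient of \<open>M\<close> by a submodule \<open>N\<close>, with the cosets of \<open>N\<close> as elements.\<close>

definition quot_module :: "('a, 'm) module \<Rightarrow> 'm set \<Rightarrow> ('a, 'm set) module" where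
  "quot_module M N =
    \<lparr>carrier = a_rcosets\<^bsub>M\<^esub> N, mult = undefined, one = undefined,
     zero = N,
     add = set_add M,
     smult = (\<lambda>a X. \<Union>x\<in>X. N +>\<^bsub>M\<^esub> (a \<odot>\<^bsub>M\<^esub> x))\<rparr>"

definition kmodule_hom ::
    "('a, 'r) ring_scheme \<Rightarrow> ('a, 'm) module \<Rightarrow> ('a, 'n) module \<Rightarrow> ('m \<Rightarrow> 'n) set" where
  "kmodule_hom R M N =
    {h \<in> carrier M \<rightarrow> carrier N.
      (\<forall>x\<in>carrier M. \<forall>y\<in>carrier M. h (x \<oplus>\<^bsub>M\<^esub> y) = h x \<oplus>\<^bsub>N\<^esub> h y) \<and>
      (\<forall>a\<in>carrier R. \<forall>x\<in>carrier M. h (a \<odot>\<^bsub>M\<^esub> x) = a \<odot>\<^bsub>N\<^esub> h x)}"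

definition kmodule_isomorphic ::
    "('a, 'r) ring_scheme \<Rightarrow> ('a, 'm) module \<Rightarrow> ('a, 'n) module \<Rightarrow> bool" where
  "kmodule_isomorphic R M N \<longleftrightarrow>
    (\<exists>h \<in> kmodule_hom R M N. bij_betw h (carrier M) (carrier N))"

definition ann_module :: "('a, 'r) ring_scheme \<Rightarrow> nat \<Rightarrow> ('a, 'a) module" where
  "ann_module R m =
    (self_module R)\<lparr>carrier := {a \<in> carrier R. [m] \<cdot>\<^bsub>R\<^esub> a = \<zero>\<^bsub>R\<^esub>}\<rparr>"

definition mod_multiples_module :: "('a, 'r) ring_scheme \<Rightarrow> nat \<Rightarrow> ('a, 'a set) module" where
  "mod_multiples_module R m =
    quot_module (self_module R) ((\<lambda>a. [m] \<cdot>\<^bsub>R\<^esub> a) ` carrier R)"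


section \<open>Homology of chain complexes and total complexes\<close>

text \<open>A chain complex consists of modules \<open>K n\<close> and maps \<open>D n\<close> from \<open>K n\<close> to \<open>K (n - 1)\<close> for
  \<open>n \<ge> 1\<close>; the complex is zero in negative degrees, and \<open>D 0\<close> is never used.\<close>

definition cycles ::
    "(nat \<Rightarrow> ('a, 'm) module) \<Rightarrow> (nat \<Rightarrow> 'm \<Rightarrow> 'm) \<Rightarrow> nat \<Rightarrow> 'm set" where
  "cycles K D n =
    (if n = 0 then carrier (K 0) else a_kernel (K n) (K (n - 1)) (D n))"

definition boundaries ::
    "(nat \<Rightarrow> ('a, 'm) module) \<Rightarrow> (nat \<Rightarrow> 'm \<Rightarrow> 'm) \<Rightarrow> nat \<Rightarrow> 'm set" where
  "boundaries K D n = D (Suc n) ` carrier (K (Suc n))"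

definition homology ::
    "(nat \<Rightarrow> ('a, 'm) module) \<Rightarrow> (nat \<Rightarrow> 'm \<Rightarrow> 'm) \<Rightarrow> nat \<Rightarrow> ('a, 'm set) module" where
  "homology K D n = quot_module ((K n)\<lparr>carrier := cycles K D n\<rparr>) (boundaries K D n)"

text \<open>A first-quadrant bicomplex has modules \<open>X p q\<close> (column \<open>p\<close>, row \<open>q\<close>), vertical maps
  \<open>dv p q\<close> from \<open>X p q\<close> to \<open>X p (q - 1)\<close> and horizontal maps \<open>dh p q\<close> from \<open>X p q\<close> to
  \<open>X (p - 1) q\<close>, with anticommuting squares, so that the total differential is \<open>dv + dh\<close> without
  further signs. An element of the total complex in degree \<open>n\<close> is the family of its components
  in column \<open>p\<close> and row \<open>n - p\<close> for \<open>p \<le> n\<close>.\<close>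

definition tot_module ::
    "(nat \<Rightarrow> nat \<Rightarrow> ('a, 'm) module) \<Rightarrow> nat \<Rightarrow> ('a, nat \<Rightarrow> 'm) module" where
  "tot_module X n = prod_module {..n} (\<lambda>p. X p (n - p))"

definition tot_diff ::
    "(nat \<Rightarrow> nat \<Rightarrow> ('a, 'm) module) \<Rightarrow> (nat \<Rightarrow> nat \<Rightarrow> 'm \<Rightarrow> 'm) \<Rightarrow> (nat \<Rightarrow> nat \<Rightarrow> 'm \<Rightarrow> 'm) \<Rightarrow>
     nat \<Rightarrow> (nat \<Rightarrow> 'm) \<Rightarrow> (nat \<Rightarrow> 'm)" where
  "tot_diff X dv dh n x =
    (\<lambda>p\<in>{..<n}. dv p (n - p) (x p) \<oplus>\<^bsub>X p (n - 1 - p)\<^esub> dh (p + 1) (n - 1 - p) (x (p + 1)))"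


section \<open>Cyclic homology of a cyclic module\<close>

text \<open>The data of a cyclic module: \<open>face C n i\<close> is $d_i : C_n \to C_{n-1}$, \<open>degen C n i\<close> is
  $s_i : C_n \to C_{n+1}$, and \<open>cyc C n\<close> is $t_n : C_n \to C_n$.\<close>

record ('a, 'm) cyclic_module =
  obj :: "nat \<Rightarrow> ('a, 'm) module"
  face :: "nat \<Rightarrow> nat \<Rightarrow> 'm \<Rightarrow> 'm"
  degen :: "nat \<Rightarrow> nat \<Rightarrow> 'm \<Rightarrow> 'm"
  cyc :: "nat \<Rightarrow> 'm \<Rightarrow> 'm"

definition sign :: "('a, 'r) ring_scheme \<Rightarrow> nat \<Rightarrow> 'a" where
  "sign R n = (\<ominus>\<^bsub>R\<^esub> \<one>\<^bsub>R\<^esub>) [^]\<^bsub>R\<^esub> n"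

definition hoch_b ::
    "('a, 'r) ring_scheme \<Rightarrow> ('a, 'm) cyclic_module \<Rightarrow> nat \<Rightarrow> 'm \<Rightarrow> 'm" where
  "hoch_b R C n x =
    (\<Oplus>\<^bsub>obj C (n - 1)\<^esub> i\<in>{..n}. sign R i \<odot>\<^bsub>obj C (n - 1)\<^esub> face C n i x)"

definition hoch_b' ::
    "('a, 'r) ring_scheme \<Rightarrow> ('a, 'm) cyclic_module \<Rightarrow> nat \<Rightarrow> 'm \<Rightarrow> 'm" where
  "hoch_b' R C n x =
    (\<Oplus>\<^bsub>obj C (n - 1)\<^esub> i\<in>{..<n}. sign R i \<odot>\<^bsub>obj C (n - 1)\<^esub> face C n i x)"

definition signed_cyc ::
    "('a, 'r) ring_scheme \<Rightarrow> ('a, 'm) cyclic_module \<Rightarrow> nat \<Rightarrow> 'm \<Rightarrow> 'm" where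
  "signed_cyc R C n x = sign R n \<odot>\<^bsub>obj C n\<^esub> cyc C n x"

definition cyc_norm ::
    "('a, 'r) ring_scheme \<Rightarrow> ('a, 'm) cyclic_module \<Rightarrow> nat \<Rightarrow> 'm \<Rightarrow> 'm" where
  "cyc_norm R C n x = (\<Oplus>\<^bsub>obj C n\<^esub> i\<in>{..n}. (signed_cyc R C n ^^ i) x)"

definition cyc_obj :: "('a, 'm) cyclic_module \<Rightarrow> nat \<Rightarrow> nat \<Rightarrow> ('a, 'm) module" where
  "cyc_obj C p q = obj C q"

definition cyc_vert ::
    "('a, 'r) ring_scheme \<Rightarrow> ('a, 'm) cyclic_module \<Rightarrow> nat \<Rightarrow> nat \<Rightarrow> 'm \<Rightarrow> 'm" where
  "cyc_vert R C p q x =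
    (if even p then hoch_b R C q x else \<ominus>\<^bsub>obj C (q - 1)\<^esub> hoch_b' R C q x)"

definition cyc_horiz ::
    "('a, 'r) ring_scheme \<Rightarrow> ('a, 'm) cyclic_module \<Rightarrow> nat \<Rightarrow> nat \<Rightarrow> 'm \<Rightarrow> 'm" where
  "cyc_horiz R C p q x =
    (if odd p then x \<ominus>\<^bsub>obj C q\<^esub> signed_cyc R C q x else cyc_norm R C q x)"

definition cyclic_homology ::
    "('a, 'r) ring_scheme \<Rightarrow> ('a, 'm) cyclic_module \<Rightarrow> nat \<Rightarrow> ('a, (nat \<Rightarrow> 'm) set) module" where
  "cyclic_homology R C =
    homology (tot_module (cyc_obj C)) (tot_diff (cyc_obj C) (cyc_vert R C) (cyc_horiz R C))"


section \<open>The Connes--Moscovici cyclic module of a group algebra\<close>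

text \<open>The free \<open>R\<close>-module on \<open>B\<close>: finitely supported functions on \<open>B\<close>, extended by zero.\<close>

definition free_module :: "('a, 'r) ring_scheme \<Rightarrow> 'b set \<Rightarrow> ('a, 'b \<Rightarrow> 'a) module" where
  "free_module R B =
    \<lparr>carrier = {x. (\<forall>w. x w \<in> carrier R) \<and> (\<forall>w. w \<notin> B \<longrightarrow> x w = \<zero>\<^bsub>R\<^esub>) \<and>
                   finite {w. x w \<noteq> \<zero>\<^bsub>R\<^esub>}},
     mult = undefined, one = undefined,
     zero = (\<lambda>_. \<zero>\<^bsub>R\<^esub>),
     add = (\<lambda>x y w. x w \<oplus>\<^bsub>R\<^esub> y w),
     smult = (\<lambda>a x w. a \<otimes>\<^bsub>R\<^esub> x w)\<rparr>"

text \<open>The linear extension of a map \<open>f\<close> between basis elements.\<close>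

definition lin_ext :: "('a, 'r) ring_scheme \<Rightarrow> ('b \<Rightarrow> 'c) \<Rightarrow> ('b \<Rightarrow> 'a) \<Rightarrow> ('c \<Rightarrow> 'a)" where
  "lin_ext R f x = (\<lambda>w. \<Oplus>\<^bsub>R\<^esub> v\<in>{v. x v \<noteq> \<zero>\<^bsub>R\<^esub> \<and> f v = w}. x v)"

text \<open>The elementary tensor $g_1 \otimes \cdots \otimes g_n$ of group elements is represented by
  the list \<open>[g\<^sub>1, \<dots>, g\<^sub>n]\<close>. These tensors form a basis of $(kL)^{\otimes n}$, which is therefore
  the free module on the lists of length \<open>n\<close>. List positions are counted from 0, so that \<open>g\<^sub>i\<close>
  is \<open>w ! (i - 1)\<close>.\<close>

definition words :: "('g, 'h) monoid_scheme \<Rightarrow> nat \<Rightarrow> 'g list set" where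
  "words L n = {w. length w = n \<and> set w \<subseteq> carrier L}"

definition word_face :: "('g, 'h) monoid_scheme \<Rightarrow> nat \<Rightarrow> nat \<Rightarrow> 'g list \<Rightarrow> 'g list" where
  "word_face L n i w =
    (if i = 0 then tl w
     else if i = n then butlast w
     else take (i - 1) w @ [w ! (i - 1) \<otimes>\<^bsub>L\<^esub> w ! i] @ drop (i + 1) w)"

definition word_degen :: "('g, 'h) monoid_scheme \<Rightarrow> nat \<Rightarrow> nat \<Rightarrow> 'g list \<Rightarrow> 'g list" where
  "word_degen L n i w = take i w @ [\<one>\<^bsub>L\<^esub>] @ drop i w"

definition word_cyc :: "('g, 'h) monoid_scheme \<Rightarrow> 'g \<Rightarrow> nat \<Rightarrow> 'g list \<Rightarrow> 'g list" where
  "word_cyc L \<pi> n w =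
    (if n = 0 then w
     else (\<pi> \<otimes>\<^bsub>L\<^esub> inv\<^bsub>L\<^esub> (foldr (mult L) w \<one>\<^bsub>L\<^esub>)) # butlast w)"

text \<open>The axioms of a cyclic module hold for the following data when \<open>L\<close> is a group and \<open>\<pi>\<close> is
  central: \<open>t\<^sub>n\<close> has order dividing \<open>n + 1\<close> only because \<open>\<pi>\<close> commutes with all of \<open>L\<close>.\<close>

definition cm_cyclic_module ::
    "('a, 'r) ring_scheme \<Rightarrow> ('g, 'h) monoid_scheme \<Rightarrow> 'g \<Rightarrow> ('a, 'g list \<Rightarrow> 'a) cyclic_module" where
  "cm_cyclic_module R L \<pi> =
    \<lparr>obj = (\<lambda>n. free_module R (words L n)),
     face = (\<lambda>n i. lin_ext R (word_face L n i)),
     degen = (\<lambda>n i. lin_ext R (word_degen L n i)),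
     cyc = (\<lambda>n. lin_ext R (word_cyc L \<pi> n))\<rparr>"

definition CM_HC ::
    "('a, 'r) ring_scheme \<Rightarrow> ('g, 'h) monoid_scheme \<Rightarrow> 'g \<Rightarrow> nat \<Rightarrow>
     ('a, (nat \<Rightarrow> 'g list \<Rightarrow> 'a) set) module" where
  "CM_HC R L \<pi> = cyclic_homology R (cm_cyclic_module R L \<pi>)"

definition subgroup_index :: "('g, 'h) monoid_scheme \<Rightarrow> 'g set \<Rightarrow> nat" where
  "subgroup_index G H = card (rcosets\<^bsub>G\<^esub> H)"

end

theory Submission
  imports Defs "HOL-Library.Poly_Mapping" "HOL-Algebra.Multiplicative_Group"
    "HOL-Computational_Algebra.Primes"
begin

text \<open>Write $N$ for the order of $G$ and $m$ for the index of $\langle\pi\rangle$. Topologically,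
  the cyclic module attached to $\pi$ models the homotopy quotient of $BG$ by the circle action
  that $\pi$ determines. For cyclic $G$ this space is $B(\mathbb{Z}/m) \times BS^1$, whence
  $HC_n \cong \bigoplus_j H_{n-2j}(\mathbb{Z}/m; k)$. The proof below is an algebraic form of this
  computation.

  The generator $\gamma$ of $G$ can be chosen with $\gamma^m = \pi$. A word $(g_1, \dots, g_q)$ is
  an orbit of tuples $(h_0, \dots, h_q)$ under simultaneous translation, through
  $g_i = h_{i-1} h_i^{-1}$. On tuples the operator $t$ puts $\pi h_q$ in front of
  $h_0, \dots, h_{q-1}$, so that $t^{q+1}$ is no longer the identity but translation by $\pi$, and
  consecutive horizontal maps of the cyclic bicomplex compose to $1 - \pi$ instead of $0$. The
  passage to orbits is resolved by the 2-periodic resolution of $G$, whose differentials are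
  alternately $\gamma - 1$ and the norm. As $\pi - 1 = (\gamma - 1)(1 + \gamma + \dots + \gamma^{m-1})$,
  a correction term with the coefficient $1 + \gamma + \dots + \gamma^{m-1}$ turns all these maps
  into the differential of one complex (\<open>tri_d_tri_d\<close>), with basis the triples of a column,
  a resolution degree and a tuple.

  This complex maps onto two others. Taking orbits maps it onto the cyclic bicomplex of $G$, with
  acyclic kernel because $G$ acts freely on tuples (\<open>tri_equivalent_cyc\<close>). Augmenting
  the tuples of length one maps it onto a small complex, with acyclic kernel because tuples form a
  contractible simplicial set and the odd columns are contractible (\<open>tri_equivalent_small\<close>).
  The small complex has basis elements $(j, i)$ in degree $2j + i$, and its differential sends
  $(j, i)$ to $N (j, i-1) + m (j-1, i+1)$ for even $i$ and to $0$ for odd $i$. Since $m$ divides $N$,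
  a triangular change of coordinates makes the differential out of degree $2l$ into $m$ times a
  coordinate projection of rank $l$. This gives $k \oplus \mathrm{Ann}(m)^l$ in degree $2l$
  (\<open>CM_HC_even\<close>) and $(k/mk)^{l+1}$ in degree $2l+1$ (\<open>CM_HC_odd\<close>).

  Up to the last step everything happens over the integers: the complexes are free with explicit
  bases, so a surjection with acyclic kernel is a homotopy equivalence, and a homotopy equivalence
  given by integer matrices stays one over every commutative ring $k$.\<close>

section \<open>Finite integral chains on a basis\<close>

abbreviation "lin \<equiv> frag_extend"

abbreviation "entry \<equiv> Poly_Mapping.lookup"

definition chains :: "'b set \<Rightarrow> ('b \<Rightarrow>\<^sub>0 int) set" where
  "chains B = {c. Poly_Mapping.keys c \<subseteq> B}"

lemma chains_zero [simp]: "0 \<in> chains B"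
  by (simp add: chains_def)

lemma chains_of [simp]: "frag_of b \<in> chains B \<longleftrightarrow> b \<in> B"
  by (simp add: chains_def keys_frag_of)

lemma chains_minus [simp]: "- c \<in> chains B \<longleftrightarrow> c \<in> chains B"
  by (simp add: chains_def)

lemma chains_cmul [simp]: "c \<in> chains B \<Longrightarrow> frag_cmul a c \<in> chains B"
  unfolding chains_def using keys_cmul by blast

lemma chains_add [simp]: "c \<in> chains B \<Longrightarrow> c' \<in> chains B \<Longrightarrow> c + c' \<in> chains B"
  unfolding chains_def using Poly_Mapping.keys_add[of c c'] by blast

lemma chains_diff [simp]: "c \<in> chains B \<Longrightarrow> c' \<in> chains B \<Longrightarrow> c - c' \<in> chains B"
  unfolding chains_def using keys_diff[of c c'] by blast

lemma chains_sum: "(\<And>i. i \<in> I \<Longrightarrow> f i \<in> chains B) \<Longrightarrow> sum f I \<in> chains B"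
  by (induction I rule: infinite_finite_induct) auto

lemma chains_extend:
  "\<lbrakk>c \<in> chains B; \<And>b. b \<in> B \<Longrightarrow> f b \<in> chains C\<rbrakk> \<Longrightarrow> lin f c \<in> chains C"
  unfolding chains_def using keys_frag_extend[of f c] by blast

lemma chains_mono: "c \<in> chains B \<Longrightarrow> B \<subseteq> C \<Longrightarrow> c \<in> chains C"
  unfolding chains_def by blast

lemma frag_extend_frag_extend:
  "lin f (lin g c) = lin (\<lambda>b. lin f (g b)) c"
  by (induction c rule: frag_induction[OF subset_UNIV]) (auto simp: frag_extend_diff)

lemma frag_extend_cong:
  "\<lbrakk>c \<in> chains B; \<And>b. b \<in> B \<Longrightarrow> f b = g b\<rbrakk> \<Longrightarrow> lin f c = lin g c"
  unfolding chains_def by (rule frag_extend_eq) blast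

lemma frag_extend_plus: "lin (\<lambda>b. f b + g b) c = lin f c + lin g c"
  by (induction c rule: frag_induction[OF subset_UNIV]) (auto simp: frag_extend_diff)

lemma frag_extend_minus_fun: "lin (\<lambda>b. f b - g b) c = lin f c - lin g c"
  by (induction c rule: frag_induction[OF subset_UNIV]) (auto simp: frag_extend_diff)

lemma frag_extend_zero_fun: "lin (\<lambda>b. 0) c = 0"
  by (rule frag_extend_eq_0) simp

lemma frag_extend_frag_of [simp]: "lin frag_of c = c"
  by (simp add: frag_expansion[symmetric])

lemma frag_extend_eq_on_chains:
  assumes "c \<in> chains B" "\<And>b. b \<in> B \<Longrightarrow> lin f (g b) = lin f' (g' b)"
  shows "lin f (lin g c) = lin f' (lin g' c)"
  unfolding frag_extend_frag_extend using assms by (rule frag_extend_cong)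

section \<open>Homotopy equivalences of based complexes\<close>

text \<open>The differential is one function on basis elements, extended linearly by \<open>lin\<close>; the degree is
  remembered only by the bases \<open>B n\<close>. As \<open>d\<close> vanishes on \<open>B 0\<close>, the truncated index \<open>n - 1\<close>
  of the next definitions is harmless in degree 0.\<close>

definition based_complex :: "(nat \<Rightarrow> 'b set) \<Rightarrow> ('b \<Rightarrow> 'b \<Rightarrow>\<^sub>0 int) \<Rightarrow> bool" where
  "based_complex B d \<longleftrightarrow>
    (\<forall>n. \<forall>b\<in>B (Suc n). d b \<in> chains (B n)) \<and> (\<forall>b\<in>B 0. d b = 0) \<and>
    (\<forall>n. \<forall>b\<in>B n. lin d (d b) = 0)"

definition chain_map ::
    "(nat \<Rightarrow> 'b set) \<Rightarrow> ('b \<Rightarrow> 'b \<Rightarrow>\<^sub>0 int) \<Rightarrow> (nat \<Rightarrow> 'c set) \<Rightarrow> ('c \<Rightarrow> 'c \<Rightarrow>\<^sub>0 int) \<Rightarrow>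
     (nat \<Rightarrow> 'b \<Rightarrow> 'c \<Rightarrow>\<^sub>0 int) \<Rightarrow> bool" where
  "chain_map B d C e F \<longleftrightarrow>
    (\<forall>n. \<forall>b\<in>B n. F n b \<in> chains (C n) \<and>
       lin (F (n - 1)) (d b) = lin e (F n b))"

definition homotopic_to_id ::
    "(nat \<Rightarrow> 'b set) \<Rightarrow> ('b \<Rightarrow> 'b \<Rightarrow>\<^sub>0 int) \<Rightarrow> (nat \<Rightarrow> 'b \<Rightarrow> 'b \<Rightarrow>\<^sub>0 int) \<Rightarrow>
     (nat \<Rightarrow> 'b \<Rightarrow> 'b \<Rightarrow>\<^sub>0 int) \<Rightarrow> bool" where
  "homotopic_to_id B d E H \<longleftrightarrow>
    (\<forall>n. \<forall>b\<in>B n. H n b \<in> chains (B (Suc n)) \<and>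
       frag_of b = E n b + lin d (H n b) + lin (H (n - 1)) (d b))"

lemma based_complexD:
  assumes "based_complex B d" "c \<in> chains (B n)"
  shows "lin d c \<in> chains (B (n - 1))" "n = 0 \<Longrightarrow> lin d c = 0"
    "lin d (lin d c) = 0"
proof -
  have dd: "lin (\<lambda>b. lin d (d b)) c = lin (\<lambda>b. 0) c"
    using assms by (intro frag_extend_cong[of c "B n"]) (auto simp: based_complex_def)
  then show "lin d (lin d c) = 0"
    by (simp add: frag_extend_frag_extend frag_extend_zero_fun)
  show "n = 0 \<Longrightarrow> lin d c = 0"
    using assms frag_extend_cong[of c "B 0" d "\<lambda>_. 0"]
    by (auto simp: based_complex_def frag_extend_zero_fun)
  then show "lin d c \<in> chains (B (n - 1))"
    using assms by (cases n) (auto simp: based_complex_def intro!: chains_extend[of c "B n"])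
qed

lemma chain_mapD:
  assumes "chain_map B d C e F" "c \<in> chains (B n)"
  shows "lin (F n) c \<in> chains (C n)"
    "lin (F (n - 1)) (lin d c) = lin e (lin (F n) c)"
proof -
  show "lin (F n) c \<in> chains (C n)"
    using assms by (intro chains_extend[of c "B n"]) (auto simp: chain_map_def)
  show "lin (F (n - 1)) (lin d c) = lin e (lin (F n) c)"
    using assms by (intro frag_extend_eq_on_chains[of c "B n"]) (auto simp: chain_map_def)
qed

lemma homotopic_to_idD:
  assumes "homotopic_to_id B d E H" "c \<in> chains (B n)"
  shows "lin (H n) c \<in> chains (B (Suc n))"
    "c = lin (E n) c + lin d (lin (H n) c)
       + lin (H (n - 1)) (lin d c)"
proof -
  show "lin (H n) c \<in> chains (B (Suc n))"
    using assms by (intro chains_extend[of c "B n"]) (auto simp: homotopic_to_id_def)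
  have "lin frag_of c = lin (\<lambda>b. E n b + lin d (H n b) + lin (H (n - 1)) (d b)) c"
    using assms by (intro frag_extend_cong[of c "B n"]) (auto simp: homotopic_to_id_def)
  then show "c = lin (E n) c + lin d (lin (H n) c)
       + lin (H (n - 1)) (lin d c)"
    by (simp add: frag_extend_plus frag_extend_frag_extend)
qed

text \<open>A section is chosen on basis elements, degree by degree: any preimage of \<open>b\<close> fails to extend the
  chain map by a cycle of the kernel, and subtracting a chain of the kernel that bounds this cycle
  repairs it.\<close>

lemma section_of_acyclic_surjection:
  fixes BW :: "nat \<Rightarrow> 'w set" and BS :: "nat \<Rightarrow> 's set"
  assumes W: "based_complex BW dW" and S: "based_complex BS dS"
    and f: "chain_map BW dW BS dS (\<lambda>_. f)"
    and surj: "\<And>n b. b \<in> BS n \<Longrightarrow> \<exists>y\<in>chains (BW n). lin f y = frag_of b"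
    and acyc: "\<And>n x. \<lbrakk>x \<in> chains (BW n); lin dW x = 0; lin f x = 0\<rbrakk>
        \<Longrightarrow> \<exists>z\<in>chains (BW (Suc n)). lin dW z = x \<and> lin f z = 0"
  obtains g where "chain_map BS dS BW dW g" "\<And>n b. b \<in> BS n \<Longrightarrow> lin f (g n b) = frag_of b"
proof -
  \<comment> \<open>That \<open>g\<close> maps cycles to cycles is the invariant that makes the obstruction in the next degree a
     cycle; \<open>Q\<close> is the chain map condition between two consecutive degrees.\<close>
  define P where "P n g \<longleftrightarrow> (\<forall>b\<in>BS n. g b \<in> chains (BW n) \<and> lin f (g b) = frag_of b) \<and>
      (\<forall>c\<in>chains (BS n). lin dS c = 0 \<longrightarrow> lin dW (lin g c) = 0)" for n g
  define Q where "Q n g g' \<longleftrightarrow> (\<forall>b\<in>BS (Suc n). lin dW (g' b) = lin g (dS b))"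
    for n and g g' :: "'s \<Rightarrow> 'w \<Rightarrow>\<^sub>0 int"
  have "\<exists>g. \<forall>n. P n (g n) \<and> Q n (g n) (g (Suc n))"
  proof (rule dependent_nat_choice)
    obtain g where g: "\<And>b. b \<in> BS 0 \<Longrightarrow> g b \<in> chains (BW 0) \<and> lin f (g b) = frag_of b"
      using surj[of _ 0] by metis
    have "lin dW (lin g c) = 0" if "c \<in> chains (BS 0)" for c
      using that g by (intro based_complexD(2)[OF W _ refl] chains_extend[of c "BS 0"]) auto
    then have "P 0 g" using g unfolding P_def by blast
    then show "\<exists>g. P 0 g" by blast
  next
    fix g n assume "P n g"
    then have g: "\<And>b. b \<in> BS n \<Longrightarrow> g b \<in> chains (BW n)"
        "\<And>b. b \<in> BS n \<Longrightarrow> lin f (g b) = frag_of b"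
        "\<And>c. c \<in> chains (BS n) \<Longrightarrow> lin dS c = 0 \<Longrightarrow> lin dW (lin g c) = 0"
      unfolding P_def by blast+
    have fg: "lin f (lin g c) = c" if "c \<in> chains (BS n)" for c
      using that frag_extend_cong[of c "BS n" "\<lambda>b. lin f (g b)" frag_of] g(2)
      by (simp add: frag_extend_frag_extend)
    have "\<exists>y\<in>chains (BW (Suc n)). lin f y = frag_of b \<and> lin dW y = lin g (dS b)"
      if b: "b \<in> BS (Suc n)" for b
    proof -
      obtain y where y: "y \<in> chains (BW (Suc n))" "lin f y = frag_of b"
        using surj b by blast
      have db: "dS b \<in> chains (BS n)" "lin dS (dS b) = 0"
        using S b unfolding based_complex_def by blast+
      let ?x = "lin dW y - lin g (dS b)"
      have "?x \<in> chains (BW n)"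
        using based_complexD(1)[OF W y(1)] chains_extend[OF db(1) g(1)] by simp
      moreover have "lin dW ?x = 0"
        using based_complexD(3)[OF W y(1)] g(3)[OF db] by (simp add: frag_extend_diff)
      moreover have "lin f ?x = 0"
        using chain_mapD(2)[OF f y(1)] y(2) fg[OF db(1)] by (simp add: frag_extend_diff)
      ultimately obtain z where z: "z \<in> chains (BW (Suc n))" "lin dW z = ?x" "lin f z = 0"
        using acyc by blast
      show ?thesis
        by (rule bexI[of _ "y - z"]) (use y z in \<open>auto simp: frag_extend_diff\<close>)
    qed
    then obtain g' where g': "\<And>b. b \<in> BS (Suc n) \<Longrightarrow> g' b \<in> chains (BW (Suc n)) \<and>
        lin f (g' b) = frag_of b \<and> lin dW (g' b) = lin g (dS b)"
      by metis
    have "lin dW (lin g' c) = lin g (lin dS c)" if "c \<in> chains (BS (Suc n))" for c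
      using that g' by (intro frag_extend_eq_on_chains[of c "BS (Suc n)"]) auto
    then have "P (Suc n) g'" unfolding P_def using g' by simp
    moreover have "Q n g g'" unfolding Q_def using g' by blast
    ultimately show "\<exists>y. P (Suc n) y \<and> Q n g y" by blast
  qed
  then obtain g where g: "\<And>n. P n (g n)" "\<And>n. Q n (g n) (g (Suc n))" by blast
  have "chain_map BS dS BW dW g"
    unfolding chain_map_def
  proof (intro allI ballI conjI)
    fix n b assume b: "b \<in> BS n"
    then show gb: "g n b \<in> chains (BW n)" using g(1) unfolding P_def by blast
    show "lin (g (n - 1)) (dS b) = lin dW (g n b)"
    proof (cases n)
      case 0
      then show ?thesis using b S based_complexD(2)[OF W gb] by (simp add: based_complex_def)
    next
      case (Suc k)
      then show ?thesis using b g(2)[of k] by (simp add: Q_def)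
    qed
  qed
  moreover have "\<And>n b. b \<in> BS n \<Longrightarrow> lin f (g n b) = frag_of b"
    using g(1) unfolding P_def by blast
  ultimately show ?thesis using that by blast
qed

text \<open>The homotopy is built like the section. It has values in the kernel of \<open>f\<close>, where the obstruction
  to the next step is again a bounding cycle.\<close>

lemma homotopy_of_acyclic_surjection:
  fixes BW :: "nat \<Rightarrow> 'w set" and BS :: "nat \<Rightarrow> 's set"
  assumes W: "based_complex BW dW" and S: "based_complex BS dS"
    and f: "chain_map BW dW BS dS (\<lambda>_. f)"
    and g: "chain_map BS dS BW dW g"
    and fg: "\<And>n b. b \<in> BS n \<Longrightarrow> lin f (g n b) = frag_of b"
    and acyc: "\<And>n x. \<lbrakk>x \<in> chains (BW n); lin dW x = 0; lin f x = 0\<rbrakk>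
        \<Longrightarrow> \<exists>z\<in>chains (BW (Suc n)). lin dW z = x \<and> lin f z = 0"
  obtains h where "homotopic_to_id BW dW (\<lambda>n b. lin (g n) (f b)) h"
proof -
  define E where "E n c = lin (g n) (lin f c)" for n c
  have fE: "lin f (E n c) = lin f c" if "c \<in> chains (BW n)" for n c
  proof -
    have "lin f c \<in> chains (BS n)" by (rule chain_mapD(1)[OF f that])
    then show ?thesis unfolding E_def
      using frag_extend_cong[of "lin f c" "BS n" "\<lambda>b. lin f (g n b)" frag_of] fg
      by (simp add: frag_extend_frag_extend[of f])
  qed
  have E_chain: "E n c \<in> chains (BW n)" if "c \<in> chains (BW n)" for n c
    unfolding E_def by (rule chain_mapD(1)[OF g chain_mapD(1)[OF f that]])
  have dE: "lin dW (E n c) = E (n - 1) (lin dW c)" if "c \<in> chains (BW n)" for n c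
    unfolding E_def chain_mapD(2)[OF f that]
    by (rule chain_mapD(2)[OF g chain_mapD(1)[OF f that], symmetric])
  \<comment> \<open>On cycles the homotopy formula involves \<open>h\<close> in one degree only, so it can serve as invariant.\<close>
  define P where "P n h \<longleftrightarrow> (\<forall>b\<in>BW n. h b \<in> chains (BW (Suc n)) \<and> lin f (h b) = 0) \<and>
      (\<forall>c\<in>chains (BW n). lin dW c = 0 \<longrightarrow> lin dW (lin h c) = c - E n c)" for n h
  define Q where "Q n h h' \<longleftrightarrow> (\<forall>b\<in>BW (Suc n).
      frag_of b = E (Suc n) (frag_of b) + lin dW (h' b) + lin h (dW b))"
    for n and h h' :: "'w \<Rightarrow> 'w \<Rightarrow>\<^sub>0 int"
  have E_ext: "E n c = lin (\<lambda>b. E n (frag_of b)) c" for n c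
    unfolding E_def by (simp add: frag_extend_frag_extend)
  have "\<exists>h. \<forall>n. P n (h n) \<and> Q n (h n) (h (Suc n))"
  proof (rule dependent_nat_choice)
    have "\<exists>z\<in>chains (BW (Suc 0)). lin dW z = frag_of b - E 0 (frag_of b) \<and> lin f z = 0"
      if b: "b \<in> BW 0" for b
    proof (rule acyc)
      have b': "frag_of b \<in> chains (BW 0)" using b by simp
      show "frag_of b - E 0 (frag_of b) \<in> chains (BW 0)"
        using E_chain[OF b'] b' by auto
      then show "lin dW (frag_of b - E 0 (frag_of b)) = 0"
        by (rule based_complexD(2)[OF W _ refl])
      show "lin f (frag_of b - E 0 (frag_of b)) = 0"
        using fE[OF b'] by (simp add: frag_extend_diff)
    qed
    then obtain h where h: "\<And>b. b \<in> BW 0 \<Longrightarrow> h b \<in> chains (BW (Suc 0)) \<and>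
        lin dW (h b) = frag_of b - E 0 (frag_of b) \<and> lin f (h b) = 0" by metis
    have "lin dW (lin h c) = c - E 0 c" if "c \<in> chains (BW 0)" for c
      using frag_extend_cong[OF that, of "\<lambda>b. lin dW (h b)" "\<lambda>b. frag_of b - E 0 (frag_of b)"] h
      by (simp add: frag_extend_frag_extend frag_extend_minus_fun E_ext[symmetric])
    then have "P 0 h" using h unfolding P_def by auto
    then show "\<exists>h. P 0 h" by blast
  next
    fix h n assume "P n h"
    then have h: "\<And>b. b \<in> BW n \<Longrightarrow> h b \<in> chains (BW (Suc n))"
        "\<And>b. b \<in> BW n \<Longrightarrow> lin f (h b) = 0"
        "\<And>c. c \<in> chains (BW n) \<Longrightarrow> lin dW c = 0 \<Longrightarrow> lin dW (lin h c) = c - E n c"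
      unfolding P_def by blast+
    have "\<exists>z\<in>chains (BW (Suc (Suc n))). lin dW z =
        frag_of b - E (Suc n) (frag_of b) - lin h (dW b) \<and> lin f z = 0"
      if b: "b \<in> BW (Suc n)" for b
    proof (rule acyc)
      have b': "frag_of b \<in> chains (BW (Suc n))" using b by simp
      have db: "dW b \<in> chains (BW n)" "lin dW (dW b) = 0"
        using W b unfolding based_complex_def by blast+
      have hdb: "lin h (dW b) \<in> chains (BW (Suc n))"
        by (rule chains_extend[OF db(1) h(1)])
      have fh: "lin f (lin h (dW b)) = 0"
        using frag_extend_cong[OF db(1), of "\<lambda>b. lin f (h b)" "\<lambda>_. 0"] h(2)
        by (simp add: frag_extend_frag_extend frag_extend_zero_fun)
      show "frag_of b - E (Suc n) (frag_of b) - lin h (dW b) \<in> chains (BW (Suc n))"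
        using E_chain[OF b'] hdb b by auto
      show "lin dW (frag_of b - E (Suc n) (frag_of b) - lin h (dW b)) = 0"
        using dE[OF b'] h(3)[OF db] by (simp add: frag_extend_diff)
      show "lin f (frag_of b - E (Suc n) (frag_of b) - lin h (dW b)) = 0"
        using fE[OF b'] fh by (simp add: frag_extend_diff)
    qed
    then obtain h' where h': "\<And>b. b \<in> BW (Suc n) \<Longrightarrow> h' b \<in> chains (BW (Suc (Suc n))) \<and>
       lin dW (h' b) = frag_of b - E (Suc n) (frag_of b) - lin h (dW b) \<and>
       lin f (h' b) = 0" by metis
    have "lin dW (lin h' c) = c - E (Suc n) c - lin h (lin dW c)"
      if "c \<in> chains (BW (Suc n))" for c
      using frag_extend_cong[OF that, of "\<lambda>b. lin dW (h' b)"
          "\<lambda>b. frag_of b - E (Suc n) (frag_of b) - lin h (dW b)"] h'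
      by (simp add: frag_extend_frag_extend frag_extend_minus_fun E_ext[symmetric])
    then have "P (Suc n) h'" using h' unfolding P_def by auto
    moreover have "Q n h h'" unfolding Q_def using h' by simp
    ultimately show "\<exists>y. P (Suc n) y \<and> Q n h y" by blast
  qed
  then obtain h where h: "\<And>n. P n (h n)" "\<And>n. Q n (h n) (h (Suc n))" by blast
  have "homotopic_to_id BW dW (\<lambda>n b. lin (g n) (f b)) h"
    unfolding homotopic_to_id_def
  proof (intro allI ballI conjI)
    fix n b assume b: "b \<in> BW n"
    then show "h n b \<in> chains (BW (Suc n))" using h(1) unfolding P_def by blast
    have E: "E n (frag_of b) = lin (g n) (f b)" for n by (simp add: E_def)
    show "frag_of b = lin (g n) (f b) + lin dW (h n b) + lin (h (n - 1)) (dW b)"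
    proof (cases n)
      case 0
      then have "dW b = 0" using b W by (simp add: based_complex_def)
      moreover have "lin dW (lin (h n) (frag_of b)) = frag_of b - E n (frag_of b)"
        using h(1)[of n] b \<open>dW b = 0\<close> unfolding P_def
        by (metis chains_of frag_extend_of)
      ultimately show ?thesis by (simp add: E)
    next
      case (Suc k)
      then show ?thesis using b h(2)[of k, unfolded Q_def, rule_format, of b] by (simp add: E)
    qed
  qed
  then show ?thesis using that by blast
qed

definition homotopy_equivalent ::
    "(nat \<Rightarrow> 'b set) \<Rightarrow> ('b \<Rightarrow> 'b \<Rightarrow>\<^sub>0 int) \<Rightarrow> (nat \<Rightarrow> 'c set) \<Rightarrow> ('c \<Rightarrow> 'c \<Rightarrow>\<^sub>0 int) \<Rightarrow> bool" where
  "homotopy_equivalent B d C e \<longleftrightarrow>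
    (\<exists>F G H K. chain_map B d C e F \<and> chain_map C e B d G \<and>
       homotopic_to_id B d (\<lambda>n b. lin (G n) (F n b)) H \<and>
       homotopic_to_id C e (\<lambda>n c. lin (F n) (G n c)) K)"

lemma homotopy_equivalent_sym: "homotopy_equivalent B d C e \<Longrightarrow> homotopy_equivalent C e B d"
  unfolding homotopy_equivalent_def by blast

text \<open>If \<open>H\<close> and \<open>H'\<close> contract \<open>1 - GF\<close> and \<open>1 - G'F'\<close>, then \<open>H + G H' F\<close> contracts
  \<open>1 - G G' F' F\<close>.\<close>

lemma homotopy_equivalent_trans:
  assumes B: "based_complex B d" and C: "based_complex C e" and D: "based_complex D k"
    and BC: "homotopy_equivalent B d C e" and CD: "homotopy_equivalent C e D k"
  shows "homotopy_equivalent B d D k"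
proof -
  have *: "\<exists>L. homotopic_to_id B d (\<lambda>n b. lin (\<lambda>c. lin (G n) (G' n c)) (lin (F' n) (F n b))) L"
    if B: "based_complex B d"
      and F: "chain_map B d C e F" and G: "chain_map C e B d G"
      and H: "homotopic_to_id B d (\<lambda>n b. lin (G n) (F n b)) H"
      and H': "homotopic_to_id C e (\<lambda>n b. lin (G' n) (F' n b)) H'"
    for B :: "nat \<Rightarrow> 'x set" and d and C :: "nat \<Rightarrow> 'y set" and e F G H F' G' H'
  proof
    let ?L = "\<lambda>n b. H n b + lin (G (Suc n)) (lin (H' n) (F n b))"
    show "homotopic_to_id B d (\<lambda>n b. lin (\<lambda>c. lin (G n) (G' n c)) (lin (F' n) (F n b))) ?L"
      unfolding homotopic_to_id_def
    proof (intro allI ballI conjI)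
      fix n b assume b: "b \<in> B n"
      then have b': "frag_of b \<in> chains (B n)" by simp
      have Fb: "F n b \<in> chains (C n)" using chain_mapD(1)[OF F b'] by simp
      have HFb: "lin (H' n) (F n b) \<in> chains (C (Suc n))" by (rule homotopic_to_idD(1)[OF H' Fb])
      show "?L n b \<in> chains (B (Suc n))"
        using homotopic_to_idD(1)[OF H b'] chain_mapD(1)[OF G HFb] by simp
      have db: "d b \<in> chains (B (n - 1))" "n = 0 \<Longrightarrow> d b = 0"
        using based_complexD(1,2)[OF B b'] by simp_all
      have 1: "frag_of b = lin (G n) (F n b) + lin d (H n b) + lin (H (n - 1)) (d b)"
        using homotopic_to_idD(2)[OF H b'] by simp
      have 2: "F n b = lin (\<lambda>b. lin (G' n) (F' n b)) (F n b)
          + lin e (lin (H' n) (F n b)) + lin (H' (n - 1)) (lin e (F n b))"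
        by (rule homotopic_to_idD(2)[OF H' Fb])
      have 3: "lin e (F n b) = lin (F (n - 1)) (d b)"
        using chain_mapD(2)[OF F b'] by simp
      have 4: "lin (G n) (lin e (lin (H' n) (F n b)))
          = lin d (lin (G (Suc n)) (lin (H' n) (F n b)))"
        using chain_mapD(2)[OF G HFb] by simp
      have 5: "lin (G n) (lin (H' (n - 1)) (lin (F (n - 1)) (d b)))
          = lin (G (Suc (n - 1))) (lin (H' (n - 1)) (lin (F (n - 1)) (d b)))"
        using db(2) by (cases n) auto
      have "lin (G n) (F n b) = lin (\<lambda>c. lin (G n) (G' n c)) (lin (F' n) (F n b))
         + lin d (lin (G (Suc n)) (lin (H' n) (F n b)))
         + lin (G (Suc (n - 1))) (lin (H' (n - 1)) (lin (F (n - 1)) (d b)))"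
        by (subst 2) (simp only: frag_extend_add 3 4 5, simp add: frag_extend_frag_extend)
      then show "frag_of b = lin (\<lambda>c. lin (G n) (G' n c)) (lin (F' n) (F n b)) +
            lin d (?L n b) + lin (?L (n - 1)) (d b)"
        by (subst 1) (simp add: frag_extend_add frag_extend_plus frag_extend_frag_extend algebra_simps)
    qed
  qed
  have comp: "chain_map B d D k (\<lambda>n b. lin (F' n) (F n b))"
    if B: "based_complex B d" and F: "chain_map B d C e F" and F': "chain_map C e D k F'"
    for B :: "nat \<Rightarrow> 'x set" and d and C :: "nat \<Rightarrow> 'y set" and e and D :: "nat \<Rightarrow> 'z set" and k F F'
    unfolding chain_map_def
  proof (intro allI ballI conjI)
    fix n b assume b: "b \<in> B n"
    then have b': "frag_of b \<in> chains (B n)" by simp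
    have Fb: "F n b \<in> chains (C n)" using chain_mapD(1)[OF F b'] by simp
    then show "lin (F' n) (F n b) \<in> chains (D n)" by (rule chain_mapD(1)[OF F'])
    show "lin (\<lambda>b. lin (F' (n - 1)) (F (n - 1) b)) (d b) = lin k (lin (F' n) (F n b))"
      using chain_mapD(2)[OF F b'] chain_mapD(2)[OF F' Fb] by (simp add: frag_extend_frag_extend[symmetric])
  qed
  obtain F G H K where 1: "chain_map B d C e F" "chain_map C e B d G"
     "homotopic_to_id B d (\<lambda>n b. lin (G n) (F n b)) H"
     "homotopic_to_id C e (\<lambda>n c. lin (F n) (G n c)) K"
    using BC unfolding homotopy_equivalent_def by blast
  obtain F' G' H' K' where 2: "chain_map C e D k F'" "chain_map D k C e G'"
     "homotopic_to_id C e (\<lambda>n b. lin (G' n) (F' n b)) H'"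
     "homotopic_to_id D k (\<lambda>n c. lin (F' n) (G' n c)) K'"
    using CD unfolding homotopy_equivalent_def by blast
  show ?thesis
    unfolding homotopy_equivalent_def
    using comp[OF B 1(1) 2(1)] comp[OF D 2(2) 1(2)] *[OF B 1(1,2,3) 2(3)] *[OF D 2(2,1,4) 1(4)]
    by blast
qed

lemma acyclic_surjection_homotopy_equivalent:
  fixes BW :: "nat \<Rightarrow> 'w set" and BS :: "nat \<Rightarrow> 's set"
  assumes W: "based_complex BW dW" and S: "based_complex BS dS"
    and f: "chain_map BW dW BS dS (\<lambda>_. f)"
    and surj: "\<And>n b. b \<in> BS n \<Longrightarrow> \<exists>y\<in>chains (BW n). lin f y = frag_of b"
    and acyc: "\<And>n x. \<lbrakk>x \<in> chains (BW n); lin dW x = 0; lin f x = 0\<rbrakk>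
        \<Longrightarrow> \<exists>z\<in>chains (BW (Suc n)). lin dW z = x \<and> lin f z = 0"
  shows "homotopy_equivalent BW dW BS dS"
proof -
  obtain g where g: "chain_map BS dS BW dW g" "\<And>n b. b \<in> BS n \<Longrightarrow> lin f (g n b) = frag_of b"
    using section_of_acyclic_surjection[OF assms] by blast
  obtain h where h: "homotopic_to_id BW dW (\<lambda>n b. lin (g n) (f b)) h"
    using homotopy_of_acyclic_surjection[OF W S f g acyc] by blast
  have "homotopic_to_id BS dS (\<lambda>n c. lin f (g n c)) (\<lambda>_ _. 0)"
    unfolding homotopic_to_id_def using g(2) by (simp add: frag_extend_zero_fun)
  then show ?thesis using f g(1) h unfolding homotopy_equivalent_def by blast
qed

text \<open>A contraction of the kernel is needed only up to terms of lower filtration. For a cycle \<open>x\<close> of the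
  kernel, the chain \<open>x - d (\<kappa> x)\<close> is homologous to \<open>x\<close> and consists of such error terms alone, so
  iteration reaches filtration 0, where only the zero chain is left.\<close>

lemma acyclic_kernel_by_filtration:
  fixes BW :: "nat \<Rightarrow> 'w set" and \<phi> :: "'w \<Rightarrow> nat"
  assumes W: "based_complex BW dW" and f: "chain_map BW dW BS dS (\<lambda>_. f)"
    and \<kappa>: "\<And>n b. b \<in> BW n \<Longrightarrow> \<kappa> b \<in> chains (BW (Suc n))"
    and f\<kappa>: "\<And>n b. b \<in> BW n \<Longrightarrow> lin f (\<kappa> b) = 0"
    and low: "\<And>n b. b \<in> BW n \<Longrightarrow>
        frag_of b - lin s (f b) - lin dW (\<kappa> b) - lin \<kappa> (dW b) \<in> chains {b'. \<phi> b' < \<phi> b}"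
    and x: "x \<in> chains (BW n)" "lin dW x = 0" "lin f x = 0"
  shows "\<exists>z\<in>chains (BW (Suc n)). lin dW z = x \<and> lin f z = 0"
proof -
  have "\<exists>z\<in>chains (BW (Suc n)). lin dW z = x \<and> lin f z = 0"
    if "x \<in> chains (BW n)" "lin dW x = 0" "lin f x = 0" "x \<in> chains {b. \<phi> b < l}" for x l
    using that
  proof (induction l arbitrary: x)
    case 0
    then have "x = 0" by (simp add: chains_def)
    then show ?case by (intro bexI[of _ 0]) auto
  next
    case (Suc l)
    let ?y = "lin \<kappa> x" and ?x = "x - lin dW (lin \<kappa> x)"
    have y: "?y \<in> chains (BW (Suc n))" using chains_extend[OF Suc.prems(1) \<kappa>] .
    have fy: "lin f ?y = 0"
      using frag_extend_cong[OF Suc.prems(1), of "\<lambda>b. lin f (\<kappa> b)" "\<lambda>_. 0"] f\<kappa>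
      by (simp add: frag_extend_frag_extend frag_extend_zero_fun)
    have xB: "x \<in> chains (BW n \<inter> {b. \<phi> b < Suc l})" using Suc.prems by (simp add: chains_def)
    have x_eq: "?x = lin
        (\<lambda>b. frag_of b - lin s (f b) - lin dW (\<kappa> b) - lin \<kappa> (dW b)) x"
      using Suc.prems(2,3) by (simp add: frag_extend_minus_fun frag_extend_frag_extend[symmetric])
    have "?x \<in> chains {b. \<phi> b < l}"
      unfolding x_eq by (rule chains_extend[OF xB]) (use low in \<open>fastforce simp: chains_def\<close>)
    moreover have "?x \<in> chains (BW n)"
      using Suc.prems(1) based_complexD(1)[OF W y] by simp
    moreover have "lin dW ?x = 0"
      using Suc.prems(2) based_complexD(3)[OF W y] by (simp add: frag_extend_diff)
    moreover have "lin f ?x = 0"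
      using Suc.prems(3) chain_mapD(2)[OF f y] fy by (simp add: frag_extend_diff)
    ultimately obtain z where z: "z \<in> chains (BW (Suc n))" "lin dW z = ?x" "lin f z = 0"
      using Suc.IH by blast
    show ?case
      by (rule bexI[of _ "z + ?y"]) (use z y fy in \<open>auto simp: frag_extend_add\<close>)
  qed
  moreover have "x \<in> chains {b. \<phi> b < Suc (Max (\<phi> ` Poly_Mapping.keys x))}"
    unfolding chains_def by (auto simp: less_Suc_eq_le)
  ultimately show ?thesis using x by blast
qed

section \<open>The cyclic bicomplex on basis elements\<close>

text \<open>The maps $b$ and $-b'$ of the even and odd columns on a basis element of row \<open>q\<close>, followed by the
  maps $1 - \tau$ and $\sum_l \tau^l$ out of the odd and even columns, for faces \<open>\<delta>\<close> and a cyclic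
  operator \<open>t\<close> that send basis elements to basis elements.\<close>

definition vert_cell :: "(nat \<Rightarrow> nat \<Rightarrow> 'x \<Rightarrow> 'x) \<Rightarrow> nat \<Rightarrow> nat \<Rightarrow> 'x \<Rightarrow> 'x \<Rightarrow>\<^sub>0 int" where
  "vert_cell \<delta> p q x =
    (if even p then (\<Sum>i\<le>q. frag_cmul ((-1)^i) (frag_of (\<delta> q i x)))
     else - (\<Sum>i<q. frag_cmul ((-1)^i) (frag_of (\<delta> q i x))))"

definition horiz_cell :: "(nat \<Rightarrow> 'x \<Rightarrow> 'x) \<Rightarrow> nat \<Rightarrow> nat \<Rightarrow> 'x \<Rightarrow> 'x \<Rightarrow>\<^sub>0 int" where
  "horiz_cell t p q x =
    (if odd p then frag_of x - frag_cmul ((-1)^q) (frag_of (t q x))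
     else (\<Sum>l\<le>q. frag_cmul (((-1)^q)^l) (frag_of ((t q ^^ l) x))))"

abbreviation push :: "('x \<Rightarrow> 'y) \<Rightarrow> ('x \<Rightarrow>\<^sub>0 int) \<Rightarrow> ('y \<Rightarrow>\<^sub>0 int)" where
  "push u \<equiv> lin (\<lambda>x. frag_of (u x))"

lemma push_push: "push u (push v c) = push (\<lambda>x. u (v x)) c"
  by (simp add: frag_extend_frag_extend)

lemma frag_extend_push: "lin f (push v c) = lin (\<lambda>x. f (v x)) c"
  by (simp add: frag_extend_frag_extend)

lemma push_chains: "c \<in> chains A \<Longrightarrow> (\<And>x. x \<in> A \<Longrightarrow> u x \<in> B) \<Longrightarrow> push u c \<in> chains B"
  by (rule chains_extend) auto

lemma frag_extend_sum': "lin f (\<Sum>i\<in>I. g i) = (\<Sum>i\<in>I. lin f (g i))"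
  by (induction I rule: infinite_finite_induct) (auto simp: frag_extend_add)

lemmas frag_extend_linear = frag_extend_add frag_extend_diff frag_extend_minus frag_extend_cmul frag_extend_sum'

lemma vert_cell_natural:
  assumes "\<And>i. i \<le> q \<Longrightarrow> u (\<delta> q i x) = \<delta>' q i (u x)"
  shows "push u (vert_cell \<delta> p q x) = vert_cell \<delta>' p q (u x)"
  unfolding vert_cell_def using assms
  by (auto simp: frag_extend_linear intro!: sum.cong)

lemma horiz_cell_natural:
  assumes "\<And>l. l \<le> Suc q \<Longrightarrow> u ((t q ^^ l) x) = (t' q ^^ l) (u x)"
  shows "push u (horiz_cell t p q x) = horiz_cell t' p q (u x)"
  unfolding horiz_cell_def using assms assms[of 1]
  by (auto simp: frag_extend_linear intro!: sum.cong)

section \<open>Homogeneous tuples\<close>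

definition del :: "nat \<Rightarrow> 'x list \<Rightarrow> 'x list" where
  "del i h = take i h @ drop (Suc i) h"

lemma del_simps [simp]: "del 0 (x # xs) = xs" "del (Suc i) (x # xs) = x # del i xs"
  by (auto simp: del_def)

lemma length_del [simp]: "i < length h \<Longrightarrow> length (del i h) = length h - 1"
  by (auto simp: del_def)

lemma set_del: "set (del i h) \<subseteq> set h"
  unfolding del_def using set_take_subset set_drop_subset by fastforce

lemma del_snoc: "i < length xs \<Longrightarrow> del i (xs @ [y]) = del i xs @ [y]"
  by (auto simp: del_def)

lemma del_length: "del (length xs) (xs @ [y]) = xs"
  by (auto simp: del_def)

lemma map_del: "map f (del i h) = del i (map f h)"
  by (simp add: del_def take_map drop_map)

text \<open>The augmented simplicial boundary: a tuple of length one is sent to the empty tuple. With the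
  augmentation included, the recursions for both ends of a list have no exceptional cases.\<close>

definition aug_bdry :: "'x list \<Rightarrow> 'x list \<Rightarrow>\<^sub>0 int" where
  "aug_bdry h = (\<Sum>i<length h. frag_cmul ((-1)^i) (frag_of (del i h)))"

lemma aug_bdry_Nil [simp]: "aug_bdry [] = 0"
  by (simp add: aug_bdry_def)

lemma aug_bdry_Cons: "aug_bdry (x # xs) = frag_of xs - push ((#) x) (aug_bdry xs)"
proof -
  have "aug_bdry (x # xs) = frag_of xs + (\<Sum>i<length xs. frag_cmul (- ((-1)^i)) (frag_of (x # del i xs)))"
    unfolding aug_bdry_def by (simp add: sum.lessThan_Suc_shift del: sum.lessThan_Suc)
  also have "(\<Sum>i<length xs. frag_cmul (- ((-1)^i)) (frag_of (x # del i xs)))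
      = - (\<Sum>i<length xs. frag_cmul ((-1)^i) (frag_of (x # del i xs)))"
    by (simp add: sum_negf[symmetric])
  finally show ?thesis
    by (simp add: aug_bdry_def frag_extend_linear)
qed

lemma aug_bdry_snoc:
  "aug_bdry (xs @ [y]) = push (\<lambda>z. z @ [y]) (aug_bdry xs) + frag_cmul ((-1)^length xs) (frag_of xs)"
  unfolding aug_bdry_def by (simp add: frag_extend_linear del_snoc del_length)

lemma aug_bdry_aug_bdry: "lin aug_bdry (aug_bdry h) = 0"
proof (induction h)
  case (Cons x xs)
  have "lin aug_bdry (push ((#) x) (aug_bdry xs)) =
      lin (\<lambda>z. frag_of z - push ((#) x) (aug_bdry z)) (aug_bdry xs)"
    by (simp add: frag_extend_push aug_bdry_Cons)
  also have "\<dots> = aug_bdry xs"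
    using Cons.IH by (simp add: frag_extend_minus_fun frag_extend_frag_extend[symmetric])
  finally show ?case
    by (simp add: aug_bdry_Cons frag_extend_diff)
qed simp

text \<open>Tuples of exponents modulo \<open>N\<close> stand for tuples of elements of a cyclic group of order \<open>N\<close>;
  \<open>shift\<close> is simultaneous translation, and \<open>twist\<close> is the cyclic operator.\<close>

definition tuples :: "int \<Rightarrow> nat \<Rightarrow> int list set" where
  "tuples N l = {h. length h = l \<and> set h \<subseteq> {0..<N}}"

lemma aug_bdry_chains: "h \<in> tuples N l \<Longrightarrow> aug_bdry h \<in> chains (tuples N (l - 1))"
  unfolding aug_bdry_def
  by (intro chains_sum chains_cmul) (use set_del in \<open>fastforce simp: tuples_def\<close>)

definition shift :: "int \<Rightarrow> int \<Rightarrow> int list \<Rightarrow> int list" where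
  "shift N c h = map (\<lambda>x. (x + c) mod N) h"

definition twist :: "int \<Rightarrow> int \<Rightarrow> int list \<Rightarrow> int list" where
  "twist N m h = ((last h + m) mod N) # butlast h"

lemma length_shift [simp]: "length (shift N c h) = length h"
  by (simp add: shift_def)

lemma shift_eq_Nil [simp]: "shift N c h = [] \<longleftrightarrow> h = []"
  by (simp add: shift_def)

lemma shift_shift: "shift N c (shift N d h) = shift N (c + d) h"
  by (simp add: shift_def mod_simps ac_simps)

lemma shift_tuples [simp]: "N > 0 \<Longrightarrow> h \<in> tuples N l \<Longrightarrow> shift N c h \<in> tuples N l"
  by (auto simp: tuples_def shift_def)

lemma shift_multiple: "h \<in> tuples N l \<Longrightarrow> N dvd c \<Longrightarrow> shift N c h = h"
  unfolding shift_def by (rule map_idI) (auto simp: tuples_def elim!: dvdE)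

lemma shift_cong: "c mod N = d mod N \<Longrightarrow> shift N c h = shift N d h"
  unfolding shift_def by (intro map_cong refl) (metis mod_add_right_eq)

lemma shift_twist: "h \<noteq> [] \<Longrightarrow> shift N c (twist N m h) = twist N m (shift N c h)"
  by (simp add: shift_def twist_def map_butlast last_map mod_simps add_ac)

lemma length_twist [simp]: "h \<noteq> [] \<Longrightarrow> length (twist N m h) = length h"
  by (simp add: twist_def)

lemma twist_neq_Nil [simp]: "twist N m h \<noteq> []"
  by (simp add: twist_def)

lemma twist_pow_neq_Nil [simp]: "h \<noteq> [] \<Longrightarrow> (twist N m ^^ l) h \<noteq> []"
  by (cases l) auto

lemma length_twist_pow [simp]: "h \<noteq> [] \<Longrightarrow> length ((twist N m ^^ l) h) = length h"
  by (induction l) auto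

lemma twist_tuples [simp]: "N > 0 \<Longrightarrow> h \<in> tuples N (Suc q) \<Longrightarrow> twist N m h \<in> tuples N (Suc q)"
  by (auto simp: tuples_def twist_def dest: in_set_butlastD)

lemma twist_pow_tuples [simp]: "N > 0 \<Longrightarrow> h \<in> tuples N (Suc q) \<Longrightarrow> (twist N m ^^ l) h \<in> tuples N (Suc q)"
  by (induction l) auto

lemma shift_twist_pow: "h \<noteq> [] \<Longrightarrow> shift N c ((twist N m ^^ l) h) = (twist N m ^^ l) (shift N c h)"
  by (induction l) (auto simp: shift_twist)

text \<open>Every entry that moves from the back to the front is translated by \<open>m\<close>, hence a full turn
  translates the whole tuple.\<close>

lemma twist_pow_rotate:
  "l \<le> length h \<Longrightarrow> (twist N m ^^ l) h = shift N m (drop (length h - l) h) @ take (length h - l) h"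
proof (induction l)
  case 0
  then show ?case by (simp add: shift_def)
next
  case (Suc l)
  let ?k = "length h - Suc l"
  have k: "length h - l = Suc ?k" "?k < length h" using Suc.prems by auto
  have "take (Suc ?k) h = take ?k h @ [h ! ?k]" using k(2) by (rule take_Suc_conv_app_nth)
  moreover have "drop ?k h = h ! ?k # drop (Suc ?k) h" using k(2) by (rule Cons_nth_drop_Suc[symmetric])
  ultimately show ?case
    using Suc k by (simp add: twist_def shift_def butlast_append)
qed

lemma twist_pow_length: "(twist N m ^^ length h) h = shift N m h"
  by (simp add: twist_pow_rotate)

lemma del_twist: "\<lbrakk>length h = Suc q; 0 < i; i \<le> q\<rbrakk> \<Longrightarrow> del i (twist N m h) = twist N m (del (i - 1) h)"
proof (cases i)
  case (Suc j)
  assume *: "length h = Suc q" "i \<le> q"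
  obtain xs y where h: "h = xs @ [y]" using *(1) by (cases h rule: rev_cases) auto
  show ?thesis using * Suc by (simp add: h twist_def del_snoc)
qed simp

lemma del_0_twist: "length h = Suc q \<Longrightarrow> del 0 (twist N m h) = del q h"
  by (cases h rule: rev_cases) (auto simp: twist_def del_length)

lemma del_twist_pow_le:
  "\<lbrakk>length h = Suc q; j \<le> i; i \<le> q; 0 < q\<rbrakk> \<Longrightarrow> del i ((twist N m ^^ j) h) = (twist N m ^^ j) (del (i - j) h)"
proof (induction j arbitrary: i)
  case (Suc j)
  then have "del i ((twist N m ^^ Suc j) h) = twist N m (del (i - 1) ((twist N m ^^ j) h))"
    by (simp, subst del_twist[of _ q]) (auto simp flip: length_greater_0_conv)
  also have "\<dots> = twist N m ((twist N m ^^ j) (del (i - 1 - j) h))"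
    using Suc by (subst Suc.IH) auto
  finally show ?case by simp
qed simp

lemma del_twist_pow_gt:
  assumes "length h = Suc q" "i < j" "j \<le> q"
  shows "del i ((twist N m ^^ j) h) = (twist N m ^^ (j - 1)) (del (q + 1 + i - j) h)"
proof -
  have h: "h \<noteq> []" using assms(1) by auto
  let ?g = "(twist N m ^^ (j - i - 1)) h"
  have "(twist N m ^^ j) h = (twist N m ^^ i) (twist N m ?g)"
    using assms by (metis Suc_diff_Suc add.commute diff_Suc_1 diff_Suc_eq_diff_pred funpow.simps(2) funpow_add le_add_diff_inverse less_imp_le_nat o_apply)
  then have "del i ((twist N m ^^ j) h) = (twist N m ^^ i) (del 0 (twist N m ?g))"
    using assms h by (simp add: del_twist_pow_le[of _ q])
  also have "del 0 (twist N m ?g) = del q ?g"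
    using assms h by (intro del_0_twist) simp
  also have "\<dots> = (twist N m ^^ (j - i - 1)) (del (q + 1 + i - j) h)"
    using assms by (subst del_twist_pow_le[of _ q]) (auto intro!: arg_cong2[of _ _ _ _ del])
  also have "(twist N m ^^ i) \<dots> = (twist N m ^^ (j - 1)) (del (q + 1 + i - j) h)"
    using assms by (simp flip: funpow_add[unfolded o_def, THEN fun_cong] add: funpow_add[unfolded o_def, symmetric, THEN fun_cong])
  finally show ?thesis .
qed

lemma neg_one_pow_cong: "even (a + b) \<Longrightarrow> (-1::int)^a = (-1)^b"
  by (auto simp: uminus_power_if)

text \<open>The identity $b' N = N b$. Moving a face past powers of \<open>t\<close> pairs the summands off bijectively,
  and no face has to pass a full turn; therefore the identity holds although $t^{q+1} \neq 1$.\<close>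

lemma bdry_norm_commute:
  assumes h: "length h = Suc q" and q: "0 < q"
  shows "(\<Sum>l\<le>q. \<Sum>i<q. frag_cmul (((-1)^q)^l * (-1)^i) (frag_of (del i ((twist N m ^^ l) h))))
    = (\<Sum>i\<le>q. \<Sum>l<q. frag_cmul ((-1)^i * ((-1)^(q-1))^l) (frag_of ((twist N m ^^ l) (del i h))))"
    (is "?L = ?R")
proof -
  have "?L = (\<Sum>(l,i)\<in>{..q} \<times> {..<q}. frag_cmul (((-1)^q)^l * (-1)^i) (frag_of (del i ((twist N m ^^ l) h))))"
    by (simp add: sum.cartesian_product)
  also have "\<dots> = (\<Sum>(i,l)\<in>{..q} \<times> {..<q}. frag_cmul ((-1)^i * ((-1)^(q-1))^l) (frag_of ((twist N m ^^ l) (del i h))))"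
    \<comment> \<open>The face \<open>i\<close> after \<open>l\<close> turns is \<open>l\<close> turns after the face \<open>i - l\<close>, or for \<open>i < l\<close> it is \<open>l - 1\<close>
       turns after the face \<open>q + 1 + i - l\<close>, one turn being used up in moving the entry to the front.\<close>
  proof (rule sum.reindex_bij_witness[where
        i = "\<lambda>(i,l). if i + l < q then (l, i + l) else (l + 1, i + l - q)" and
        j = "\<lambda>(l,i). if l \<le> i then (i - l, l) else (q + 1 + i - l, l - 1)"], goal_cases)
    case (5 a)
    obtain l i where a: "a = (l, i)" by fastforce
    have li: "l \<le> q" "i < q" using 5 a by auto
    show ?case
    proof (cases "l \<le> i")
      case True
      have "((-1::int)^(i - l) * ((-1)^(q-1))^l) = ((-1)^q)^l * (-1)^i"
        unfolding power_mult[symmetric] power_add[symmetric]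
        using True q by (intro neg_one_pow_cong) (auto simp: even_diff_nat)
      then show ?thesis using True li a h q by (simp add: del_twist_pow_le[of _ q])
    next
      case False
      have "((-1::int)^(q + 1 + i - l) * ((-1)^(q-1))^(l - 1)) = ((-1)^q)^l * (-1)^i"
        unfolding power_mult[symmetric] power_add[symmetric]
        using False q li by (intro neg_one_pow_cong) (auto simp: even_diff_nat)
      then show ?thesis using False li a h q by (simp add: del_twist_pow_gt[of _ q])
    qed
  qed auto
  also have "\<dots> = ?R"
    by (simp add: sum.cartesian_product)
  finally show ?thesis .
qed

lemma frag_extend_sum_fun: "lin (\<lambda>b. \<Sum>i\<in>I. f i b) c = (\<Sum>i\<in>I. lin (f i) c)"
  by (induction I rule: infinite_finite_induct) (auto simp: frag_extend_plus frag_extend_zero_fun)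

lemma frag_cmul_diff_distrib2: "frag_cmul a (x - y) = frag_cmul a x - frag_cmul a y"
  by (rule poly_mapping_eqI) (simp add: lookup_minus algebra_simps)

lemma frag_extend_cmul_fun: "lin (\<lambda>b. frag_cmul a (f b)) c = frag_cmul a (lin f c)"
  by (induction c rule: frag_induction[OF subset_UNIV])
    (auto simp: frag_extend_diff frag_cmul_diff_distrib2)

lemma frag_extend_uminus_fun: "lin (\<lambda>b. - f b) c = - lin f c"
  using frag_extend_minus_fun[of "\<lambda>_. 0" f c] by (simp add: frag_extend_zero_fun)

lemmas frag_extend_fun = frag_extend_plus frag_extend_minus_fun frag_extend_uminus_fun
  frag_extend_sum_fun frag_extend_cmul_fun frag_extend_zero_fun

section \<open>The triple complex\<close>

locale homogeneous =
  fixes N m :: nat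
  assumes N_pos: "0 < N"
begin

abbreviation "tup \<equiv> tuples (int N)"
abbreviation "sh \<equiv> shift (int N)"
abbreviation "tw \<equiv> twist (int N) (int m)"

text \<open>The four parts of the differential: along a column of the bicomplex, along a row, along the
  periodic resolution of the group, and the correction for the failure of the rows to be complexes.
  The correction goes two columns back and one step up in the resolution. The vertical map vanishes
  on tuples of length one, where \<open>aug_bdry\<close> would produce the augmentation; the others vanish where
  they would leave the first octant. In odd resolution degrees \<open>corr\<close> vanishes,
  because there $\gamma - 1$ followed by \<open>corr\<close> already makes up $\gamma^m - 1$.\<close>

definition vert :: "nat \<Rightarrow> int list \<Rightarrow> int list \<Rightarrow>\<^sub>0 int" where
  "vert p h = (if length h \<le> 1 then 0 else vert_cell (\<lambda>_. del) p (length h - 1) h)"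

definition horiz :: "nat \<Rightarrow> int list \<Rightarrow> int list \<Rightarrow>\<^sub>0 int" where
  "horiz p h = (if p = 0 then 0 else horiz_cell (\<lambda>_. tw) p (length h - 1) h)"

definition grp :: "nat \<Rightarrow> int list \<Rightarrow> int list \<Rightarrow>\<^sub>0 int" where
  "grp i h = (if i = 0 then 0 else if odd i then frag_of (sh 1 h) - frag_of h
            else (\<Sum>c<N. frag_of (sh (int c) h)))"

definition corr :: "nat \<Rightarrow> nat \<Rightarrow> int list \<Rightarrow> int list \<Rightarrow>\<^sub>0 int" where
  "corr p i h = (if p < 2 \<or> odd i then 0 else (\<Sum>c<m. frag_of (sh (int c) h)))"

lemma tupD: "h \<in> tup (Suc q) \<Longrightarrow> h \<noteq> [] \<and> length h = Suc q"
  by (auto simp: tuples_def)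

lemma vert_even: "even p \<Longrightarrow> vert p h = (if length h \<le> 1 then 0 else aug_bdry h)"
  by (cases h) (auto simp: vert_def vert_cell_def aug_bdry_def lessThan_Suc_atMost)

lemma vert_odd: "odd p \<Longrightarrow> h \<noteq> [] \<Longrightarrow> vert p h = - push (\<lambda>z. z @ [last h]) (aug_bdry (butlast h))"
  by (cases h rule: rev_cases)
    (auto simp: vert_def vert_cell_def aug_bdry_def frag_extend_linear del_snoc)

lemma vert_chains: assumes "h \<in> tup (Suc q)" shows "vert p h \<in> chains (tup q)"
proof (cases "odd p")
  case True
  have "butlast h \<in> tup q" using assms by (auto simp: tuples_def dest: in_set_butlastD)
  then have *: "aug_bdry (butlast h) \<in> chains (tup (q - 1))" by (rule aug_bdry_chains)
  have "push (\<lambda>z. z @ [last h]) (aug_bdry (butlast h)) \<in> chains (tup q)"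
  proof (cases q)
    case 0
    then show ?thesis using assms by (auto simp: tuples_def length_Suc_conv)
  next
    case (Suc r)
    have "last h \<in> set h" using tupD[OF assms] by simp
    then show ?thesis using Suc assms by (intro push_chains[OF *]) (auto simp: tuples_def)
  qed
  then show ?thesis using True vert_odd[of p h] tupD[OF assms] by simp
next
  case False
  then show ?thesis using aug_bdry_chains[OF assms] by (simp add: vert_even)
qed

lemma horiz_chains: "h \<in> tup (Suc q) \<Longrightarrow> horiz p h \<in> chains (tup (Suc q))"
  unfolding horiz_def horiz_cell_def using N_pos
  by (auto intro!: chains_sum chains_cmul chains_diff)

lemma grp_chains: "h \<in> tup q \<Longrightarrow> grp i h \<in> chains (tup q)"
  unfolding grp_def using N_pos by (auto intro!: chains_sum chains_diff)

lemma corr_chains: "h \<in> tup q \<Longrightarrow> corr p i h \<in> chains (tup q)"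
  unfolding corr_def using N_pos by (auto intro!: chains_sum)

text \<open>All structure maps commute with translations, of which \<open>grp\<close> and \<open>corr\<close> are linear
  combinations.\<close>

lemma vert_shift: "vert p (sh c h) = push (sh c) (vert p h)"
proof -
  have "push (sh c) (vert_cell (\<lambda>_. del) p (length h - 1) h) = vert_cell (\<lambda>_. del) p (length h - 1) (sh c h)"
    by (rule vert_cell_natural) (simp add: shift_def map_del)
  then show ?thesis by (simp add: vert_def)
qed

lemma horiz_shift: assumes "h \<noteq> []" shows "horiz p (sh c h) = push (sh c) (horiz p h)"
proof -
  have "push (sh c) (horiz_cell (\<lambda>_. tw) p (length h - 1) h) = horiz_cell (\<lambda>_. tw) p (length h - 1) (sh c h)"
    by (rule horiz_cell_natural) (simp add: shift_twist_pow assms)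
  then show ?thesis by (simp add: horiz_def)
qed

lemma vert_grp: "lin (vert p) (grp i h) = lin (grp i) (vert p h)"
  unfolding grp_def by (auto simp: frag_extend_linear frag_extend_fun vert_shift)

lemma horiz_grp: "h \<noteq> [] \<Longrightarrow> lin (horiz p) (grp i h) = lin (grp i) (horiz p h)"
  unfolding grp_def by (auto simp: frag_extend_linear frag_extend_fun horiz_shift)

lemma vert_corr: "lin (vert p) (corr p' i h) = lin (corr p' i) (vert p h)"
  unfolding corr_def by (auto simp: frag_extend_linear frag_extend_fun vert_shift)

lemma horiz_corr: "h \<noteq> [] \<Longrightarrow> lin (horiz p) (corr p' i h) = lin (corr p' i) (horiz p h)"
  unfolding corr_def by (auto simp: frag_extend_linear frag_extend_fun horiz_shift)

lemma vert_vert: assumes "h \<in> tup (Suc q)" shows "lin (vert p) (vert p h) = 0"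
proof (cases "odd p")
  case True
  obtain xs y where h: "h = xs @ [y]" using tupD[OF assms] by (cases h rule: rev_cases) auto
  have "lin (vert p) (vert p h) = - lin (\<lambda>z. vert p (z @ [y])) (aug_bdry xs)"
    using True by (simp add: h vert_odd[of p "xs @ [y]"] frag_extend_linear frag_extend_push)
  also have "\<dots> = push (\<lambda>z. z @ [y]) (lin aug_bdry (aug_bdry xs))"
    using True by (simp add: vert_odd frag_extend_fun frag_extend_frag_extend)
  finally show ?thesis by (simp add: aug_bdry_aug_bdry)
next
  case False
  show ?thesis
  proof (cases "q \<le> 1")
    case True
    have "lin (vert p) c = 0" if "c \<in> chains (tup q)" for c
      using frag_extend_cong[OF that, of "vert p" "\<lambda>_. 0"] True
      by (auto simp: vert_def tuples_def frag_extend_fun)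
    then show ?thesis using vert_chains[OF assms] by blast
  next
    case q: False
    have "lin (vert p) (vert p h) = lin aug_bdry (vert p h)"
      using q False by (intro frag_extend_cong[OF vert_chains[OF assms]]) (auto simp: vert_even tuples_def)
    then show ?thesis using False by (simp add: vert_even aug_bdry_aug_bdry)
  qed
qed

text \<open>The sum telescopes to $1 - \tau^{q+1}$, and $\tau^{q+1}$ is translation by \<open>m\<close> because the
  sign $(-1)^{q(q+1)}$ is 1.\<close>

lemma norm_alternating:
  assumes "h \<in> tup (Suc q)"
  shows "(\<Sum>l\<le>q. frag_cmul (((-1)^q)^l) (frag_of ((tw ^^ l) h)) -
           frag_cmul ((-1)^q * ((-1)^q)^l) (frag_of (tw ((tw ^^ l) h)))) = frag_of h - frag_of (sh (int m) h)"
proof -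
  let ?f = "\<lambda>l. frag_cmul (((-1)^q)^l) (frag_of ((tw ^^ l) h))"
  have "?f (Suc q) = frag_of (sh (int m) h)"
    using twist_pow_length[where N="int N" and m="int m" and h=h] tupD[OF assms]
    by (simp add: power_mult[symmetric] power_add[symmetric] uminus_power_if)
  moreover have "(\<Sum>l<Suc q. ?f l - ?f (Suc l)) = ?f 0 - ?f (Suc q)"
    by (rule sum_lessThan_telescope')
  ultimately show ?thesis
    by (simp add: lessThan_Suc_atMost)
qed

lemma horiz_horiz:
  assumes h: "h \<in> tup (Suc q)" and p: "2 \<le> p"
  shows "lin (horiz (p - 1)) (horiz p h) = frag_of h - frag_of (sh (int m) h)"
proof -
  have len: "length h = Suc q" "h \<noteq> []" using tupD[OF h] by auto
  show ?thesis
  proof (cases "odd p")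
    case True
    then have "odd p" "even (p - 1)" "p - 1 \<noteq> 0" "p \<noteq> 0" using p by auto
    then have "lin (horiz (p - 1)) (horiz p h) =
       (\<Sum>l\<le>q. frag_cmul (((-1)^q)^l) (frag_of ((tw ^^ l) h)) -
           frag_cmul ((-1)^q * ((-1)^q)^l) (frag_of (tw ((tw ^^ l) h))))"
      unfolding horiz_def using len
      by (simp add: horiz_cell_def frag_extend_linear sum_subtractf frag_cmul_sum funpow_swap1)
    then show ?thesis by (simp only: norm_alternating[OF h])
  next
    case False
    then have "even p" "odd (p - 1)" "p - 1 \<noteq> 0" "p \<noteq> 0" using p by (auto intro: ccontr)
    then have "lin (horiz (p - 1)) (horiz p h) =
       (\<Sum>l\<le>q. frag_cmul (((-1)^q)^l) (frag_of ((tw ^^ l) h)) -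
           frag_cmul ((-1)^q * ((-1)^q)^l) (frag_of (tw ((tw ^^ l) h))))"
      unfolding horiz_def using len
      by (simp add: horiz_cell_def frag_extend_linear frag_cmul_diff_distrib2 mult.commute)
    then show ?thesis by (simp only: norm_alternating[OF h])
  qed
qed

lemma vert_horiz:
  assumes h: "h \<in> tup (Suc q)" and p: "1 \<le> p"
  shows "lin (vert (p - 1)) (horiz p h) + lin (horiz p) (vert p h) = 0"
proof (cases "q = 0")
  case True
  then have "vert p h = 0" using h by (simp add: vert_def tuples_def)
  moreover have "lin (vert (p - 1)) (horiz p h) = 0"
    using frag_extend_cong[OF horiz_chains[OF h], of "vert (p - 1)" "\<lambda>_. 0"] True
    by (auto simp: vert_def tuples_def frag_extend_fun)
  ultimately show ?thesis by simp
next
  case False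
  then have q: "0 < q" by simp
  have len: "length h = Suc q" "h \<noteq> []" using tupD[OF h] by auto
  show ?thesis
  proof (cases "odd p")
    case True
    then have p': "even (p - 1)" "p \<noteq> 0" using p by auto
    obtain xs y where hx: "h = xs @ [y]" using len by (cases h rule: rev_cases) auto
    have xs: "length xs = q" "xs \<noteq> []" using len q hx by auto
    define y' where "y' = (y + int m) mod int N"
    have tw: "tw (z @ [y]) = y' # z" for z by (simp add: twist_def y'_def)
    have c: "aug_bdry xs \<in> chains (tup (q - 1))"
      using h xs(1) by (intro aug_bdry_chains) (auto simp: tuples_def hx)
    have "lin (horiz p) (vert p h) = - lin (\<lambda>z. horiz p (z @ [y])) (aug_bdry xs)"
      using True by (simp add: hx vert_odd frag_extend_linear frag_extend_push)
    also have "lin (\<lambda>z. horiz p (z @ [y])) (aug_bdry xs)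
       = lin (\<lambda>z. frag_of (z @ [y]) - frag_cmul ((-1)^(q - 1)) (frag_of (y' # z))) (aug_bdry xs)"
      using True p' by (intro frag_extend_cong[OF c]) (auto simp: horiz_def horiz_cell_def tw tuples_def)
    also have "\<dots> = push (\<lambda>z. z @ [y]) (aug_bdry xs) + frag_cmul ((-1)^q) (push ((#) y') (aug_bdry xs))"
      using q by (cases q) (simp_all add: frag_extend_fun)
    finally have 1: "lin (horiz p) (vert p h) =
       - (push (\<lambda>z. z @ [y]) (aug_bdry xs) + frag_cmul ((-1)^q) (push ((#) y') (aug_bdry xs)))" .
    have "horiz p h = frag_of (xs @ [y]) - frag_cmul ((-1)^q) (frag_of (y' # xs))"
      using True p' len xs by (simp add: horiz_def horiz_cell_def tw hx)
    then have "lin (vert (p - 1)) (horiz p h) =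
       aug_bdry (xs @ [y]) - frag_cmul ((-1)^q) (aug_bdry (y' # xs))"
      using p' q len xs by (simp add: frag_extend_linear vert_even)
    also have "\<dots> = push (\<lambda>z. z @ [y]) (aug_bdry xs) + frag_cmul ((-1)^q) (push ((#) y') (aug_bdry xs))"
      by (simp add: aug_bdry_snoc aug_bdry_Cons xs frag_cmul_diff_distrib2)
    finally show ?thesis by (simp only: 1 right_minus)
  next
    case False
    then have p': "even p" "odd (p - 1)" "p \<noteq> 0" using p by auto
    have "lin (vert (p - 1)) (horiz p h) =
       - (\<Sum>l\<le>q. \<Sum>i<q. frag_cmul (((-1)^q)^l * (-1)^i) (frag_of (del i ((tw ^^ l) h))))"
      using p' len q by (simp add: horiz_def vert_def horiz_cell_def vert_cell_def frag_extend_linear sum_negf[symmetric] frag_cmul_sum)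
    moreover have "lin (horiz p) (vert p h) =
       (\<Sum>i\<le>q. \<Sum>l<q. frag_cmul ((-1)^i * ((-1)^(q-1))^l) (frag_of ((tw ^^ l) (del i h))))"
      using p' len q by (simp add: horiz_def vert_def horiz_cell_def vert_cell_def frag_extend_linear frag_cmul_sum
          atMost_atLeast0 lessThan_atLeast0 atLeastLessThanSuc_atLeastAtMost[symmetric])
    ultimately show ?thesis using bdry_norm_commute[OF len(1) q, of "int N" "int m"] by simp
  qed
qed

lemma shift_telescope:
  assumes "h \<in> tup q"
  shows "(\<Sum>c<k. frag_of (sh (int c + 1) h) - frag_of (sh (int c) h)) = frag_of (sh (int k) h) - frag_of h"
proof -
  have "(\<Sum>c<k. frag_of (sh (int (Suc c)) h) - frag_of (sh (int c) h)) = frag_of (sh (int k) h) - frag_of (sh (int 0) h)"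
    by (rule sum_lessThan_telescope)
  then show ?thesis using shift_multiple[OF assms, of 0] by (simp add: add.commute)
qed

lemma grp_grp: assumes h: "h \<in> tup q" shows "lin (grp (i - 1)) (grp i h) = 0"
proof (cases "i \<le> 1")
  case True
  then have "grp (i - 1) = (\<lambda>h. 0)" by (auto simp: grp_def)
  then show ?thesis by (simp add: frag_extend_fun)
next
  case False
  then have *: "(\<Sum>c<N. frag_of (sh (int c + 1) h) - frag_of (sh (int c) h)) = 0"
    using shift_telescope[OF h, of N] shift_multiple[OF h, of "int N"] by simp
  show ?thesis
    using False * by (auto simp: grp_def frag_extend_linear shift_shift sum_subtractf add.commute)
qed

text \<open>Again a telescoping sum, $(\gamma - 1)(1 + \dots + \gamma^{m-1}) = \gamma^m - 1$. It cancels the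
  square of the horizontal map in \<open>horiz_horiz\<close>.\<close>

lemma grp_corr:
  assumes h: "h \<in> tup q" and p: "2 \<le> p"
  shows "lin (grp (Suc i)) (corr p i h) + lin (corr p (i - 1)) (grp i h) = frag_of (sh (int m) h) - frag_of h"
proof (cases "even i")
  case True
  have "lin (corr p (i - 1)) (grp i h) = 0"
  proof (cases "i = 0")
    case False
    then have "corr p (i - 1) = (\<lambda>_. 0)" using True by (auto simp: corr_def)
    then show ?thesis by (simp add: frag_extend_fun)
  qed (simp add: grp_def)
  moreover have "lin (grp (Suc i)) (corr p i h) = (\<Sum>c<m. frag_of (sh (int c + 1) h) - frag_of (sh (int c) h))"
    using True p by (simp add: grp_def corr_def frag_extend_linear shift_shift add.commute)
  ultimately show ?thesis using shift_telescope[OF h, of m] by simp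
next
  case False
  moreover have "i \<noteq> 0" "even (i - 1)" using False by (cases i; simp)+
  ultimately have "lin (corr p (i - 1)) (grp i h) = (\<Sum>c<m. frag_of (sh (int c + 1) h) - frag_of (sh (int c) h))"
    using p by (simp add: grp_def corr_def frag_extend_linear shift_shift sum_subtractf)
  then show ?thesis using False shift_telescope[OF h, of m] by (simp add: corr_def)
qed

lemma corr_corr: "lin (corr p' (Suc i)) (corr p i h) = 0"
proof (cases "odd i")
  case False
  then have "corr p' (Suc i) = (\<lambda>_. 0)" by (simp add: corr_def fun_eq_iff)
  then show ?thesis by (simp add: frag_extend_fun)
qed (simp add: corr_def)

text \<open>Every orbit contains exactly one tuple \<open>y\<close> that starts with 0, and \<open>h\<close> is its translate by \<open>hd h\<close>.
  The contraction is the standard one of the periodic resolution: in even degrees $\gamma^j y$ goes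
  to $(1 + \dots + \gamma^{j-1}) y$, in odd degrees $\gamma^{N-1} y$ goes to $y$ and the other
  translates to 0.\<close>

definition grp_contr :: "nat \<Rightarrow> int list \<Rightarrow> int list \<Rightarrow>\<^sub>0 int" where
  "grp_contr i h = (if even i then (\<Sum>l<nat (hd h). frag_of (sh (int l - hd h) h))
            else if hd h = int N - 1 then frag_of (sh (- hd h) h) else 0)"

lemma grp_contr_chains: "h \<in> tup q \<Longrightarrow> grp_contr i h \<in> chains (tup q)"
  unfolding grp_contr_def using N_pos by (auto intro!: chains_sum)

lemma hd_shift: "h \<noteq> [] \<Longrightarrow> hd (sh c h) = (hd h + c) mod int N"
  by (cases h) (auto simp: shift_def)

lemma hd_tup: "h \<in> tup (Suc q) \<Longrightarrow> 0 \<le> hd h \<and> hd h < int N"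
  by (cases h) (auto simp: tuples_def)

lemma sum_nat_int: "0 \<le> x \<Longrightarrow> (\<Sum>l<nat (x + 1). f l) = (\<Sum>l<nat x. f l) + f (nat x)" for f :: "nat \<Rightarrow> 'x :: comm_monoid_add"
  by (simp add: nat_add_distrib)

text \<open>The correction at \<open>i = 0\<close> is the projection of a tuple to the representative of its orbit.\<close>

lemma grp_grp_contr:
  assumes h: "h \<in> tup (Suc q)"
  shows "lin (grp (Suc i)) (grp_contr i h) + lin (grp_contr (i - 1)) (grp i h)
    = frag_of h - (if i = 0 then frag_of (sh (- hd h) h) else 0)"
proof -
  have h0: "h \<noteq> []" using tupD[OF h] by simp
  have hd: "0 \<le> hd h" "hd h < int N" using hd_tup[OF h] by auto
  let ?y = "sh (- hd h) h"
  have y: "?y \<in> tup (Suc q)" using h N_pos by simp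
  have sh_y: "sh c ?y = sh (c - hd h) h" for c by (simp add: shift_shift)
  have even_grp_contr: "grp_contr j (sh c h) = (\<Sum>l<nat ((hd h + c) mod int N). frag_of (sh (int l) ?y))" if "even j" for c j
  proof -
    have "sh (int l - (hd h + c) mod int N) (sh c h) = sh (int l) ?y" for l
      unfolding shift_shift
    proof (rule shift_cong)
      have "(int l + c - (hd h + c) mod int N) mod int N = (int l + c - (hd h + c)) mod int N"
        by (rule mod_diff_right_eq)
      then show "(int l - (hd h + c) mod int N + c) mod int N = (int l + - hd h) mod int N"
        by (simp add: algebra_simps)
    qed
    then show ?thesis using that h0 by (simp add: grp_contr_def hd_shift)
  qed
  have sh0: "sh 0 h = h" by (rule shift_multiple[OF h]) simp
  have GK: "lin (grp (Suc i)) (grp_contr i h) = frag_of h - frag_of ?y" if "even i"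
  proof -
    have "lin (grp (Suc i)) (grp_contr i h) =
       (\<Sum>l<nat (hd h). frag_of (sh (int l + 1) ?y) - frag_of (sh (int l) ?y))"
      using that by (simp add: grp_contr_def grp_def frag_extend_linear shift_shift algebra_simps)
    also have "\<dots> = frag_of (sh (int (nat (hd h))) ?y) - frag_of ?y" by (rule shift_telescope[OF y])
    also have "sh (int (nat (hd h))) ?y = h" using hd by (simp add: shift_shift sh0)
    finally show ?thesis .
  qed
  consider (zero) "i = 0" | (even) "even i" "i \<noteq> 0" | (odd) "odd i" by blast
  then show ?thesis
  proof cases
    case zero
    then show ?thesis using GK by (simp add: grp_def)
  next
    case even
    then have i: "odd (i - 1)" by auto
    have "lin (grp_contr (i - 1)) (grp i h) =
       (\<Sum>c<N. if (hd h + int c) mod int N = int N - 1 then frag_of (sh (- ((hd h + int c) mod int N)) (sh (int c) h)) else 0)"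
      using even i h0 by (simp add: grp_def grp_contr_def frag_extend_linear hd_shift cong: if_cong)
    \<comment> \<open>Exactly one translate of \<open>h\<close> starts with the last exponent, and \<open>grp_contr\<close> sends it to \<open>?y\<close>.\<close>
    also have "\<dots> = (\<Sum>c<N. if c = nat (int N - 1 - hd h) then frag_of ?y else 0)"
    proof (rule sum.cong[OF refl])
      fix c assume c: "c \<in> {..<N}"
      have 1: "(hd h + int c) mod int N = int N - 1 \<longleftrightarrow> c = nat (int N - 1 - hd h)"
      proof (cases "hd h + int c < int N")
        case True
        then have "(hd h + int c) mod int N = hd h + int c" using hd by simp
        then show ?thesis using hd by arith
      next
        case False
        have "(hd h + int c - int N) mod int N = hd h + int c - int N"
          by (rule mod_pos_pos_trivial) (use False c hd in auto)
        then have "(hd h + int c) mod int N = hd h + int c - int N" by simp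
        then show ?thesis using False hd c by auto
      qed
      have 2: "sh (- ((hd h + int c) mod int N)) (sh (int c) h) = ?y"
        unfolding shift_shift
      proof (rule shift_cong)
        have "(int c - (hd h + int c) mod int N) mod int N = (int c - (hd h + int c)) mod int N"
          by (rule mod_diff_right_eq)
        then show "(- ((hd h + int c) mod int N) + int c) mod int N = (- hd h) mod int N" by simp
      qed
      show "(if (hd h + int c) mod int N = int N - 1 then frag_of (sh (- ((hd h + int c) mod int N)) (sh (int c) h)) else 0)
         = (if c = nat (int N - 1 - hd h) then frag_of ?y else 0)"
        by (simp only: 1 2)
    qed
    also have "\<dots> = frag_of ?y" using hd by (simp add: sum.delta')
    finally show ?thesis using GK even by simp
  next
    case odd
    then have i: "i \<noteq> 0" "even (i - 1)" by (cases i; simp)+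
    have "lin (grp_contr (i - 1)) (grp i h) = grp_contr (i - 1) (sh 1 h) - grp_contr (i - 1) (sh 0 h)"
      using odd i(1) by (simp add: grp_def frag_extend_linear sh0)
    also have "\<dots> = (\<Sum>l<nat ((hd h + 1) mod int N). frag_of (sh (int l) ?y)) - (\<Sum>l<nat (hd h). frag_of (sh (int l) ?y))"
      unfolding even_grp_contr[OF i(2)] using hd by simp
    finally have KG: "lin (grp_contr (i - 1)) (grp i h) = \<dots>" .
    show ?thesis
    proof (cases "hd h = int N - 1")
      case True
      then have "lin (grp (Suc i)) (grp_contr i h) = (\<Sum>l<Suc (nat (hd h)). frag_of (sh (int l) ?y))"
        using odd hd N_pos by (simp add: grp_contr_def grp_def Suc_nat_eq_nat_zadd1 del: sum.lessThan_Suc)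
      also have "\<dots> = (\<Sum>l<nat (hd h). frag_of (sh (int l) ?y)) + frag_of h"
        using hd by (simp add: shift_shift sh0)
      finally show ?thesis using KG True i by simp
    next
      case False
      then have "(hd h + 1) mod int N = hd h + 1" using hd by simp
      then have "lin (grp_contr (i - 1)) (grp i h) = frag_of h"
        using KG hd by (simp add: sum_nat_int shift_shift sh0)
      then show ?thesis using odd False i by (simp add: grp_contr_def)
    qed
  qed
qed

end

context homogeneous
begin

text \<open>A basis element of the triple complex consists of a column \<open>p\<close>, a degree \<open>i\<close> of the periodic
  resolution and a tuple. The sign makes the last two parts of \<open>tri_d\<close> anticommute with the
  first two; it is the same in columns \<open>p\<close> and \<open>p - 2\<close>.\<close>

abbreviation cell :: "nat \<Rightarrow> nat \<Rightarrow> (int list \<Rightarrow>\<^sub>0 int) \<Rightarrow> (nat \<times> nat \<times> int list \<Rightarrow>\<^sub>0 int)" where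
  "cell p i \<equiv> push (\<lambda>h. (p, i, h))"

definition tot_sign :: "nat \<Rightarrow> nat \<Rightarrow> int" where
  "tot_sign p l = (-1) ^ Suc (p + l)"

definition tri_d :: "nat \<times> nat \<times> int list \<Rightarrow> (nat \<times> nat \<times> int list \<Rightarrow>\<^sub>0 int)" where
  "tri_d = (\<lambda>(p, i, h). cell p i (vert p h) + cell (p - 1) i (horiz p h)
     + frag_cmul (tot_sign p (length h)) (cell p (i - 1) (grp i h))
     + frag_cmul (tot_sign p (length h)) (cell (p - 2) (Suc i) (corr p i h)))"

definition tri_basis :: "nat \<Rightarrow> (nat \<times> nat \<times> int list) set" where
  "tri_basis n = {(p, i, h). \<exists>q. h \<in> tup (Suc q) \<and> p + i + q = n}"

lemma cell_ext: "cell p i (lin F c) = lin (\<lambda>h. cell p i (F h)) c"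
  by (simp add: frag_extend_frag_extend)

lemma tri_d_cell:
  assumes "c \<in> chains (tup l)"
  shows "lin tri_d (cell p i c) = cell p i (lin (vert p) c) + cell (p - 1) i (lin (horiz p) c)
     + frag_cmul (tot_sign p l) (cell p (i - 1) (lin (grp i) c))
     + frag_cmul (tot_sign p l) (cell (p - 2) (Suc i) (lin (corr p i) c))"
proof -
  have "lin tri_d (cell p i c) = lin (\<lambda>h. cell p i (vert p h) + cell (p - 1) i (horiz p h)
     + frag_cmul (tot_sign p l) (cell p (i - 1) (grp i h)) + frag_cmul (tot_sign p l) (cell (p - 2) (Suc i) (corr p i h))) c"
    unfolding frag_extend_push
    by (rule frag_extend_cong[OF assms]) (auto simp: tri_d_def tuples_def)
  then show ?thesis by (simp add: frag_extend_fun cell_ext)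
qed

lemma vert_parity: "even p = even p' \<Longrightarrow> vert p h = vert p' h"
  by (simp add: vert_def vert_cell_def)

lemma horiz_parity: "even p = even p' \<Longrightarrow> 0 < p \<Longrightarrow> 0 < p' \<Longrightarrow> horiz p h = horiz p' h"
  by (simp add: horiz_def horiz_cell_def)

lemma corr_large: "2 \<le> p \<Longrightarrow> 2 \<le> p' \<Longrightarrow> corr p i h = corr p' i h"
  by (simp add: corr_def)

lemma horiz_0 [simp]: "horiz 0 = (\<lambda>_. 0)" by (simp add: horiz_def fun_eq_iff)
lemma grp_0 [simp]: "grp 0 = (\<lambda>_. 0)" by (simp add: grp_def fun_eq_iff)
lemma corr_small: "p < 2 \<Longrightarrow> corr p i = (\<lambda>_. 0)" by (simp add: corr_def fun_eq_iff)

text \<open>Of the sixteen composites, three vanish, ten cancel in pairs because the parts commute up to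
  sign, and the remaining three are $1 - \gamma^m$ from the rows and $\gamma^m - 1$ from
  \<open>grp_corr\<close>.\<close>

lemma tri_d_tri_d:
  assumes h: "h \<in> tup (Suc q)"
  shows "lin tri_d (tri_d (p, i, h)) = 0"
proof -
  let ?s = "tot_sign p (Suc q)"
  have len: "length h = Suc q" "h \<noteq> []" using tupD[OF h] by auto
  have ss: "?s * ?s = 1" by (simp add: tot_sign_def power_add[symmetric] power_mult_distrib[symmetric])
  note C = vert_chains[OF h, of p] horiz_chains[OF h, of p] grp_chains[OF h, of i] corr_chains[OF h, of p i]
  have tri_d: "tri_d (p, i, h) = cell p i (vert p h) + cell (p - 1) i (horiz p h)
     + frag_cmul ?s (cell p (i - 1) (grp i h)) + frag_cmul ?s (cell (p - 2) (Suc i) (corr p i h))"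
    by (simp add: tri_d_def len)
  have e: "lin tri_d (tri_d (p, i, h)) =
      cell p i (lin (vert p) (vert p h)) + cell (p - 1) i (lin (horiz p) (vert p h))
      + frag_cmul (tot_sign p q) (cell p (i - 1) (lin (grp i) (vert p h)))
      + frag_cmul (tot_sign p q) (cell (p - 2) (Suc i) (lin (corr p i) (vert p h)))
      + (cell (p - 1) i (lin (vert (p - 1)) (horiz p h)) + cell (p - 1 - 1) i (lin (horiz (p - 1)) (horiz p h))
      + frag_cmul (tot_sign (p - 1) (Suc q)) (cell (p - 1) (i - 1) (lin (grp i) (horiz p h)))
      + frag_cmul (tot_sign (p - 1) (Suc q)) (cell (p - 1 - 2) (Suc i) (lin (corr (p - 1) i) (horiz p h))))
      + (frag_cmul ?s (cell p (i - 1) (lin (vert p) (grp i h)))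
      + frag_cmul ?s (cell (p - 1) (i - 1) (lin (horiz p) (grp i h)))
      + cell p (i - 1 - 1) (lin (grp (i - 1)) (grp i h))
      + cell (p - 2) (Suc (i - 1)) (lin (corr p (i - 1)) (grp i h)))
      + (frag_cmul ?s (cell (p - 2) (Suc i) (lin (vert (p - 2)) (corr p i h)))
      + frag_cmul ?s (cell (p - 2 - 1) (Suc i) (lin (horiz (p - 2)) (corr p i h)))
      + frag_cmul (?s * tot_sign (p - 2) (Suc q)) (cell (p - 2) i (lin (grp (Suc i)) (corr p i h)))
      + frag_cmul (?s * tot_sign (p - 2) (Suc q)) (cell (p - 2 - 2) (Suc (Suc i)) (lin (corr (p - 2) (Suc i)) (corr p i h))))"
    unfolding tri_d frag_extend_linear tri_d_cell[OF C(1)] tri_d_cell[OF C(2)] tri_d_cell[OF C(3)] tri_d_cell[OF C(4)]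
    by (simp add: frag_cmul_distrib2 ss)
  have 1: "lin (vert p) (vert p h) = 0" by (rule vert_vert[OF h])
  have 2: "cell (p - 1) i (lin (horiz p) (vert p h)) = - cell (p - 1) i (lin (vert (p - 1)) (horiz p h))"
  proof (cases "p = 0")
    case False
    then have "lin (horiz p) (vert p h) = - lin (vert (p - 1)) (horiz p h)"
      using vert_horiz[OF h, of p] by (simp add: eq_neg_iff_add_eq_0 add.commute)
    then show ?thesis by (simp add: frag_extend_minus)
  qed (simp add: frag_extend_fun)
  have 3: "frag_cmul (tot_sign p q) (cell p (i - 1) (lin (grp i) (vert p h)))
      = - frag_cmul ?s (cell p (i - 1) (lin (vert p) (grp i h)))"
    by (simp add: vert_grp tot_sign_def)
  have 4: "frag_cmul (tot_sign p q) (cell (p - 2) (Suc i) (lin (corr p i) (vert p h)))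
      = - frag_cmul ?s (cell (p - 2) (Suc i) (lin (vert (p - 2)) (corr p i h)))"
  proof (cases "p < 2")
    case False
    then have "vert (p - 2) = vert p" by (intro ext vert_parity) auto
    then show ?thesis by (simp add: vert_corr tot_sign_def)
  qed (simp add: corr_small frag_extend_fun)
  have 5: "cell (p - 1 - 1) i (lin (horiz (p - 1)) (horiz p h))
      = - cell (p - 2) (Suc (i - 1)) (lin (corr p (i - 1)) (grp i h))
        - frag_cmul (?s * tot_sign (p - 2) (Suc q)) (cell (p - 2) i (lin (grp (Suc i)) (corr p i h)))"
  proof (cases "p < 2")
    case True
    then have "p = 0 \<or> p = 1" by auto
    then show ?thesis using True by (auto simp: corr_small frag_extend_fun)
  next
    case False
    then have p: "2 \<le> p" by simp
    have s: "?s * tot_sign (p - 2) (Suc q) = 1"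
      unfolding tot_sign_def power_add[symmetric] using p by (simp add: uminus_power_if)
    have i: "cell (p - 2) (Suc (i - 1)) (lin (corr p (i - 1)) (grp i h))
       = cell (p - 2) i (lin (corr p (i - 1)) (grp i h))"
      by (cases i) auto
    have "cell (p - 2) i (lin (grp (Suc i)) (corr p i h) + lin (corr p (i - 1)) (grp i h))
      = - cell (p - 2) i (lin (horiz (p - 1)) (horiz p h))"
      unfolding grp_corr[OF h p] horiz_horiz[OF h p] by (simp add: frag_extend_linear)
    moreover have neg: "c = - b - a" if "a + b = - c" for a b c :: "nat \<times> nat \<times> int list \<Rightarrow>\<^sub>0 int"
    proof -
      have "c = - (a + b)" using that by simp
      then show ?thesis by simp
    qed
    ultimately show ?thesis
      unfolding s i frag_extend_linear by (simp add: neg numeral_2_eq_2)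
  qed
  have 6: "frag_cmul (tot_sign (p - 1) (Suc q)) (cell (p - 1) (i - 1) (lin (grp i) (horiz p h)))
      = - frag_cmul ?s (cell (p - 1) (i - 1) (lin (horiz p) (grp i h)))"
    by (cases p) (simp_all add: horiz_grp[OF len(2)] tot_sign_def frag_extend_fun)
  have 7: "frag_cmul (tot_sign (p - 1) (Suc q)) (cell (p - 1 - 2) (Suc i) (lin (corr (p - 1) i) (horiz p h)))
      = - frag_cmul ?s (cell (p - 2 - 1) (Suc i) (lin (horiz (p - 2)) (corr p i h)))"
  proof (cases "p < 3")
    case True
    then consider "p < 2" | "p = 2" by linarith
    then show ?thesis by cases (auto simp: corr_small frag_extend_fun)
  next
    case False
    then have "horiz (p - 2) = horiz p" "corr (p - 1) i = corr p i"
      by (auto intro!: ext horiz_parity corr_large)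
    moreover have "tot_sign (p - 1) (Suc q) = - ?s" using False by (cases p) (auto simp: tot_sign_def)
    ultimately show ?thesis by (simp add: horiz_corr[OF len(2)] numeral_eq_Suc)
  qed
  have 8: "lin (grp (i - 1)) (grp i h) = 0" by (rule grp_grp[OF h])
  have 9: "lin (corr (p - 2) (Suc i)) (corr p i h) = 0" by (rule corr_corr)
  show ?thesis
    unfolding e 1 2 3 4 5 6 7 8 9 by (simp del: minus_frag_cmul)
qed

lemma cell_chains: "c \<in> chains (tup (Suc q)) \<Longrightarrow> p + i + q = n \<Longrightarrow> cell p i c \<in> chains (tri_basis n)"
  by (rule push_chains) (auto simp: tri_basis_def)

lemma tri_d_chains:
  assumes h: "h \<in> tup (Suc q)" and n: "p + i + q = Suc n"
  shows "tri_d (p, i, h) \<in> chains (tri_basis n)"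
proof -
  have "cell p i (vert p h) \<in> chains (tri_basis n)"
  proof (cases q)
    case 0
    then show ?thesis using h by (simp add: vert_def tuples_def)
  next
    case (Suc r)
    then show ?thesis using vert_chains[OF h] n by (intro cell_chains[of _ r]) auto
  qed
  moreover have "cell (p - 1) i (horiz p h) \<in> chains (tri_basis n)"
    by (cases p) (use horiz_chains[OF h] n in \<open>auto intro!: cell_chains[of _ q]\<close>)
  moreover have "cell p (i - 1) (grp i h) \<in> chains (tri_basis n)"
    by (cases i) (use grp_chains[OF h] n in \<open>auto intro!: cell_chains[of _ q]\<close>)
  moreover have "cell (p - 2) (Suc i) (corr p i h) \<in> chains (tri_basis n)"
    by (cases "p < 2") (use corr_chains[OF h] n in \<open>auto simp: corr_small intro!: cell_chains[of _ q]\<close>)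
  ultimately show ?thesis by (simp add: tri_d_def)
qed

lemma based_complex_tri: "based_complex tri_basis tri_d"
  unfolding based_complex_def
proof (intro conjI allI ballI)
  fix n b assume "b \<in> tri_basis (Suc n)"
  then obtain p i h q where "b = (p, i, h)" "h \<in> tup (Suc q)" "p + i + q = Suc n"
    by (auto simp: tri_basis_def)
  then show "tri_d b \<in> chains (tri_basis n)" by (simp add: tri_d_chains)
next
  fix b assume "b \<in> tri_basis 0"
  then show "tri_d b = 0" by (auto simp: tri_basis_def tri_d_def corr_small vert_def tuples_def)
next
  fix n b assume "b \<in> tri_basis n"
  then show "lin tri_d (tri_d b) = 0" by (auto simp: tri_basis_def tri_d_tri_d)
qed

section \<open>Collapse onto the small complex\<close>

text \<open>The element \<open>(j, i)\<close> is what remains of column \<open>2 * j\<close> and resolution degree \<open>i\<close>: on coefficients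
  \<open>grp\<close> becomes 0 or \<open>N\<close>, and \<open>corr\<close> becomes \<open>m\<close>.\<close>

definition small_d :: "nat \<times> nat \<Rightarrow> (nat \<times> nat \<Rightarrow>\<^sub>0 int)" where
  "small_d = (\<lambda>(j, i). if odd i then 0 else
      (if i = 0 then 0 else frag_cmul (int N) (frag_of (j, i - 1))) +
      (if j = 0 then 0 else frag_cmul (int m) (frag_of (j - 1, Suc i))))"

definition small_basis :: "nat \<Rightarrow> (nat \<times> nat) set" where
  "small_basis n = {(j, i). 2 * j + i = n}"

lemma based_complex_small: "based_complex small_basis small_d"
  unfolding based_complex_def
proof (intro conjI allI ballI)
  fix n b assume "b \<in> small_basis (Suc n)"
  then show "small_d b \<in> chains (small_basis n)" by (auto simp: small_basis_def small_d_def)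
next
  fix b assume "b \<in> small_basis 0"
  then show "small_d b = 0" by (auto simp: small_basis_def small_d_def)
next
  fix n b assume "b \<in> small_basis n"
  then show "lin small_d (small_d b) = 0" by (cases b) (auto simp: small_d_def frag_extend_linear)
qed

definition augment :: "nat \<times> nat \<times> int list \<Rightarrow> (nat \<times> nat \<Rightarrow>\<^sub>0 int)" where
  "augment = (\<lambda>(p, i, h). if even p \<and> length h = 1 then frag_of (p div 2, i) else 0)"

lemma augment_cell:
  assumes "c \<in> chains (tup l)"
  shows "lin augment (cell p i c) = (if even p \<and> l = 1 then push (\<lambda>_. (p div 2, i)) c else 0)"
proof -
  have "lin augment (cell p i c) = lin (\<lambda>h. if even p \<and> l = 1 then frag_of (p div 2, i) else 0) c"
    unfolding frag_extend_push
    by (rule frag_extend_cong[OF assms]) (auto simp: augment_def tuples_def)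
  then show ?thesis by (auto simp: frag_extend_fun)
qed

lemma sum_const_frag: "(\<Sum>c<k. frag_of b) = frag_cmul (int k) (frag_of b)"
  by (induction k) (auto simp: frag_cmul_distrib)

lemma augment_chain_map: "chain_map tri_basis tri_d small_basis small_d (\<lambda>_. augment)"
  unfolding chain_map_def
proof (intro allI ballI conjI)
  fix n b assume "b \<in> tri_basis n"
  then obtain p i h q where b: "b = (p, i, h)" and h: "h \<in> tup (Suc q)" and n: "p + i + q = n"
    by (auto simp: tri_basis_def)
  have len: "length h = Suc q" "h \<noteq> []" using tupD[OF h] by auto
  show "augment b \<in> chains (small_basis n)"
    using n len by (auto simp: b augment_def small_basis_def)
  have e: "lin augment (tri_d b) =
      (if even p \<and> q = 1 then push (\<lambda>_. (p div 2, i)) (vert p h) else 0)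
    + (if even (p - 1) \<and> q = 0 then push (\<lambda>_. ((p - 1) div 2, i)) (horiz p h) else 0)
    + frag_cmul (tot_sign p (Suc q)) (if even p \<and> q = 0 then push (\<lambda>_. (p div 2, i - 1)) (grp i h) else 0)
    + frag_cmul (tot_sign p (Suc q)) (if even (p - 2) \<and> q = 0 then push (\<lambda>_. ((p - 2) div 2, Suc i)) (corr p i h) else 0)"
    unfolding b tri_d_def prod.case frag_extend_linear augment_cell[OF vert_chains[OF h]] augment_cell[OF horiz_chains[OF h]]
      augment_cell[OF grp_chains[OF h]] augment_cell[OF corr_chains[OF h]] len
    by simp
  consider "2 \<le> q" | "q = 1" | "q = 0" by linarith
  then show "lin augment (tri_d b) = lin small_d (augment b)"
  proof cases
    case 1
    then show ?thesis unfolding e by (simp add: b augment_def len)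
  next
    case 2
    then obtain x y where h2: "h = [x, y]" using len by (auto simp: length_Suc_conv)
    show ?thesis unfolding e using 2
      by (simp add: b augment_def h2 vert_even aug_bdry_Cons frag_extend_linear)
  next
    case 3
    have H0: "push (\<lambda>_. ((p - 1) div 2, i)) (horiz p h) = 0" if "even (p - 1)"
    proof (cases "p = 0")
      case False
      then have "odd p" using that by (cases p) auto
      then show ?thesis using len 3 by (simp add: horiz_def horiz_cell_def frag_extend_linear)
    qed simp
    have e': "lin augment (tri_d b) =
      (if even p then push (\<lambda>_. (p div 2, i - 1)) (grp i h) + push (\<lambda>_. ((p - 2) div 2, Suc i)) (corr p i h) else 0)"
    proof -
      have "tot_sign p (Suc q) = 1" if "even p" using that 3 by (simp add: tot_sign_def)
      moreover have "corr p i h = 0" if "odd p" "even (p - 2)" using that by (cases "p < 2") (auto simp: corr_small)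
      moreover have "even (p - 2)" if "even p" using that by simp
      ultimately show ?thesis unfolding e using 3 H0 by auto
    qed
    show ?thesis
    proof (cases "even p")
      case False
      then show ?thesis unfolding e' by (simp add: b augment_def)
    next
      case True
      then obtain j where p: "p = 2 * j" by blast
      have "push (\<lambda>_. (p div 2, i - 1)) (grp i h) = (if odd i \<or> i = 0 then 0 else frag_cmul (int N) (frag_of (j, i - 1)))"
        by (auto simp: grp_def frag_extend_linear p sum_const_frag)
      moreover have pj: "(p - 2) div 2 = j - 1" using p by (cases j) auto
      moreover have "push (\<lambda>_. ((p - 2) div 2, Suc i)) (corr p i h)
          = (if odd i \<or> j = 0 then 0 else frag_cmul (int m) (frag_of (j - 1, Suc i)))"
        unfolding pj using p by (auto simp: corr_def frag_extend_linear sum_const_frag)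
      ultimately show ?thesis
        unfolding e' using True by (auto simp: b augment_def len 3 p small_d_def)
    qed
  qed
qed

text \<open>The cone with apex 0 contracts the columns: the odd ones entirely, since $b'$ never deletes the
  last entry, and the even ones onto the augmentation. The sign is that of the vertical map.\<close>

definition cone_contr :: "nat \<times> nat \<times> int list \<Rightarrow> (nat \<times> nat \<times> int list \<Rightarrow>\<^sub>0 int)" where
  "cone_contr = (\<lambda>(p, i, h). frag_cmul ((-1) ^ p) (frag_of (p, i, 0 # h)))"

lemma cone_contr_at: "lin cone_contr (cell p i c) = frag_cmul ((-1) ^ p) (cell p i (push ((#) 0) c))"
  by (simp add: cone_contr_def frag_extend_push push_push frag_extend_fun)

lemma vert_cone:
  assumes "h \<noteq> []"
  shows "frag_cmul ((-1) ^ p) (vert p (0 # h) + push ((#) 0) (vert p h))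
    = frag_of h - (if even p \<and> length h = 1 then frag_of [0] else 0)"
proof (cases "even p")
  case True
  show ?thesis
  proof (cases "length h = 1")
    case len: True
    then obtain x where "h = [x]" by (auto simp: length_Suc_conv)
    then show ?thesis using True by (simp add: vert_even aug_bdry_Cons frag_extend_linear)
  next
    case False
    moreover have "length h \<noteq> 0" using assms by simp
    ultimately have "\<not> length h \<le> 1" by linarith
    then show ?thesis using True assms False by (simp add: vert_even aug_bdry_Cons)
  qed
next
  case False
  obtain xs y where h: "h = xs @ [y]" using assms by (cases h rule: rev_cases) auto
  show ?thesis using False assms
    by (simp add: vert_odd h aug_bdry_Cons[of 0 xs] frag_extend_linear push_push)
qed

text \<open>All parts of the differential other than the vertical one lower \<open>p + i\<close>.\<close>

lemma tri_d_minus_vert: "tri_d (p, i, h) - cell p i (vert p h) \<in> chains {b. (case b of (p', i', h') \<Rightarrow> p' + i') < p + i}"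
proof -
  let ?B = "{b. (case b of (p', i', h') \<Rightarrow> p' + i') < p + i}"
  have cell: "cell p' i' c \<in> chains ?B" if "p' + i' < p + i" for p' i' c
    using that by (intro push_chains[of c UNIV]) (auto simp: chains_def)
  have "cell (p - 1) i (horiz p h) \<in> chains ?B"
    by (cases p) (use cell[of "p - 1" i] in auto)
  moreover have "cell p (i - 1) (grp i h) \<in> chains ?B"
    by (cases i) (use cell[of p "i - 1"] in auto)
  moreover have "cell (p - 2) (Suc i) (corr p i h) \<in> chains ?B"
    by (cases "p < 2") (use cell[of "p - 2" "Suc i"] in \<open>auto simp: corr_small\<close>)
  ultimately show ?thesis by (simp add: tri_d_def)
qed

lemma tri_equivalent_small: "homotopy_equivalent tri_basis tri_d small_basis small_d"
proof (rule acyclic_surjection_homotopy_equivalent[OF based_complex_tri based_complex_small augment_chain_map])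
  fix n b assume "b \<in> small_basis n"
  then obtain j i where b: "b = (j, i)" "2 * j + i = n" by (auto simp: small_basis_def)
  show "\<exists>y\<in>chains (tri_basis n). lin augment y = frag_of b"
  proof (rule bexI[of _ "frag_of (2 * j, i, [0])"])
    show "frag_of (2 * j, i, [0]) \<in> chains (tri_basis n)" using b N_pos by (auto simp: tri_basis_def tuples_def)
  qed (simp add: augment_def b)
next
  fix n x
  let ?\<phi> = "\<lambda>(p, i, h :: int list). p + i :: nat"
  assume "x \<in> chains (tri_basis n)" "lin tri_d x = 0" "lin augment x = 0"
  then show "\<exists>z\<in>chains (tri_basis (Suc n)). lin tri_d z = x \<and> lin augment z = 0"
  proof (rule acyclic_kernel_by_filtration[where s = "\<lambda>(j, i). frag_of (2 * j, i, [0])" and \<kappa> = cone_contr and \<phi> = ?\<phi>,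
        OF based_complex_tri augment_chain_map, rotated -3])
    fix n b assume "b \<in> tri_basis n"
    then obtain p i h q where b: "b = (p, i, h)" and h: "h \<in> tup (Suc q)" and n: "p + i + q = n"
      by (auto simp: tri_basis_def)
    have len: "length h = Suc q" "h \<noteq> []" using tupD[OF h] by auto
    have 0: "0 # h \<in> tup (Suc (Suc q))" using h N_pos by (auto simp: tuples_def)
    show "cone_contr b \<in> chains (tri_basis (Suc n))" using 0 n by (auto simp: b cone_contr_def tri_basis_def)
    show "lin augment (cone_contr b) = 0" using len by (simp add: cone_contr_def augment_def b frag_extend_linear)
    let ?low = "{b'. ?\<phi> b' < ?\<phi> b}"
    define R where "R h = tri_d (p, i, h) - cell p i (vert p h)" for h
    have R: "R h \<in> chains ?low" for h
      unfolding R_def using tri_d_minus_vert[of p i h] by (simp add: b)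
    have tri_d: "tri_d (p, i, h) = cell p i (vert p h) + R h" for h by (simp add: R_def)
    have contr_R: "lin cone_contr (R h) \<in> chains ?low"
      by (rule chains_extend[OF R]) (auto simp: cone_contr_def)
    have "frag_of b - lin (\<lambda>(j, i). frag_of (2 * j, i, [0])) (augment b)
        = cell p i (frag_of h - (if even p \<and> length h = 1 then frag_of [0] else 0))"
      using len by (auto simp: b augment_def frag_extend_linear)
    also have "\<dots> = frag_cmul ((-1)^p) (cell p i (vert p (0 # h))) + lin cone_contr (cell p i (vert p h))"
      unfolding vert_cone[OF len(2), of p, symmetric] by (simp add: frag_extend_linear cone_contr_at frag_cmul_distrib2)
    finally have "frag_of b - lin (\<lambda>(j, i). frag_of (2 * j, i, [0])) (augment b) -
        lin tri_d (cone_contr b) - lin cone_contr (tri_d b) = - frag_cmul ((-1)^p) (R (0 # h)) - lin cone_contr (R h)"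
      by (simp add: b cone_contr_def frag_extend_linear tri_d frag_cmul_distrib2 del: minus_frag_cmul)
    also have "\<dots> \<in> chains ?low" using R contr_R by (simp del: minus_frag_cmul)
    finally show "frag_of b - lin (\<lambda>(j, i). frag_of (2 * j, i, [0])) (augment b) -
        lin tri_d (cone_contr b) - lin cone_contr (tri_d b) \<in> chains ?low" .
  qed
qed

end

section \<open>Collapse onto words\<close>

locale cyclic_quotient = group L + homogeneous N m
  for L :: "('g, 'h) monoid_scheme" (structure) and N m +
  fixes \<gamma> \<pi> :: 'g
  assumes gen: "\<gamma> \<in> carrier L" "carrier L = range (\<lambda>i::int. \<gamma> [^] i)" "ord \<gamma> = N"
    and pi: "\<pi> = \<gamma> [^] m"
begin

lemma pow_eq_iff: "\<gamma> [^] (a::int) = \<gamma> [^] b \<longleftrightarrow> a mod int N = b mod int N"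
  using int_pow_eq[OF gen(1), of b a] gen(3) by (metis mod_eq_dvd_iff)

text \<open>The word of a tuple, $g_i = h_{i-1} h_i^{-1}$.\<close>

fun ratios :: "int list \<Rightarrow> 'g list" where
  "ratios (x # y # h) = \<gamma> [^] (x - y) # ratios (y # h)"
| "ratios _ = []"

lemma length_ratios [simp]: "length (ratios h) = length h - 1"
  by (induction h rule: ratios.induct) auto

lemma set_ratios: "set (ratios h) \<subseteq> carrier L"
  by (induction h rule: ratios.induct) (auto simp: gen)

lemma ratios_eq_Nil_iff: "ratios h = [] \<longleftrightarrow> length h \<le> 1"
  using length_ratios[of h] by (metis diff_is_0_eq length_0_conv)

lemma ratios_append: "ratios (a @ x # b) = ratios (a @ [x]) @ ratios (x # b)"
proof (induction a)
  case (Cons y a)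
  then show ?case by (cases a) auto
qed simp

lemma ratios_tl: "ratios (tl h) = tl (ratios h)"
  by (cases h rule: ratios.cases) auto

lemma ratios_butlast: "ratios (butlast h) = butlast (ratios h)"
proof (cases h rule: rev_cases)
  case (snoc a y)
  then show ?thesis
    by (cases a rule: rev_cases) (auto simp: ratios_append[of _ _ "[y]"] butlast_append)
qed simp

lemma gen_pow_mult: "\<gamma> [^] (a::int) \<otimes> \<gamma> [^] b = \<gamma> [^] (a + b)"
  using gen(1) by (simp add: int_pow_mult)

lemma ratios_del:
  assumes h: "length h = Suc q" and i: "i \<le> q" and q: "0 < q"
  shows "ratios (del i h) = word_face L q i (ratios h)"
proof -
  consider "i = 0" | "i = q" | "0 < i" "i < q" using i by linarith
  then show ?thesis
  proof cases
    case 1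
    then show ?thesis using ratios_tl[of h] h by (cases h) (auto simp: word_face_def)
  next
    case 2
    obtain a y where hy: "h = a @ [y]" using h by (cases h rule: rev_cases) auto
    then have "del i h = butlast h" using h 2 by (auto simp: del_length)
    then show ?thesis using 2 q by (simp add: word_face_def ratios_butlast)
  next
    case 3
    obtain a b where ab: "h = a @ b" "length a = i - 1"
      using h 3 by (metis append_take_drop_id length_take min.absorb2 less_imp_diff_less less_SucI less_imp_le)
    obtain x y z c where b: "b = x # y # z # c"
    proof -
      have "length b \<ge> 3" using ab h 3 by (auto simp: )
      then show ?thesis using that by (cases b; cases "tl b"; cases "tl (tl b)") auto
    qed
    have "del i h = a @ x # z # c"
    proof -
      have "i = Suc (length a)" using ab(2) 3(1) by linarith
      then show ?thesis by (simp add: ab(1) b del_def)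
    qed
    then have 1: "ratios (del i h) = ratios (a @ [x]) @ \<gamma> [^] (x - z) # ratios (z # c)"
      by (simp add: ratios_append[of a x "z # c"])
    have 2: "ratios h = ratios (a @ [x]) @ \<gamma> [^] (x - y) # \<gamma> [^] (y - z) # ratios (z # c)"
      by (simp add: ab(1) b ratios_append[of a x "y # z # c"])
    have len: "length (ratios (a @ [x])) = i - 1" by (simp add: ab)
    have 4: "\<gamma> [^] (x - y) \<otimes> \<gamma> [^] (y - z) = \<gamma> [^] (x - z)" by (simp add: gen_pow_mult)
    have nth: "ratios h ! (i - 1) = \<gamma> [^] (x - y)" "ratios h ! i = \<gamma> [^] (y - z)"
      using len 3 by (auto simp: 2 nth_append)
    have td: "take (i - 1) (ratios h) = ratios (a @ [x])" "drop (i + 1) (ratios h) = ratios (z # c)"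
      using len 3 by (auto simp: 2 Suc_diff_le)
    show ?thesis using 3 unfolding word_face_def nth td 4 1 by simp
  qed
qed

lemma foldr_ratios: "h \<noteq> [] \<Longrightarrow> foldr (monoid.mult L) (ratios h) \<one> = \<gamma> [^] (hd h - last h)"
  by (induction h rule: ratios.induct) (auto simp: gen_pow_mult)

lemma ratios_shift: "ratios (sh c h) = ratios h"
proof (induction h rule: ratios.induct)
  case (1 x y h)
  have "\<gamma> [^] ((x + c) mod int N - (y + c) mod int N) = \<gamma> [^] (x - y)"
    by (simp add: pow_eq_iff mod_simps)
  then show ?case using 1 by (simp add: shift_def)
qed (auto simp: shift_def)

lemma ratios_twist:
  assumes "length h = Suc q"
  shows "ratios (tw h) = word_cyc L \<pi> q (ratios h)"
proof (cases "q = 0")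
  case True
  then obtain x where "h = [x]" using assms by (auto simp: length_Suc_conv)
  then show ?thesis using True by (simp add: word_cyc_def twist_def)
next
  case False
  obtain x h' where h: "h = x # h'" "h' \<noteq> []" using assms False by (cases h) auto
  then obtain y where y: "butlast h = x # y" by (cases h') auto
  have "\<pi> \<otimes> inv (foldr (monoid.mult L) (ratios h) \<one>) = \<gamma> [^] int m \<otimes> \<gamma> [^] (- (x - last h))"
    unfolding int_pow_neg[OF gen(1)] pi int_pow_int using h by (subst foldr_ratios) auto
  also have "\<dots> = \<gamma> [^] ((last h + int m) mod int N - x)"
    by (simp add: gen_pow_mult pow_eq_iff mod_simps algebra_simps)
  finally show ?thesis
    using False y by (simp add: word_cyc_def twist_def ratios_butlast[symmetric])
qed

lemma ratios_twist_pow: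
  assumes "length h = Suc q"
  shows "ratios ((tw ^^ l) h) = (word_cyc L \<pi> q ^^ l) (ratios h)"
proof (induction l)
  case (Suc l)
  have "h \<noteq> []" using assms by auto
  then show ?case using Suc assms by (simp add: ratios_twist[of _ q])
qed simp

text \<open>Together with \<open>ratios_shift\<close> and \<open>ratios_surj\<close> this identifies words with orbits of tuples.\<close>

lemma ratios_inj:
  "\<lbrakk>h \<in> tup (Suc q); h' \<in> tup (Suc q); hd h = hd h'; ratios h = ratios h'\<rbrakk> \<Longrightarrow> h = h'"
proof (induction q arbitrary: h h')
  case 0
  then show ?case by (auto simp: tuples_def length_Suc_conv)
next
  case (Suc q)
  obtain x y r where h: "h = x # y # r" using Suc.prems by (auto simp: tuples_def length_Suc_conv)
  obtain x' y' r' where h': "h' = x' # y' # r'" using Suc.prems by (auto simp: tuples_def length_Suc_conv)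
  have x: "x' = x" using Suc.prems h h' by simp
  have "(x - y) mod int N = (x - y') mod int N" using Suc.prems(4) by (simp add: h h' x pow_eq_iff)
  then have "(x - (x - y)) mod int N = (x - (x - y')) mod int N" by (metis mod_diff_right_eq)
  then have "y mod int N = y' mod int N" by simp
  then have y: "y = y'" using Suc.prems by (simp add: tuples_def h h')
  have "y # r = y' # r'"
    by (rule Suc.IH) (use Suc.prems h h' y in \<open>auto simp: tuples_def\<close>)
  then show ?case by (simp add: h h' x)
qed

lemma ratios_surj:
  "\<lbrakk>set w \<subseteq> carrier L; 0 \<le> x; x < int N\<rbrakk> \<Longrightarrow> \<exists>h \<in> tup (Suc (length w)). hd h = x \<and> ratios h = w"
proof (induction w arbitrary: x)
  case Nil
  then show ?case by (intro bexI[of _ "[x]"]) (auto simp: tuples_def)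
next
  case (Cons g w)
  then obtain c where c: "g = \<gamma> [^] (c::int)" using gen(2) by auto
  let ?y = "(x - c) mod int N"
  obtain h where h: "h \<in> tup (Suc (length w))" "hd h = ?y" "ratios h = w"
    using Cons.IH[of ?y] Cons.prems N_pos by auto
  then obtain r where r: "h = ?y # r" by (cases h) (auto simp: tuples_def)
  have "\<gamma> [^] (x - ?y) = g" by (simp add: c pow_eq_iff mod_simps)
  then show ?case using h Cons.prems by (intro bexI[of _ "x # h"]) (auto simp: tuples_def r)
qed

text \<open>The total complex of the cyclic bicomplex of the group algebra over the integers; a basis element
  is a word placed in a column.\<close>

definition cyc_basis :: "nat \<Rightarrow> (nat \<times> 'g list) set" where
  "cyc_basis n = {(p, w). p + length w = n \<and> set w \<subseteq> carrier L}"

definition cyc_d :: "nat \<times> 'g list \<Rightarrow> (nat \<times> 'g list \<Rightarrow>\<^sub>0 int)" where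
  "cyc_d = (\<lambda>(p, w).
    (if w = [] then 0 else push (Pair p) (vert_cell (word_face L) p (length w) w)) +
    (if p = 0 then 0 else push (Pair (p - 1)) (horiz_cell (word_cyc L \<pi>) p (length w) w)))"

definition dehomog :: "nat \<times> nat \<times> int list \<Rightarrow> (nat \<times> 'g list \<Rightarrow>\<^sub>0 int)" where
  "dehomog = (\<lambda>(p, i, h). if i = 0 then frag_of (p, ratios h) else 0)"

lemma dehomog_cell: "lin dehomog (cell p i c) = (if i = 0 then push (Pair p) (push ratios c) else 0)"
  by (auto simp: frag_extend_push dehomog_def frag_extend_fun)

lemma dehomog_tri_d:
  assumes h: "h \<in> tup (Suc q)"
  shows "lin dehomog (tri_d (p, i, h)) = lin cyc_d (dehomog (p, i, h))"
proof -
  have len: "length h = Suc q" "h \<noteq> []" using tupD[OF h] by auto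
  consider "i = 0" | "i = 1" | "2 \<le> i" by linarith
  then show ?thesis
  proof cases
    case 1
    have vert: "push ratios (vert p h) = (if ratios h = [] then 0 else vert_cell (word_face L) p q (ratios h))"
    proof (cases "q = 0")
      case True
      then show ?thesis using len by (simp add: ratios_eq_Nil_iff vert_def)
    next
      case False
      then have "push ratios (vert_cell (\<lambda>_. del) p q h) = vert_cell (word_face L) p q (ratios h)"
        by (intro vert_cell_natural ratios_del len) auto
      then show ?thesis using False len by (simp add: ratios_eq_Nil_iff vert_def)
    qed
    have horiz: "push ratios (horiz p h) = (if p = 0 then 0 else horiz_cell (word_cyc L \<pi>) p q (ratios h))"
    proof -
      have "push ratios (horiz_cell (\<lambda>_. tw) p q h) = horiz_cell (word_cyc L \<pi>) p q (ratios h)"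
        by (intro horiz_cell_natural ratios_twist_pow len)
      then show ?thesis using len by (simp add: horiz_def)
    qed
    have "lin dehomog (tri_d (p, i, h)) = push (Pair p) (push ratios (vert p h)) + push (Pair (p - 1)) (push ratios (horiz p h))"
      using 1 by (simp add: tri_d_def frag_extend_linear dehomog_cell)
    also have "\<dots> = cyc_d (p, ratios h)"
      unfolding vert horiz using len by (auto simp: cyc_d_def)
    finally show ?thesis using 1 by (simp add: dehomog_def)
  next
    case 2
    then have "lin dehomog (tri_d (p, i, h)) = 0"
      unfolding tri_d_def prod.case frag_extend_linear dehomog_cell
      by (simp add: grp_def ratios_shift frag_extend_linear)
    then show ?thesis using 2 by (simp add: dehomog_def)
  next
    case 3
    then have "lin dehomog (tri_d (p, i, h)) = 0" by (simp add: tri_d_def frag_extend_linear dehomog_cell)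
    then show ?thesis using 3 by (simp add: dehomog_def)
  qed
qed

lemma dehomog_chains: "b \<in> tri_basis n \<Longrightarrow> dehomog b \<in> chains (cyc_basis n)"
  using set_ratios by (auto simp: tri_basis_def cyc_basis_def dehomog_def tuples_def)

lemma dehomog_surj: "(p, w) \<in> cyc_basis n \<Longrightarrow> \<exists>h \<in> tup (Suc (length w)). (p, 0, h) \<in> tri_basis n \<and> dehomog (p, 0, h) = frag_of (p, w)"
  using ratios_surj[of w 0] N_pos by (auto simp: cyc_basis_def tri_basis_def dehomog_def)

lemma dehomog_chain_map: "chain_map tri_basis tri_d cyc_basis cyc_d (\<lambda>_. dehomog)"
  unfolding chain_map_def using dehomog_chains dehomog_tri_d by (auto simp: tri_basis_def)

text \<open>The square of the differential vanishes on words because every word comes from a tuple.\<close>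

lemma based_complex_cyc: "based_complex cyc_basis cyc_d"
  unfolding based_complex_def
proof (intro conjI allI ballI)
  fix n b assume b: "b \<in> cyc_basis (Suc n)"
  obtain p w where [simp]: "b = (p, w)" by fastforce
  obtain h where h: "(p, 0, h) \<in> tri_basis (Suc n)" "dehomog (p, 0, h) = frag_of b" using dehomog_surj b by fastforce
  have "lin dehomog (tri_d (p, 0, h)) = cyc_d b"
    using chain_mapD(2)[OF dehomog_chain_map, of "frag_of (p, 0, h)"] h by simp
  moreover have "tri_d (p, 0, h) \<in> chains (tri_basis n)" using based_complex_tri h(1) by (auto simp: based_complex_def)
  ultimately show "cyc_d b \<in> chains (cyc_basis n)"
    using chain_mapD(1)[OF dehomog_chain_map] by metis
next
  fix b assume "b \<in> cyc_basis 0"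
  then show "cyc_d b = 0" by (auto simp: cyc_basis_def cyc_d_def)
next
  fix n b assume b: "b \<in> cyc_basis n"
  obtain p w where [simp]: "b = (p, w)" by fastforce
  obtain h where h: "(p, 0, h) \<in> tri_basis n" "dehomog (p, 0, h) = frag_of b" using dehomog_surj b by fastforce
  have 1: "lin dehomog (tri_d (p, 0, h)) = cyc_d b"
    using chain_mapD(2)[OF dehomog_chain_map, of "frag_of (p, 0, h)"] h by simp
  have "tri_d (p, 0, h) \<in> chains (tri_basis (n - 1))"
    using based_complexD(1)[OF based_complex_tri, of "frag_of (p, 0, h)"] h(1) by simp
  then have "lin cyc_d (cyc_d b) = lin dehomog (lin tri_d (tri_d (p, 0, h)))"
    using chain_mapD(2)[OF dehomog_chain_map] 1 by metis
  also have "\<dots> = 0" using based_complex_tri h(1) by (simp add: based_complex_def)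
  finally show "lin cyc_d (cyc_d b) = 0" .
qed

definition orbit_rep :: "nat \<times> 'g list \<Rightarrow> (nat \<times> nat \<times> int list \<Rightarrow>\<^sub>0 int)" where
  "orbit_rep = (\<lambda>(p, w). frag_of (p, 0, THE h. h \<in> tup (Suc (length w)) \<and> hd h = 0 \<and> ratios h = w))"

lemma orbit_rep_ratios: assumes h: "h \<in> tup (Suc q)" shows "orbit_rep (p, ratios h) = frag_of (p, 0, sh (- hd h) h)"
proof -
  have len: "length h = Suc q" "h \<noteq> []" using tupD[OF h] by auto
  have "(THE h'. h' \<in> tup (Suc (length (ratios h))) \<and> hd h' = 0 \<and> ratios h' = ratios h) = sh (- hd h) h"
  proof (rule the_equality)
    show *: "sh (- hd h) h \<in> tup (Suc (length (ratios h))) \<and> hd (sh (- hd h) h) = 0 \<and> ratios (sh (- hd h) h) = ratios h"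
      using h len N_pos by (simp add: ratios_shift hd_shift)
    fix h' assume "h' \<in> tup (Suc (length (ratios h))) \<and> hd h' = 0 \<and> ratios h' = ratios h"
    then show "h' = sh (- hd h) h" using * ratios_inj[of h' "length (ratios h)" "sh (- hd h) h"] by simp
  qed
  then show ?thesis by (simp add: orbit_rep_def)
qed

definition orbit_contr :: "nat \<times> nat \<times> int list \<Rightarrow> (nat \<times> nat \<times> int list \<Rightarrow>\<^sub>0 int)" where
  "orbit_contr = (\<lambda>(p, i, h). frag_cmul (tot_sign p (length h)) (cell p (Suc i) (grp_contr i h)))"

lemma grp_contr_length: "grp_contr i h \<in> chains {h'. length h' = length h}"
  unfolding grp_contr_def by (auto intro!: chains_sum)

text \<open>The parts of the differential that lower the column plus the length of the tuple.\<close>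

definition non_grp_part :: "nat \<Rightarrow> nat \<Rightarrow> int list \<Rightarrow> (nat \<times> nat \<times> int list \<Rightarrow>\<^sub>0 int)" where
  "non_grp_part p i h = cell p i (vert p h) + cell (p - 1) i (horiz p h) + frag_cmul (tot_sign p (length h)) (cell (p - 2) (Suc i) (corr p i h))"

lemma non_grp_part_chains:
  assumes h: "h \<in> tup (Suc q)"
  shows "non_grp_part p i h \<in> chains {b. (case b of (p', i', h') \<Rightarrow> p' + length h') < p + Suc q}"
proof -
  let ?B = "{b. (case b of (p', i', h') \<Rightarrow> p' + length h') < p + Suc q}"
  have cell: "cell p' i' c \<in> chains ?B" if "c \<in> chains (tup l)" "p' + l < p + Suc q" for p' i' c l
    using that(2) by (intro push_chains[OF that(1)]) (auto simp: tuples_def)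
  have "cell p i (vert p h) \<in> chains ?B" by (rule cell[OF vert_chains[OF h]]) simp
  moreover have "cell (p - 1) i (horiz p h) \<in> chains ?B"
    by (cases p) (use cell[OF horiz_chains[OF h], of "p - 1"] in auto)
  moreover have "cell (p - 2) (Suc i) (corr p i h) \<in> chains ?B"
    by (cases "p < 2") (use cell[OF corr_chains[OF h], of "p - 2"] in \<open>auto simp: corr_small\<close>)
  ultimately show ?thesis by (simp add: non_grp_part_def)
qed

lemma tri_d_non_grp_part: "tri_d (p, i, h) = non_grp_part p i h + frag_cmul (tot_sign p (length h)) (cell p (i - 1) (grp i h))"
  by (simp add: tri_d_def non_grp_part_def)

text \<open>With the filtration by column plus length of the tuple, the resolution part of the differential is
  the leading one, and \<open>grp_contr\<close> contracts it onto orbits.\<close>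

lemma tri_equivalent_cyc: "homotopy_equivalent tri_basis tri_d cyc_basis cyc_d"
proof (rule acyclic_surjection_homotopy_equivalent[OF based_complex_tri based_complex_cyc dehomog_chain_map])
  fix n b assume "b \<in> cyc_basis n"
  then show "\<exists>y\<in>chains (tri_basis n). lin dehomog y = frag_of b"
    using dehomog_surj[of "fst b" "snd b" n] by (metis chains_of frag_extend_of prod.collapse)
next
  fix n x
  let ?\<phi> = "\<lambda>(p, i :: nat, h :: int list). p + length h"
  assume "x \<in> chains (tri_basis n)" "lin tri_d x = 0" "lin dehomog x = 0"
  then show "\<exists>z\<in>chains (tri_basis (Suc n)). lin tri_d z = x \<and> lin dehomog z = 0"
  proof (rule acyclic_kernel_by_filtration[where s = orbit_rep and \<kappa> = orbit_contr and \<phi> = ?\<phi>,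
        OF based_complex_tri dehomog_chain_map, rotated -3])
    fix n b assume "b \<in> tri_basis n"
    then obtain p i h q where b: "b = (p, i, h)" and h: "h \<in> tup (Suc q)" and n: "p + i + q = n"
      by (auto simp: tri_basis_def)
    have len: "length h = Suc q" "h \<noteq> []" using tupD[OF h] by auto
    show "orbit_contr b \<in> chains (tri_basis (Suc n))"
      using cell_chains[OF grp_contr_chains[OF h], of p "Suc i" "Suc n"] n by (simp add: orbit_contr_def b)
    show "lin dehomog (orbit_contr b) = 0" by (simp add: orbit_contr_def b frag_extend_linear dehomog_cell)
    let ?low = "{b'. ?\<phi> b' < ?\<phi> b}" and ?s = "tot_sign p (Suc q)"
    have ss: "?s * ?s = 1" by (simp add: tot_sign_def power_add[symmetric] power_mult_distrib[symmetric])
    have low: "?low = {b'. ?\<phi> b' < p + Suc q}" using len by (simp add: b)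
    have R: "non_grp_part p i' h' \<in> chains ?low" if "h' \<in> tup (Suc q)" for h' i'
      unfolding low by (rule non_grp_part_chains[OF that])
    have contr_R: "lin orbit_contr (non_grp_part p i h) \<in> chains ?low"
    proof (rule chains_extend[OF R[OF h]])
      fix b' assume "b' \<in> ?low"
      moreover obtain p' i' h' where b': "b' = (p', i', h')" by (cases b')
      moreover have "cell p' (Suc i') (grp_contr i' h') \<in> chains {b''. ?\<phi> b'' = p' + length h'}"
        by (rule push_chains[OF grp_contr_length]) simp
      ultimately show "orbit_contr b' \<in> chains ?low"
        by (auto simp: orbit_contr_def elim: chains_mono intro!: chains_cmul)
    qed
    have RK: "lin (non_grp_part p (Suc i)) (grp_contr i h) \<in> chains ?low"
      by (rule chains_extend[OF grp_contr_chains[OF h]]) (rule R)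
    have "lin tri_d (cell p (Suc i) (grp_contr i h)) = lin (\<lambda>h. non_grp_part p (Suc i) h + frag_cmul ?s (cell p i (grp (Suc i) h))) (grp_contr i h)"
      unfolding frag_extend_push
      by (rule frag_extend_cong[OF grp_contr_chains[OF h]]) (auto simp: tri_d_non_grp_part tuples_def)
    then have "lin tri_d (orbit_contr b) = frag_cmul ?s (lin (non_grp_part p (Suc i)) (grp_contr i h)) + cell p i (lin (grp (Suc i)) (grp_contr i h))"
      by (simp add: orbit_contr_def b len frag_extend_linear frag_extend_fun frag_cmul_distrib2 ss cell_ext)
    moreover have "lin orbit_contr (tri_d b) = lin orbit_contr (non_grp_part p i h) + cell p i (lin (grp_contr (i - 1)) (grp i h))"
    proof -
      have "lin orbit_contr (cell p (i - 1) (grp i h)) = lin (\<lambda>h. frag_cmul ?s (cell p (Suc (i - 1)) (grp_contr (i - 1) h))) (grp i h)"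
        unfolding frag_extend_push
        by (rule frag_extend_cong[OF grp_chains[OF h]]) (auto simp: orbit_contr_def tuples_def)
      also have "\<dots> = frag_cmul ?s (cell p i (lin (grp_contr (i - 1)) (grp i h)))"
        by (cases i) (simp_all add: frag_extend_fun cell_ext)
      finally show ?thesis
        by (simp add: b tri_d_non_grp_part len frag_extend_linear ss)
    qed
    moreover have "frag_of b - lin orbit_rep (dehomog b)
        = cell p i (frag_of h - (if i = 0 then frag_of (sh (- hd h) h) else 0))"
      by (auto simp: b dehomog_def frag_extend_linear orbit_rep_ratios[OF h])
    ultimately have "frag_of b - lin orbit_rep (dehomog b) - lin tri_d (orbit_contr b) - lin orbit_contr (tri_d b)
        = - frag_cmul ?s (lin (non_grp_part p (Suc i)) (grp_contr i h)) - lin orbit_contr (non_grp_part p i h)"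
      unfolding grp_grp_contr[OF h, of i, symmetric] by (simp add: frag_extend_linear del: minus_frag_cmul)
    also have "\<dots> \<in> chains ?low" using RK contr_R by (simp del: minus_frag_cmul)
    finally show "frag_of b - lin orbit_rep (dehomog b) - lin tri_d (orbit_contr b) - lin orbit_contr (tri_d b) \<in> chains ?low" .
  qed
qed

theorem cyc_equivalent_small: "homotopy_equivalent cyc_basis cyc_d small_basis small_d"
  by (rule homotopy_equivalent_trans[OF based_complex_cyc based_complex_tri based_complex_small
        homotopy_equivalent_sym[OF tri_equivalent_cyc] tri_equivalent_small])

end

section \<open>Extension of scalars\<close>

text \<open>The map between free \<open>R\<close>-modules with the integer matrix \<open>f\<close>, whose column at \<open>v\<close> is \<open>f v\<close>.\<close>

definition act ::
    "('a, 'r) ring_scheme \<Rightarrow> 'b set \<Rightarrow> ('b \<Rightarrow> 'c \<Rightarrow>\<^sub>0 int) \<Rightarrow> ('b \<Rightarrow> 'a) \<Rightarrow> ('c \<Rightarrow> 'a)" where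
  "act R B f x = (\<lambda>w. \<Oplus>\<^bsub>R\<^esub> v\<in>B. [entry (f v) w] \<cdot>\<^bsub>R\<^esub> x v)"

abbreviation vecs :: "('a, 'r) ring_scheme \<Rightarrow> 'b set \<Rightarrow> ('b \<Rightarrow> 'a) set" where
  "vecs R B \<equiv> carrier (free_module R B)"

context cring
begin

lemma vecs_iff: "finite B \<Longrightarrow> x \<in> vecs R B \<longleftrightarrow> (\<forall>w. x w \<in> carrier R) \<and> (\<forall>w. w \<notin> B \<longrightarrow> x w = \<zero>)"
  by (auto simp: free_module_def intro: finite_subset[of _ B])

lemma vecs_closed: "x \<in> vecs R B \<Longrightarrow> x w \<in> carrier R"
  by (simp add: free_module_def)

lemma vecs_zero: "x \<in> vecs R B \<Longrightarrow> w \<notin> B \<Longrightarrow> x w = \<zero>"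
  by (simp add: free_module_def)

lemma free_module_simps [simp]:
  "x \<oplus>\<^bsub>free_module R B\<^esub> y = (\<lambda>w. x w \<oplus> y w)"
  "a \<odot>\<^bsub>free_module R B\<^esub> x = (\<lambda>w. a \<otimes> x w)"
  "\<zero>\<^bsub>free_module R B\<^esub> = (\<lambda>_. \<zero>)"
  by (simp_all add: free_module_def)

lemma module_free_module: "Module.module R (free_module R B)"
proof (rule moduleI[OF is_cring abelian_groupI])
  fix x y assume x: "x \<in> vecs R B" and y: "y \<in> vecs R B"
  have "{w. x w \<oplus> y w \<noteq> \<zero>} \<subseteq> {w. x w \<noteq> \<zero>} \<union> {w. y w \<noteq> \<zero>}" by auto
  then show "x \<oplus>\<^bsub>free_module R B\<^esub> y \<in> vecs R B"
    using x y by (auto simp: free_module_def elim: finite_subset)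
next
  fix x assume x: "x \<in> vecs R B"
  have "(\<lambda>w. \<ominus> x w) \<in> vecs R B"
  proof -
    have "{w. \<ominus> x w \<noteq> \<zero>} \<subseteq> {w. x w \<noteq> \<zero>}" by auto
    then show ?thesis using x by (auto simp: free_module_def elim: finite_subset)
  qed
  moreover have "(\<lambda>w. \<ominus> x w) \<oplus>\<^bsub>free_module R B\<^esub> x = \<zero>\<^bsub>free_module R B\<^esub>"
    using vecs_closed[OF x] by (simp add: l_neg)
  ultimately show "\<exists>y\<in>vecs R B. y \<oplus>\<^bsub>free_module R B\<^esub> x = \<zero>\<^bsub>free_module R B\<^esub>" by blast
next
  fix a x assume a: "a \<in> carrier R" and x: "x \<in> vecs R B"
  have "{w. a \<otimes> x w \<noteq> \<zero>} \<subseteq> {w. x w \<noteq> \<zero>}" using a by auto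
  then show "a \<odot>\<^bsub>free_module R B\<^esub> x \<in> vecs R B"
    using a x by (auto simp: free_module_def elim: finite_subset)
qed (auto simp: free_module_def a_ac l_distr r_distr m_assoc)

lemma free_module_a_inv:
  assumes x: "x \<in> vecs R B"
  shows "\<ominus>\<^bsub>free_module R B\<^esub> x = (\<lambda>w. \<ominus> x w)"
proof -
  interpret M: Module.module R "free_module R B" by (rule module_free_module)
  have "(\<lambda>w. \<ominus> x w) \<in> vecs R B"
  proof -
    have "{w. \<ominus> x w \<noteq> \<zero>} \<subseteq> {w. x w \<noteq> \<zero>}" by auto
    then show ?thesis using x by (auto simp: free_module_def elim: finite_subset)
  qed
  then show ?thesis
    using x vecs_closed[OF x] by (intro M.minus_equality) (auto simp: l_neg)
qed

lemma free_module_finsum: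
  assumes "finite I" "\<And>i. i \<in> I \<Longrightarrow> y i \<in> vecs R B"
  shows "(\<Oplus>\<^bsub>free_module R B\<^esub> i\<in>I. y i) = (\<lambda>w. \<Oplus>i\<in>I. y i w)"
  using assms
proof (induction I)
  interpret M: Module.module R "free_module R B" by (rule module_free_module)
  case (insert i I)
  then have "(\<Oplus>\<^bsub>free_module R B\<^esub> i\<in>insert i I. y i) = y i \<oplus>\<^bsub>free_module R B\<^esub> (\<Oplus>\<^bsub>free_module R B\<^esub> i\<in>I. y i)"
    by (intro M.finsum_insert) auto
  moreover have "y j w \<in> carrier R" if "j \<in> insert i I" for j w
    using insert.prems[OF that] by (rule vecs_closed)
  ultimately show ?case using insert by (auto simp: fun_eq_iff finsum_insert Pi_def)
next
  interpret M: Module.module R "free_module R B" by (rule module_free_module)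
  case empty
  then show ?case by simp
qed

lemma mult_int_1 [simp]: "x \<in> carrier R \<Longrightarrow> [(1::int)] \<cdot> x = x"
  by (simp add: add.int_pow_1)

lemma mult_int_0 [simp]: "[(0::int)] \<cdot> x = \<zero>"
  by (simp add: add_pow_def)

lemma mult_int_zero [simp]: "[(a::int)] \<cdot> \<zero> = \<zero>"
  by (rule add.int_pow_one)

lemma mult_int_closed [simp]: "x \<in> carrier R \<Longrightarrow> [(a::int)] \<cdot> x \<in> carrier R"
  by (rule add.int_pow_closed)

lemma mult_int_add: "x \<in> carrier R \<Longrightarrow> [((a::int) + b)] \<cdot> x = [a] \<cdot> x \<oplus> [b] \<cdot> x"
  by (simp add: add.int_pow_mult)

lemma mult_int_mult: "x \<in> carrier R \<Longrightarrow> [((a::int) * b)] \<cdot> x = [a] \<cdot> ([b] \<cdot> x)"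
  by (simp add: add.int_pow_pow mult.commute)

lemma mult_int_uminus: "x \<in> carrier R \<Longrightarrow> [(- (a::int))] \<cdot> x = \<ominus> ([a] \<cdot> x)"
  by (simp add: add.int_pow_neg)

lemma mult_int_diff: "x \<in> carrier R \<Longrightarrow> [((a::int) - b)] \<cdot> x = [a] \<cdot> x \<ominus> [b] \<cdot> x"
  using mult_int_add[of x a "- b"] by (simp add: mult_int_uminus a_minus_def)

lemma mult_int_add_right: "x \<in> carrier R \<Longrightarrow> y \<in> carrier R \<Longrightarrow> [(a::int)] \<cdot> (x \<oplus> y) = [a] \<cdot> x \<oplus> [a] \<cdot> y"
  by (simp add: add.int_pow_distrib)

lemma mult_int_finsum:
  "\<lbrakk>finite I; \<And>i. i \<in> I \<Longrightarrow> y i \<in> carrier R\<rbrakk> \<Longrightarrow> [(a::int)] \<cdot> (\<Oplus>i\<in>I. y i) = (\<Oplus>i\<in>I. [a] \<cdot> y i)"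
  by (induction I rule: finite_induct) (auto simp: finsum_insert mult_int_add_right Pi_def)

lemma mult_int_of_nat: "[int k] \<cdot> x = [k] \<cdot> x"
  by (simp add: add_pow_def int_pow_int)

lemma sign_mult: "x \<in> carrier R \<Longrightarrow> sign R i \<otimes> x = [((-1::int)^i)] \<cdot> x"
proof (induction i)
  case (Suc i)
  have s: "sign R i \<in> carrier R" by (simp add: sign_def)
  have "sign R (Suc i) \<otimes> x = \<ominus> (sign R i \<otimes> x)"
    using s Suc.prems by (simp add: sign_def l_minus r_minus m_ac)
  then show ?case using Suc by (simp add: mult_int_uminus)
qed (simp add: sign_def)

lemma act_closed: "\<lbrakk>\<And>v. v \<in> B \<Longrightarrow> x v \<in> carrier R\<rbrakk> \<Longrightarrow> act R B f x w \<in> carrier R"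
  unfolding act_def by (rule finsum_closed) auto

lemma act_insert:
  "\<lbrakk>finite B; v \<notin> B; \<And>u. u \<in> insert v B \<Longrightarrow> x u \<in> carrier R\<rbrakk> \<Longrightarrow>
    act R (insert v B) f x w = [entry (f v) w] \<cdot> x v \<oplus> act R B f x w"
  unfolding act_def by (rule finsum_insert) auto

lemma act_cong:
  "\<lbrakk>\<And>v. v \<in> B \<Longrightarrow> f v = g v; \<And>v. v \<in> B \<Longrightarrow> x v = y v; \<And>v. v \<in> B \<Longrightarrow> y v \<in> carrier R\<rbrakk>
    \<Longrightarrow> act R B f x = act R B g y"
  unfolding act_def by (intro ext finsum_cong') auto

lemma act_plus:
  "\<lbrakk>\<And>v. v \<in> B \<Longrightarrow> x v \<in> carrier R\<rbrakk> \<Longrightarrow>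
    act R B (\<lambda>v. f v + g v) x w = act R B f x w \<oplus> act R B g x w"
  unfolding act_def
  by (rule trans[OF finsum_cong' finsum_addf]) (auto simp: lookup_add mult_int_add)

lemma act_cmul:
  "\<lbrakk>finite B; \<And>v. v \<in> B \<Longrightarrow> x v \<in> carrier R\<rbrakk> \<Longrightarrow>
    act R B (\<lambda>v. frag_cmul a (f v)) x w = [a] \<cdot> act R B f x w"
  unfolding act_def by (subst mult_int_finsum) (auto simp: mult_int_mult intro!: finsum_cong')

lemma act_uminus:
  "\<lbrakk>finite B; \<And>v. v \<in> B \<Longrightarrow> x v \<in> carrier R\<rbrakk> \<Longrightarrow> act R B (\<lambda>v. - f v) x w = \<ominus> act R B f x w"
  using act_cmul[of B x "-1" f w] act_closed[of B x f w] by (simp add: mult_int_uminus)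

lemma act_zero_fun: "act R B (\<lambda>v. 0) x w = \<zero>"
  unfolding act_def by (simp add: finsum_zero)

lemma act_sum:
  assumes "finite B" "\<And>v. v \<in> B \<Longrightarrow> x v \<in> carrier R" "finite I"
  shows "act R B (\<lambda>v. \<Sum>i\<in>I. f i v) x w = (\<Oplus>i\<in>I. act R B (f i) x w)"
  using assms(3)
proof (induction I)
  case (insert i I)
  then show ?case using assms(1,2) by (simp add: act_plus act_closed finsum_insert)
qed (simp add: act_zero_fun)

lemma act_add_vec:
  "\<lbrakk>\<And>v. v \<in> B \<Longrightarrow> x v \<in> carrier R; \<And>v. v \<in> B \<Longrightarrow> y v \<in> carrier R\<rbrakk> \<Longrightarrow>
    act R B f (\<lambda>v. x v \<oplus> y v) w = act R B f x w \<oplus> act R B f y w"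
  unfolding act_def
  by (rule trans[OF finsum_cong' finsum_addf]) (auto simp: mult_int_add_right)

lemma act_smult_vec:
  "\<lbrakk>finite B; a \<in> carrier R; \<And>v. v \<in> B \<Longrightarrow> x v \<in> carrier R\<rbrakk> \<Longrightarrow>
    act R B f (\<lambda>v. a \<otimes> x v) w = a \<otimes> act R B f x w"
  unfolding act_def
  by (subst finsum_rdistr) (auto simp: add_pow_rdistr_int intro!: finsum_cong')

lemma act_minus_vec:
  assumes "finite B" "\<And>v. v \<in> B \<Longrightarrow> x v \<in> carrier R" "\<And>v. v \<in> B \<Longrightarrow> y v \<in> carrier R"
  shows "act R B f (\<lambda>v. x v \<ominus> y v) w = act R B f x w \<ominus> act R B f y w"
proof -
  have "act R B f (\<lambda>v. x v \<ominus> y v) w = act R B f (\<lambda>v. x v \<oplus> (\<ominus> \<one>) \<otimes> y v) w"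
    using assms by (intro fun_cong[OF act_cong]) (auto simp: a_minus_def l_minus)
  also have "\<dots> = act R B f x w \<oplus> (\<ominus> \<one>) \<otimes> act R B f y w"
    using assms by (simp add: act_add_vec act_smult_vec)
  also have "\<dots> = act R B f x w \<ominus> act R B f y w"
    using assms by (simp add: a_minus_def l_minus act_closed)
  finally show ?thesis .
qed

lemma act_zero_vec: "act R B f (\<lambda>v. \<zero>) w = \<zero>"
  unfolding act_def by (simp add: finsum_zero)

lemma act_vecs:
  assumes "finite C" "\<And>v. v \<in> B \<Longrightarrow> f v \<in> chains C" "\<And>v. v \<in> B \<Longrightarrow> x v \<in> carrier R"
  shows "act R B f x \<in> vecs R C"
proof -
  have "act R B f x w = \<zero>" if "w \<notin> C" for w
    unfolding act_def
  proof (rule add.finprod_one_eqI)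
    fix v assume "v \<in> B"
    then have "w \<notin> Poly_Mapping.keys (f v)"
      using assms(2) that by (auto simp: chains_def)
    then have "entry (f v) w = 0" by (simp add: in_keys_iff)
    then show "[entry (f v) w] \<cdot> x v = \<zero>" by simp
  qed
  then show ?thesis using assms by (simp add: vecs_iff act_closed)
qed

lemma act_single:
  assumes "finite B" "v0 \<in> B" "\<And>v. v \<in> B \<Longrightarrow> x v \<in> carrier R"
    and "\<And>v. v \<in> B \<Longrightarrow> entry (f v) w = (if v = v0 then c else 0)"
  shows "act R B f x w = [c] \<cdot> x v0"
proof -
  have "act R B f x w = (\<Oplus>v\<in>B. if v0 = v then [c] \<cdot> x v else \<zero>)"
    unfolding act_def using assms by (intro finsum_cong') auto
  also have "\<dots> = [c] \<cdot> x v0"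
    using assms by (intro finsum_singleton) auto
  finally show ?thesis .
qed

lemma act_frag_of: "finite B \<Longrightarrow> x \<in> vecs R B \<Longrightarrow> act R B frag_of x = x"
proof
  fix w assume B: "finite B" and x: "x \<in> vecs R B"
  show "act R B frag_of x w = x w"
  proof (cases "w \<in> B")
    case True
    then have "act R B frag_of x w = [(1::int)] \<cdot> x w"
      using B x by (intro act_single) (auto simp: vecs_closed lookup_frag_of)
    then show ?thesis using x by (simp add: vecs_closed)
  next
    case False
    have "act R B frag_of x \<in> vecs R B" using B x by (intro act_vecs) (auto simp: vecs_closed)
    then show ?thesis using False x vecs_zero by metis
  qed
qed

text \<open>Functoriality: the product of integer matrices acts by composition.\<close>

lemma act_act:
  assumes B: "finite B" and C: "finite C" and f: "\<And>v. v \<in> B \<Longrightarrow> f v \<in> chains C"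
    and x: "\<And>v. v \<in> B \<Longrightarrow> x v \<in> carrier R"
  shows "act R C g (act R B f x) = act R B (\<lambda>v. lin g (f v)) x"
proof
  fix w
  have single: "act R C g (\<lambda>u. [entry c u] \<cdot> a) w = [entry (lin g c) w] \<cdot> a"
    if c: "c \<in> chains C" and a: "a \<in> carrier R" for c a
  proof -
    have "Poly_Mapping.keys c \<subseteq> C" using c by (simp add: chains_def)
    then show ?thesis
    proof (induction c rule: frag_induction)
      case zero
      show ?case by (simp add: act_zero_vec)
    next
      case (one u)
      have "act R C g (\<lambda>u'. [entry (frag_of u) u'] \<cdot> a) w
          = act R {u} g (\<lambda>u'. [entry (frag_of u) u'] \<cdot> a) w"
        unfolding act_def using C one a
        by (intro add.finprod_mono_neutral_cong_right) (auto simp: lookup_frag_of)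
      also have "\<dots> = [entry (g u) w] \<cdot> a"
        using a by (subst act_insert) (auto simp: lookup_frag_of act_def)
      finally show ?case by simp
    next
      case (diff c d)
      have "act R C g (\<lambda>u. [entry (c - d) u] \<cdot> a) w
         = act R C g (\<lambda>u. [entry c u] \<cdot> a \<ominus> [entry d u] \<cdot> a) w"
        using a by (intro fun_cong[OF act_cong]) (auto simp: lookup_minus mult_int_diff)
      also have "\<dots> = [entry (lin g c) w] \<cdot> a \<ominus> [entry (lin g d) w] \<cdot> a"
        using a C diff by (subst act_minus_vec) auto
      finally show ?case using a by (simp add: frag_extend_diff lookup_minus mult_int_diff)
    qed
  qed
  show "act R C g (act R B f x) w = act R B (\<lambda>v. lin g (f v)) x w"
    using B f x
  proof (induction B)
    case empty
    have "act R {} f x = (\<lambda>_. \<zero>)" by (simp add: act_def)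
    then show ?case by (simp add: act_zero_vec) (simp add: act_def)
  next
    case (insert v B)
    have "act R C g (act R (insert v B) f x) w =
        act R C g (\<lambda>u. [entry (f v) u] \<cdot> x v \<oplus> act R B f x u) w"
    proof (intro fun_cong[OF act_cong])
      fix u
      show "act R (insert v B) f x u = [entry (f v) u] \<cdot> x v \<oplus> act R B f x u"
        by (rule act_insert) (use insert in auto)
      show "[entry (f v) u] \<cdot> x v \<oplus> act R B f x u \<in> carrier R"
        using insert.prems by (auto intro!: act_closed)
    qed simp
    also have "\<dots> = [entry (lin g (f v)) w] \<cdot> x v \<oplus> act R B (\<lambda>v. lin g (f v)) x w"
      using insert by (subst act_add_vec) (auto simp: single act_closed)
    also have "\<dots> = act R (insert v B) (\<lambda>v. lin g (f v)) x w"
      using insert by (subst act_insert) auto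
    finally show ?case .
  qed
qed

text \<open>When the entries of \<open>f\<close> in the row \<open>u\<close> are supported on the pairs with first component \<open>p\<close>, the
  action at \<open>u\<close> reduces to these pairs. This extracts the single column that contributes to a
  component of the total differential.\<close>

lemma act_fiber:
  assumes B: "finite B" and y: "\<And>b. b \<in> B \<Longrightarrow> y b \<in> carrier R"
    and f: "\<And>p' w'. (p', w') \<in> B \<Longrightarrow>
      entry (f (p', w')) u = (if p' = p then entry (v w') w else 0)"
  shows "act R B f y u = act R {w'. (p, w') \<in> B} v (\<lambda>w'. y (p, w')) w"
proof -
  let ?A = "{w'. (p, w') \<in> B}"
  have "act R B f y u = (\<Oplus>b\<in>Pair p ` ?A. [entry (f b) u] \<cdot> y b)"
    unfolding act_def
  proof (rule add.finprod_mono_neutral_cong_right)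
    fix b assume b: "b \<in> B - Pair p ` ?A"
    then obtain p' w' where "b = (p', w')" "p' \<noteq> p" by (cases b) auto
    then show "[entry (f b) u] \<cdot> y b = \<zero>" using f b by auto
  qed (use B y in auto)
  also have "\<dots> = (\<Oplus>w'\<in>?A. [entry (f (p, w')) u] \<cdot> y (p, w'))"
    using y by (intro finsum_reindex) (auto simp: inj_on_def)
  also have "\<dots> = act R ?A v (\<lambda>w'. y (p, w')) w"
    unfolding act_def using y f by (intro finsum_cong') auto
  finally show ?thesis .
qed

lemma lin_ext_eq_act:
  assumes B: "finite B" and x: "x \<in> vecs R B"
  shows "lin_ext R f x = act R B (\<lambda>v. frag_of (f v)) x"
proof
  fix w
  show "lin_ext R f x w = act R B (\<lambda>v. frag_of (f v)) x w"
    unfolding lin_ext_def act_def using B x vecs_closed[OF x] vecs_zero[OF x]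
    by (intro add.finprod_mono_neutral_cong_left) (auto simp: lookup_frag_of)
qed

end

section \<open>The Connes--Moscovici bicomplex over a ring\<close>

lemma finite_words: "finite (carrier L) \<Longrightarrow> finite (words L q)"
  unfolding words_def using finite_lists_length_eq[of "carrier L" q] by (simp add: conj_commute)

lemma (in monoid) word_face_words:
  assumes w: "w \<in> words G (Suc q)" and i: "i \<le> Suc q"
  shows "word_face G (Suc q) i w \<in> words G q"
proof -
  have w': "length w = Suc q" "set w \<subseteq> carrier G" using w by (auto simp: words_def)
  consider "i = 0" | "i = Suc q" | "0 < i" "i < Suc q" using i by linarith
  then show ?thesis
  proof cases
    case 1
    then show ?thesis using w' by (cases w) (auto simp: word_face_def words_def)
  next
    case 2
    then show ?thesis using w' by (auto simp: word_face_def words_def dest: in_set_butlastD)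
  next
    case 3
    have "w ! (i - 1) \<in> carrier G" "w ! i \<in> carrier G" using w' 3 by (auto simp: subset_iff)
    moreover have "set (take (i - 1) w) \<subseteq> carrier G" "set (drop (i + 1) w) \<subseteq> carrier G"
      using w' set_take_subset set_drop_subset by fast+
    ultimately show ?thesis using 3 w' by (auto simp: word_face_def words_def)
  qed
qed

lemma (in group) foldr_closed: "set w \<subseteq> carrier G \<Longrightarrow> foldr (monoid.mult G) w \<one> \<in> carrier G"
  by (induction w) auto

lemma (in group) word_cyc_words:
  assumes w: "w \<in> words G q" and pi: "\<pi> \<in> carrier G"
  shows "word_cyc G \<pi> q w \<in> words G q"
  using w pi foldr_closed[of w] by (auto simp: word_cyc_def words_def dest: in_set_butlastD)

lemma (in group) word_cyc_pow_words:
  assumes "w \<in> words G q" "\<pi> \<in> carrier G"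
  shows "(word_cyc G \<pi> q ^^ l) w \<in> words G q"
  using assms by (induction l) (auto intro: word_cyc_words)

locale group_algebra = cring k + L: group L
  for k :: "('a, 'r) ring_scheme" (structure) and L :: "('g, 'h) monoid_scheme" +
  fixes \<pi> :: 'g
  assumes fin: "finite (carrier L)" and pi_in: "\<pi> \<in> carrier L"
begin

abbreviation "W q \<equiv> words L q"
abbreviation "C \<equiv> cm_cyclic_module k L \<pi>"

lemma finW [simp]: "finite (W q)" using fin by (rule finite_words)

lemma C_simps: "obj C q = free_module k (W q)" "face C q i = lin_ext k (word_face L q i)"
    "cyc C q = lin_ext k (word_cyc L \<pi> q)"
  by (simp_all add: cm_cyclic_module_def)

text \<open>The alternating sums of faces, defined as sums in a module of functions, act by the integer
  matrices of their cells.\<close>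

lemma face_sum:
  assumes x: "x \<in> vecs k (W (Suc q))" and I: "finite I" "\<And>i. i \<in> I \<Longrightarrow> i \<le> Suc q"
  shows "(\<Oplus>\<^bsub>obj C q\<^esub> i\<in>I. sign k i \<odot>\<^bsub>obj C q\<^esub> face C (Suc q) i x)
    = act k (W (Suc q)) (\<lambda>v. \<Sum>i\<in>I. frag_cmul ((-1)^i) (frag_of (word_face L (Suc q) i v))) x"
proof
  fix w
  have xc: "x v \<in> carrier k" for v using x by (rule vecs_closed)
  have lin: "lin_ext k (word_face L (Suc q) i) x = act k (W (Suc q)) (\<lambda>v. frag_of (word_face L (Suc q) i v)) x" for i
    using x by (simp add: lin_ext_eq_act)
  have s: "sign k i \<in> carrier k" for i by (simp add: sign_def)
  interpret M: Module.module k "free_module k (W q)" by (rule module_free_module)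
  have mem: "act k (W (Suc q)) (\<lambda>v. frag_of (word_face L (Suc q) i v)) x \<in> vecs k (W q)" if "i \<in> I" for i
    using I(2)[OF that] xc by (intro act_vecs) (auto intro: L.word_face_words)
  have "(\<Oplus>\<^bsub>free_module k (W q)\<^esub> i\<in>I. sign k i \<odot>\<^bsub>free_module k (W q)\<^esub> act k (W (Suc q)) (\<lambda>v. frag_of (word_face L (Suc q) i v)) x) w
     = (\<Oplus>i\<in>I. (sign k i \<odot>\<^bsub>free_module k (W q)\<^esub> act k (W (Suc q)) (\<lambda>v. frag_of (word_face L (Suc q) i v)) x) w)"
    using I(1) s mem by (intro fun_cong[OF free_module_finsum] M.smult_closed) auto
  also have "\<dots> = (\<Oplus>i\<in>I. act k (W (Suc q)) (\<lambda>v. frag_cmul ((-1)^i) (frag_of (word_face L (Suc q) i v))) x w)"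
    using xc by (intro finsum_cong') (auto simp: sign_mult act_cmul act_closed)
  also have "\<dots> = act k (W (Suc q)) (\<lambda>v. \<Sum>i\<in>I. frag_cmul ((-1)^i) (frag_of (word_face L (Suc q) i v))) x w"
    using xc I by (intro act_sum[symmetric]) auto
  finally show "(\<Oplus>\<^bsub>obj C q\<^esub> i\<in>I. sign k i \<odot>\<^bsub>obj C q\<^esub> face C (Suc q) i x) w
    = act k (W (Suc q)) (\<lambda>v. \<Sum>i\<in>I. frag_cmul ((-1)^i) (frag_of (word_face L (Suc q) i v))) x w"
    unfolding C_simps lin .
qed

lemma cyc_vert_act:
  assumes x: "x \<in> vecs k (W (Suc q))"
  shows "cyc_vert k C p (Suc q) x = act k (W (Suc q)) (vert_cell (word_face L) p (Suc q)) x"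
proof (cases "even p")
  case True
  then show ?thesis
    using face_sum[OF x, of "{..Suc q}"] by (simp add: cyc_vert_def hoch_b_def vert_cell_def[abs_def])
next
  case False
  have xc: "x v \<in> carrier k" for v using x by (rule vecs_closed)
  let ?f = "\<lambda>v. \<Sum>i<Suc q. frag_cmul ((-1)^i) (frag_of (word_face L (Suc q) i v))"
  have mem: "act k (W (Suc q)) ?f x \<in> vecs k (W q)"
    using xc by (intro act_vecs chains_sum chains_cmul) (auto intro: L.word_face_words)
  have "cyc_vert k C p (Suc q) x = (\<lambda>w. \<ominus> act k (W (Suc q)) ?f x w)"
    using False face_sum[OF x, of "{..<Suc q}"] free_module_a_inv[OF mem]
    by (simp add: cyc_vert_def hoch_b'_def C_simps(1))
  also have "\<dots> = act k (W (Suc q)) (\<lambda>v. - ?f v) x"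
    using xc by (intro ext act_uminus[symmetric]) auto
  finally show ?thesis using False by (simp add: vert_cell_def[abs_def])
qed

lemma signed_cyc_pow_act:
  assumes x: "x \<in> vecs k (W q)"
  shows "(signed_cyc k C q ^^ l) x = act k (W q) (\<lambda>v. frag_cmul (((-1)^q)^l) (frag_of ((word_cyc L \<pi> q ^^ l) v))) x"
proof (induction l)
  case 0
  then show ?case using x by (simp add: act_frag_of)
next
  case (Suc l)
  have xc: "x v \<in> carrier k" for v using x by (rule vecs_closed)
  let ?f = "\<lambda>v. frag_cmul (((-1)^q)^l) (frag_of ((word_cyc L \<pi> q ^^ l) v))"
  let ?y = "act k (W q) ?f x"
  have fc: "?f v \<in> chains (W q)" if "v \<in> W q" for v
    using that pi_in by (intro chains_cmul) (simp add: L.word_cyc_pow_words)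
  have y: "?y \<in> vecs k (W q)" using xc fc by (intro act_vecs) auto
  have yc: "?y v \<in> carrier k" for v using y by (rule vecs_closed)
  have "(signed_cyc k C q ^^ Suc l) x = signed_cyc k C q ?y" using Suc by simp
  also have "\<dots> = (\<lambda>w. [((-1::int)^q)] \<cdot> act k (W q) (\<lambda>v. frag_of (word_cyc L \<pi> q v)) ?y w)"
    using yc by (simp add: signed_cyc_def C_simps lin_ext_eq_act[OF finW y] sign_mult act_closed)
  also have "\<dots> = act k (W q) (\<lambda>v. frag_cmul ((-1)^q) (frag_of (word_cyc L \<pi> q v))) ?y"
    using yc by (intro ext act_cmul[symmetric]) auto
  also have "\<dots> = act k (W q) (\<lambda>v. lin (\<lambda>v. frag_cmul ((-1)^q) (frag_of (word_cyc L \<pi> q v))) (?f v)) x"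
    using fc xc by (intro act_act) auto
  also have "\<dots> = act k (W q) (\<lambda>v. frag_cmul (((-1)^q)^Suc l) (frag_of ((word_cyc L \<pi> q ^^ Suc l) v))) x"
    by (simp add: frag_extend_cmul mult.commute)
  finally show ?case .
qed

lemma cyc_horiz_act:
  assumes x: "x \<in> vecs k (W q)"
  shows "cyc_horiz k C p q x = act k (W q) (horiz_cell (word_cyc L \<pi>) p q) x"
proof -
  have xc: "x v \<in> carrier k" for v using x by (rule vecs_closed)
  have fc: "frag_cmul (((-1)^q)^l) (frag_of ((word_cyc L \<pi> q ^^ l) v)) \<in> chains (W q)" if "v \<in> W q" for v l
    using that pi_in by (intro chains_cmul) (simp add: L.word_cyc_pow_words)
  have mem: "act k (W q) (\<lambda>v. frag_cmul (((-1)^q)^l) (frag_of ((word_cyc L \<pi> q ^^ l) v))) x \<in> vecs k (W q)" for l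
    using xc fc by (intro act_vecs) auto
  interpret M: Module.module k "free_module k (W q)" by (rule module_free_module)
  show ?thesis
  proof (cases "odd p")
    case True
    let ?g = "\<lambda>v. frag_cmul ((-1)^q) (frag_of (word_cyc L \<pi> q v))"
    have "signed_cyc k C q x = act k (W q) ?g x"
      using signed_cyc_pow_act[OF x, of 1] by simp
    moreover have "act k (W q) ?g x \<in> vecs k (W q)" using mem[of 1] by simp
    ultimately have "cyc_horiz k C p q x = (\<lambda>w. x w \<oplus> \<ominus> act k (W q) ?g x w)"
      using True by (simp add: cyc_horiz_def C_simps(1) a_minus_def free_module_a_inv)
    also have "\<dots> = (\<lambda>w. act k (W q) frag_of x w \<oplus> act k (W q) (\<lambda>v. - ?g v) x w)"
      using x xc by (simp add: act_frag_of act_uminus del: minus_frag_cmul)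
    also have "\<dots> = act k (W q) (\<lambda>v. frag_of v + - ?g v) x"
      using xc by (intro ext act_plus[symmetric]) auto
    finally show ?thesis using True by (simp add: horiz_cell_def[abs_def] del: minus_frag_cmul)
  next
    case False
    have "cyc_horiz k C p q x = (\<Oplus>\<^bsub>free_module k (W q)\<^esub> l\<in>{..q}.
        act k (W q) (\<lambda>v. frag_cmul (((-1)^q)^l) (frag_of ((word_cyc L \<pi> q ^^ l) v))) x)"
      using False x by (simp add: cyc_horiz_def cyc_norm_def signed_cyc_pow_act C_simps(1))
    also have "\<dots> = (\<lambda>w. \<Oplus>l\<in>{..q}.
        act k (W q) (\<lambda>v. frag_cmul (((-1)^q)^l) (frag_of ((word_cyc L \<pi> q ^^ l) v))) x w)"
      using mem by (intro free_module_finsum) auto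
    also have "\<dots> = act k (W q) (\<lambda>v. \<Sum>l\<le>q. frag_cmul (((-1)^q)^l) (frag_of ((word_cyc L \<pi> q ^^ l) v))) x"
      using xc by (intro ext act_sum[symmetric]) auto
    finally show ?thesis using False by (simp add: horiz_cell_def[abs_def])
  qed
qed

end

lemma lookup_push_Pair:
  "entry (push (Pair p) c) (p', w) = (if p = p' then entry c w else 0)"
  by (induction c rule: frag_induction[OF subset_UNIV])
    (auto simp: lookup_frag_of frag_extend_diff lookup_minus)

text \<open>An element of the total complex is a family of functions on words, one for each column;
  \<open>flat\<close> joins them into one function on pairs of a column and a word.\<close>

definition flat :: "('a, 'r) ring_scheme \<Rightarrow> nat \<Rightarrow> (nat \<Rightarrow> 'w \<Rightarrow> 'a) \<Rightarrow> (nat \<times> 'w \<Rightarrow> 'a)" where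
  "flat k n x = (\<lambda>(p, w). if p \<le> n then x p w else \<zero>\<^bsub>k\<^esub>)"

locale cyclic_group_algebra = group_algebra k L \<pi> + cyclic_quotient L N m \<gamma> \<pi>
  for k :: "('a, 'r) ring_scheme" (structure) and L :: "('g, 'h) monoid_scheme" and N m and \<gamma> \<pi> :: 'g
begin

abbreviation "Tot n \<equiv> tot_module (cyc_obj C) n"
abbreviation "tot_d n \<equiv> tot_diff (cyc_obj C) (cyc_vert k C) (cyc_horiz k C) n"

lemma cyc_basis_eq: "cyc_basis n = Sigma {..n} (\<lambda>p. W (n - p))"
  by (auto simp: cyc_basis_def words_def)

lemma finite_cyc_basis: "finite (cyc_basis n)"
  unfolding cyc_basis_eq by auto

lemma Tot_carrier: "x \<in> carrier (Tot n) \<longleftrightarrow> x \<in> (\<Pi>\<^sub>E p\<in>{..n}. vecs k (W (n - p)))"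
  by (simp add: tot_module_def prod_module_def cyc_obj_def C_simps)

lemma Tot_simps:
  "x \<oplus>\<^bsub>Tot n\<^esub> y = (\<lambda>p\<in>{..n}. \<lambda>w. x p w \<oplus> y p w)"
  "a \<odot>\<^bsub>Tot n\<^esub> x = (\<lambda>p\<in>{..n}. \<lambda>w. a \<otimes> x p w)"
  "\<zero>\<^bsub>Tot n\<^esub> = (\<lambda>p\<in>{..n}. \<lambda>_. \<zero>)"
  by (simp_all add: tot_module_def prod_module_def cyc_obj_def C_simps fun_eq_iff restrict_def)

lemma vecs_cyc_basis_iff: "y \<in> vecs k (cyc_basis n) \<longleftrightarrow>
    (\<forall>u. y u \<in> carrier k) \<and> (\<forall>p w. \<not> (p \<le> n \<and> w \<in> W (n - p)) \<longrightarrow> y (p, w) = \<zero>)"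
  unfolding vecs_iff[OF finite_cyc_basis] by (auto simp: cyc_basis_eq)

lemma flat_vecs: assumes "x \<in> carrier (Tot n)" shows "flat k n x \<in> vecs k (cyc_basis n)"
proof -
  have "x p w \<in> carrier k" "w \<notin> W (n - p) \<Longrightarrow> x p w = \<zero>" if "p \<le> n" for p w
    using assms that unfolding Tot_carrier PiE_iff by (metis atMost_iff vecs_closed, metis atMost_iff vecs_zero)
  then show ?thesis by (auto simp: vecs_cyc_basis_iff flat_def)
qed

lemma flat_bij: "bij_betw (flat k n) (carrier (Tot n)) (vecs k (cyc_basis n))"
proof (rule bij_betw_byWitness[where f' = "\<lambda>y. \<lambda>p\<in>{..n}. \<lambda>w. y (p, w)"])
  show "\<forall>x\<in>carrier (Tot n). (\<lambda>p\<in>{..n}. \<lambda>w. flat k n x (p, w)) = x"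
    by (auto simp: Tot_carrier flat_def fun_eq_iff PiE_iff extensional_def)
  show "\<forall>y\<in>vecs k (cyc_basis n). flat k n (\<lambda>p\<in>{..n}. \<lambda>w. y (p, w)) = y"
    by (auto simp: flat_def fun_eq_iff vecs_cyc_basis_iff)
  show "flat k n ` carrier (Tot n) \<subseteq> vecs k (cyc_basis n)" using flat_vecs by blast
  show "(\<lambda>y. \<lambda>p\<in>{..n}. \<lambda>w. y (p, w)) ` vecs k (cyc_basis n) \<subseteq> carrier (Tot n)"
    by (auto simp: Tot_carrier vecs_iff vecs_cyc_basis_iff)
qed

lemma flat_add: "flat k n (x \<oplus>\<^bsub>Tot n\<^esub> y) = (\<lambda>b. flat k n x b \<oplus> flat k n y b)"
  by (auto simp: flat_def Tot_simps fun_eq_iff)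

lemma flat_smult: "a \<in> carrier k \<Longrightarrow> flat k n (a \<odot>\<^bsub>Tot n\<^esub> x) = (\<lambda>b. a \<otimes> flat k n x b)"
  by (auto simp: flat_def Tot_simps fun_eq_iff)

lemma flat_zero: "flat k n (\<zero>\<^bsub>Tot n\<^esub>) = (\<lambda>_. \<zero>)"
  by (auto simp: flat_def Tot_simps fun_eq_iff)

text \<open>In this form the total differential is the action of the integral differential \<open>cyc_d\<close>.\<close>

lemma flat_tot_diff:
  assumes x: "x \<in> carrier (Tot (Suc n))"
  shows "flat k n (tot_d (Suc n) x) = act k (cyc_basis (Suc n)) cyc_d (flat k (Suc n) x)"
proof
  fix u :: "nat \<times> 'g list"
  obtain p w where u: "u = (p, w)" by fastforce
  let ?y = "flat k (Suc n) x"
  have y: "?y \<in> vecs k (cyc_basis (Suc n))" by (rule flat_vecs[OF x])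
  have yc: "?y b \<in> carrier k" for b using y by (rule vecs_closed)
  have xp: "x p' \<in> vecs k (W (Suc n - p'))" if "p' \<le> Suc n" for p'
    using x that by (auto simp: Tot_carrier)
  show "flat k n (tot_d (Suc n) x) u = act k (cyc_basis (Suc n)) cyc_d ?y u"
  proof (cases "p \<le> n")
    case False
    have "act k (cyc_basis (Suc n)) cyc_d ?y \<in> vecs k (cyc_basis n)"
      using yc based_complex_cyc finite_cyc_basis by (intro act_vecs) (auto simp: based_complex_def)
    moreover have "u \<notin> cyc_basis n" using False by (auto simp: u cyc_basis_eq)
    ultimately have "act k (cyc_basis (Suc n)) cyc_d ?y u = \<zero>" by (rule vecs_zero)
    then show ?thesis using False by (simp add: flat_def u)
  next
    case True
    let ?dV = "\<lambda>(p, w). if w = [] then 0 else push (Pair p) (vert_cell (word_face L) p (length w) w)"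
    let ?dH = "\<lambda>(p, w). if p = 0 then 0 else push (Pair (p - 1)) (horiz_cell (word_cyc L \<pi>) p (length w) w)"
    have Sn: "Suc n - p = Suc (n - p)" using True by simp
    have fib: "{w'. (p', w') \<in> cyc_basis (Suc n)} = W (Suc n - p')" if "p' \<le> Suc n" for p'
      using that by (auto simp: cyc_basis_eq)
    have "act k (cyc_basis (Suc n)) cyc_d ?y u = act k (cyc_basis (Suc n)) ?dV ?y u \<oplus> act k (cyc_basis (Suc n)) ?dH ?y u"
    proof -
      have "cyc_d = (\<lambda>b. ?dV b + ?dH b)" by (auto simp: cyc_d_def fun_eq_iff)
      then show ?thesis using yc by (simp only: act_plus)
    qed
    also have "act k (cyc_basis (Suc n)) ?dV ?y u = act k {w'. (p, w') \<in> cyc_basis (Suc n)}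
        (vert_cell (word_face L) p (Suc n - p)) (\<lambda>w'. ?y (p, w')) w"
    proof (rule act_fiber[OF finite_cyc_basis yc])
      fix p' w' assume b: "(p', w') \<in> cyc_basis (Suc n)"
      show "entry (?dV (p', w')) u =
          (if p' = p then entry (vert_cell (word_face L) p (Suc n - p) w') w else 0)"
        using b True by (auto simp: u lookup_push_Pair cyc_basis_eq words_def)
    qed
    also have "\<dots> = act k (W (Suc n - p)) (vert_cell (word_face L) p (Suc n - p)) (x p) w"
      using True xp[of p] fib[of p]
      by (intro fun_cong[OF act_cong[THEN trans]]) (auto simp: flat_def vecs_closed intro!: act_cong)
    also have "\<dots> = cyc_vert k C p (Suc n - p) (x p) w"
      using xp[of p] True by (simp add: Sn cyc_vert_act)
    also have "act k (cyc_basis (Suc n)) ?dH ?y u = act k {w'. (Suc p, w') \<in> cyc_basis (Suc n)}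
        (horiz_cell (word_cyc L \<pi>) (Suc p) (n - p)) (\<lambda>w'. ?y (Suc p, w')) w"
    proof (rule act_fiber[OF finite_cyc_basis yc])
      fix p' w' assume b: "(p', w') \<in> cyc_basis (Suc n)"
      show "entry (?dH (p', w')) u =
          (if p' = Suc p then entry (horiz_cell (word_cyc L \<pi>) (Suc p) (n - p) w') w else 0)"
        using b True by (auto simp: u lookup_push_Pair cyc_basis_eq words_def)
    qed
    also have "\<dots> = act k (W (n - p)) (horiz_cell (word_cyc L \<pi>) (Suc p) (n - p)) (x (Suc p)) w"
      using True xp[of "Suc p"] fib[of "Suc p"]
      by (intro fun_cong[OF act_cong[THEN trans]]) (auto simp: flat_def vecs_closed intro!: act_cong)
    also have "\<dots> = cyc_horiz k C (Suc p) (n - p) (x (Suc p)) w"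
      using xp[of "Suc p"] True by (simp add: cyc_horiz_act)
    finally show ?thesis
      using True by (simp add: u flat_def tot_diff_def cyc_obj_def C_simps(1))
  qed
qed

end

section \<open>Homology over a ring\<close>

text \<open>The homomorphism theorem. The fibres of \<open>\<psi>\<close> are assumed to be the cosets of \<open>N\<close>, from which it
  follows that \<open>N\<close> is a submodule.\<close>

lemma quot_module_isomorphic:
  fixes R (structure) and M (structure)
  assumes M: "Module.module R M" and N: "N \<subseteq> carrier M"
    and cl: "\<And>x. x \<in> carrier M \<Longrightarrow> \<psi> x \<in> carrier M'"
    and surj: "carrier M' \<subseteq> \<psi> ` carrier M"
    and add: "\<And>x y. \<lbrakk>x \<in> carrier M; y \<in> carrier M\<rbrakk> \<Longrightarrow> \<psi> (x \<oplus>\<^bsub>M\<^esub> y) = \<psi> x \<oplus>\<^bsub>M'\<^esub> \<psi> y"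
    and smult: "\<And>a x. \<lbrakk>a \<in> carrier R; x \<in> carrier M\<rbrakk> \<Longrightarrow> \<psi> (a \<odot>\<^bsub>M\<^esub> x) = a \<odot>\<^bsub>M'\<^esub> \<psi> x"
    and ker: "\<And>x y. \<lbrakk>x \<in> carrier M; y \<in> carrier M\<rbrakk> \<Longrightarrow> \<psi> x = \<psi> y \<longleftrightarrow> (\<exists>b\<in>N. x = b \<oplus>\<^bsub>M\<^esub> y)"
  shows "kmodule_isomorphic R (quot_module M N) M'"
proof -
  interpret M: Module.module R M by (rule M)
  have N_iff: "b \<in> N \<longleftrightarrow> b \<in> carrier M \<and> \<psi> b = \<psi> \<zero>\<^bsub>M\<^esub>" for b
    using ker[of b "\<zero>\<^bsub>M\<^esub>"] N by (auto simp: subset_iff)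
  have "submodule N R M"
  proof (rule M.submoduleI)
    show "N \<subseteq> carrier M" by (rule N)
    show "\<zero>\<^bsub>M\<^esub> \<in> N" by (simp add: N_iff)
    fix a b assume a: "a \<in> N" and b: "b \<in> N"
    then have "\<psi> (a \<oplus>\<^bsub>M\<^esub> b) = \<psi> (\<zero>\<^bsub>M\<^esub> \<oplus>\<^bsub>M\<^esub> \<zero>\<^bsub>M\<^esub>)" by (simp only: N_iff add M.zero_closed)
    then show "a \<oplus>\<^bsub>M\<^esub> b \<in> N" using a b by (simp add: N_iff)
  next
    fix a assume a: "a \<in> N"
    then have ac: "a \<in> carrier M" "\<psi> a = \<psi> \<zero>\<^bsub>M\<^esub>" by (auto simp: N_iff)
    have "\<psi> (a \<oplus>\<^bsub>M\<^esub> \<ominus>\<^bsub>M\<^esub> a) = \<psi> (\<zero>\<^bsub>M\<^esub> \<oplus>\<^bsub>M\<^esub> \<ominus>\<^bsub>M\<^esub> a)"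
      using ac by (simp only: add M.zero_closed M.a_inv_closed)
    then show "\<ominus>\<^bsub>M\<^esub> a \<in> N" using ac by (simp add: N_iff M.r_neg)
  next
    fix a x assume a: "a \<in> carrier R" and x: "x \<in> N"
    then have "\<psi> (a \<odot>\<^bsub>M\<^esub> x) = \<psi> (a \<odot>\<^bsub>M\<^esub> \<zero>\<^bsub>M\<^esub>)" by (simp only: N_iff smult M.zero_closed)
    then show "a \<odot>\<^bsub>M\<^esub> x \<in> N" using a x by (simp add: N_iff)
  qed
  then have sub: "subgroup N (add_monoid M)" by (rule submodule.axioms(1))
  interpret S: abelian_subgroup N M
    by (rule abelian_subgroupI3[OF additive_subgroupI[OF sub]]) (rule M.abelian_group_axioms)
  have cos: "y \<in> N +>\<^bsub>M\<^esub> x \<longleftrightarrow> y \<in> carrier M \<and> \<psi> y = \<psi> x" if x: "x \<in> carrier M" for x y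
    unfolding a_r_coset_def' using ker[of y x] x N by auto
  have cos_eq: "N +>\<^bsub>M\<^esub> x = N +>\<^bsub>M\<^esub> y \<longleftrightarrow> \<psi> x = \<psi> y" if "x \<in> carrier M" "y \<in> carrier M" for x y
    using cos[OF that(1)] cos[OF that(2)] that by (metis set_eq_iff)
  define \<Phi> where "\<Phi> X = \<psi> (SOME x. x \<in> X)" for X
  have \<Phi>: "\<Phi> (N +>\<^bsub>M\<^esub> x) = \<psi> x" if "x \<in> carrier M" for x
  proof -
    have "x \<in> N +>\<^bsub>M\<^esub> x" using that by (simp add: cos)
    then have "(SOME y. y \<in> N +>\<^bsub>M\<^esub> x) \<in> N +>\<^bsub>M\<^esub> x" by (rule someI)
    then show ?thesis using that by (simp add: \<Phi>_def cos)
  qed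
  have carr: "carrier (quot_module M N) = (\<lambda>x. N +>\<^bsub>M\<^esub> x) ` carrier M"
    by (auto simp: quot_module_def A_RCOSETS_def')
  have qadd: "(N +>\<^bsub>M\<^esub> x) \<oplus>\<^bsub>quot_module M N\<^esub> (N +>\<^bsub>M\<^esub> y) = N +>\<^bsub>M\<^esub> (x \<oplus>\<^bsub>M\<^esub> y)"
    if "x \<in> carrier M" "y \<in> carrier M" for x y
    using that by (simp add: quot_module_def S.a_rcos_sum)
  have qsmult: "a \<odot>\<^bsub>quot_module M N\<^esub> (N +>\<^bsub>M\<^esub> x) = N +>\<^bsub>M\<^esub> (a \<odot>\<^bsub>M\<^esub> x)"
    if a: "a \<in> carrier R" and x: "x \<in> carrier M" for a x
  proof -
    have 1: "N +>\<^bsub>M\<^esub> (a \<odot>\<^bsub>M\<^esub> y) = N +>\<^bsub>M\<^esub> (a \<odot>\<^bsub>M\<^esub> x)" if "y \<in> N +>\<^bsub>M\<^esub> x" for y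
      using that a x by (simp add: cos cos_eq smult)
    have 2: "x \<in> N +>\<^bsub>M\<^esub> x" using x by (simp add: cos)
    have "(\<Union>y\<in>N +>\<^bsub>M\<^esub> x. N +>\<^bsub>M\<^esub> (a \<odot>\<^bsub>M\<^esub> y)) = N +>\<^bsub>M\<^esub> (a \<odot>\<^bsub>M\<^esub> x)"
      using 1 2 by blast
    then show ?thesis by (simp add: quot_module_def)
  qed
  have "\<Phi> \<in> kmodule_hom R (quot_module M N) M'"
    unfolding kmodule_hom_def carr using cl by (auto simp: \<Phi> qadd qsmult add smult)
  moreover have "bij_betw \<Phi> (carrier (quot_module M N)) (carrier M')"
    unfolding bij_betw_def
  proof
    show "inj_on \<Phi> (carrier (quot_module M N))" unfolding carr by (auto simp: inj_on_def \<Phi> cos_eq)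
    show "\<Phi> ` carrier (quot_module M N) = carrier M'"
      unfolding carr image_image using surj cl by (auto simp: \<Phi> image_iff subset_iff)
  qed
  ultimately show ?thesis unfolding kmodule_isomorphic_def by blast
qed

lemma module_prod_module:
  assumes R: "cring R" and M: "\<And>i. i \<in> I \<Longrightarrow> Module.module R (M i)"
  shows "Module.module R (prod_module I M)"
proof -
  have ag: "abelian_group (M i)" if "i \<in> I" for i using M[OF that] by (rule module.axioms(2))
  have am: "abelian_monoid (M i)" if "i \<in> I" for i using ag[OF that] by (rule abelian_group.axioms(1))
  note cl = PiE_iff extensional_def restrict_def fun_eq_iff
  show ?thesis
  proof (rule moduleI[OF R abelian_groupI])
    fix x assume x: "x \<in> carrier (prod_module I M)"
    have "(\<lambda>i\<in>I. \<ominus>\<^bsub>M i\<^esub> x i) \<in> carrier (prod_module I M)"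
      using x ag by (auto simp: prod_module_def PiE_iff abelian_group.a_inv_closed)
    moreover have "(\<lambda>i\<in>I. \<ominus>\<^bsub>M i\<^esub> x i) \<oplus>\<^bsub>prod_module I M\<^esub> x = \<zero>\<^bsub>prod_module I M\<^esub>"
      using x ag by (auto simp: prod_module_def cl abelian_group.l_neg)
    ultimately show "\<exists>y\<in>carrier (prod_module I M). y \<oplus>\<^bsub>prod_module I M\<^esub> x = \<zero>\<^bsub>prod_module I M\<^esub>" by blast
  qed (use am in \<open>auto simp: prod_module_def cl abelian_monoid.a_closed abelian_monoid.zero_closed
      abelian_monoid.l_zero abelian_monoid.r_zero abelian_monoid.a_assoc module.smult_closed[OF M]
      module.smult_l_distr[OF M] module.smult_r_distr[OF M] module.smult_assoc1[OF M]
      module.smult_one[OF M] intro: abelian_monoid.a_comm\<close>)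
qed

context cring
begin

lemma add_minus_cancel_left: "\<lbrakk>a \<in> carrier R; b \<in> carrier R\<rbrakk> \<Longrightarrow> (a \<oplus> b) \<ominus> a = b"
  by (simp add: a_minus_def a_comm[of a b] a_assoc r_neg)

lemma act_zero_vec_fun: "act R B f (\<lambda>_. \<zero>) = (\<lambda>_. \<zero>)"
  by (simp add: act_zero_vec fun_eq_iff)

lemma act_chain_map:
  assumes F: "chain_map B d C e F" and B: "based_complex B d"
    and fin: "\<And>n. finite (B n)" "\<And>n. finite (C n)" and x: "x \<in> vecs R (B n)"
  shows "act R (C n) e (act R (B n) (F n) x) = act R (B (n - 1)) (F (n - 1)) (act R (B n) d x)"
proof -
  have xc: "x v \<in> carrier R" for v using x by (rule vecs_closed)
  have "act R (C n) e (act R (B n) (F n) x) = act R (B n) (\<lambda>v. lin e (F n v)) x"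
    using F xc fin by (intro act_act) (auto simp: chain_map_def)
  also have "\<dots> = act R (B n) (\<lambda>v. lin (F (n - 1)) (d v)) x"
    using F xc by (intro act_cong) (auto simp: chain_map_def)
  also have "\<dots> = act R (B (n - 1)) (F (n - 1)) (act R (B n) d x)"
    using based_complexD(1)[OF B, of "frag_of _"] xc fin by (intro act_act[symmetric]) auto
  finally show ?thesis .
qed

lemma act_chain_map_vecs:
  "\<lbrakk>chain_map B d C e F; \<And>n. finite (C n); x \<in> vecs R (B n)\<rbrakk> \<Longrightarrow> act R (B n) (F n) x \<in> vecs R (C n)"
  by (intro act_vecs) (auto simp: chain_map_def vecs_closed)

text \<open>On a cycle the homotopy formula loses its last term.\<close>

lemma act_homotopy:
  assumes F: "chain_map B d C e F" and B: "based_complex B d"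
    and H: "homotopic_to_id B d (\<lambda>n b. lin (G n) (F n b)) H"
    and fin: "\<And>n. finite (B n)" "\<And>n. finite (C n)" and x: "x \<in> vecs R (B n)"
    and cyc: "act R (B n) d x = (\<lambda>_. \<zero>)"
  shows "act R (B n) (H n) x \<in> vecs R (B (Suc n))"
    "x = (\<lambda>w. act R (C n) (G n) (act R (B n) (F n) x) w \<oplus> act R (B (Suc n)) d (act R (B n) (H n) x) w)"
proof -
  have xc: "x v \<in> carrier R" for v using x by (rule vecs_closed)
  show Hx: "act R (B n) (H n) x \<in> vecs R (B (Suc n))"
    using H fin xc by (intro act_vecs) (auto simp: homotopic_to_id_def)
  have 1: "act R (C n) (G n) (act R (B n) (F n) x) = act R (B n) (\<lambda>v. lin (G n) (F n v)) x"
    using F xc fin by (intro act_act) (auto simp: chain_map_def)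
  have 2: "act R (B (Suc n)) d (act R (B n) (H n) x) = act R (B n) (\<lambda>v. lin d (H n v)) x"
    using H xc fin by (intro act_act) (auto simp: homotopic_to_id_def)
  have 3: "act R (B n) (\<lambda>v. lin (H (n - 1)) (d v)) x = (\<lambda>_. \<zero>)"
  proof -
    have "act R (B n) (\<lambda>v. lin (H (n - 1)) (d v)) x = act R (B (n - 1)) (H (n - 1)) (act R (B n) d x)"
      using based_complexD(1)[OF B, of "frag_of _"] xc fin by (intro act_act[symmetric]) auto
    then show ?thesis by (simp add: cyc act_zero_vec fun_eq_iff)
  qed
  have "x = act R (B n) frag_of x" using fin x by (simp add: act_frag_of)
  also have "\<dots> = act R (B n) (\<lambda>v. lin (G n) (F n v) + lin d (H n v) + lin (H (n - 1)) (d v)) x"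
    using H xc by (intro act_cong) (auto simp: homotopic_to_id_def)
  also have "\<dots> = (\<lambda>w. act R (C n) (G n) (act R (B n) (F n) x) w \<oplus> act R (B (Suc n)) d (act R (B n) (H n) x) w)"
    using xc by (simp add: act_plus 1 2 3[unfolded One_nat_def] fun_eq_iff act_closed)
  finally show "x = (\<lambda>w. act R (C n) (G n) (act R (B n) (F n) x) w \<oplus> act R (B (Suc n)) d (act R (B n) (H n) x) w)" .
qed

definition cyc_vecs :: "(nat \<Rightarrow> 'x set) \<Rightarrow> ('x \<Rightarrow> 'x \<Rightarrow>\<^sub>0 int) \<Rightarrow> nat \<Rightarrow> ('x \<Rightarrow> 'a) set" where
  "cyc_vecs B d n = {x \<in> vecs R (B n). act R (B n) d x = (\<lambda>_. \<zero>)}"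

definition bdry_vecs :: "(nat \<Rightarrow> 'x set) \<Rightarrow> ('x \<Rightarrow> 'x \<Rightarrow>\<^sub>0 int) \<Rightarrow> nat \<Rightarrow> ('x \<Rightarrow> 'a) set" where
  "bdry_vecs B d n = act R (B (Suc n)) d ` vecs R (B (Suc n))"

lemma vecs_add: assumes "x \<in> vecs R B" "y \<in> vecs R B" shows "(\<lambda>w. x w \<oplus> y w) \<in> vecs R B"
proof -
  interpret M: Module.module R "free_module R B" by (rule module_free_module)
  show ?thesis using M.a_closed[OF assms] by simp
qed

lemma vecs_smult: assumes "a \<in> carrier R" "x \<in> vecs R B" shows "(\<lambda>w. a \<otimes> x w) \<in> vecs R B"
proof -
  interpret M: Module.module R "free_module R B" by (rule module_free_module)
  show ?thesis using M.smult_closed[OF assms] by simp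
qed

lemma vecs_minus: assumes "x \<in> vecs R B" "y \<in> vecs R B" shows "(\<lambda>w. x w \<ominus> y w) \<in> vecs R B"
proof -
  interpret M: Module.module R "free_module R B" by (rule module_free_module)
  show ?thesis using M.minus_closed[OF assms] free_module_a_inv[OF assms(2)] by (simp add: a_minus_def)
qed

lemma cyc_vecs_minus:
  assumes "finite (B n)" "x \<in> cyc_vecs B d n" "y \<in> cyc_vecs B d n"
  shows "(\<lambda>w. x w \<ominus> y w) \<in> cyc_vecs B d n"
proof -
  have "\<zero> \<ominus> \<zero> = \<zero>" by (simp add: a_minus_def)
  then show ?thesis
    using assms by (auto simp: cyc_vecs_def vecs_minus act_minus_vec vecs_closed fun_eq_iff)
qed

lemma bdry_vecs_cyc_vecs:
  assumes B: "based_complex B d" and fin: "\<And>n. finite (B n)" and y: "y \<in> vecs R (B (Suc n))"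
  shows "act R (B (Suc n)) d y \<in> cyc_vecs B d n"
proof -
  have yc: "y v \<in> carrier R" for v using y by (rule vecs_closed)
  have d: "d v \<in> chains (B n)" if "v \<in> B (Suc n)" for v using B that by (auto simp: based_complex_def)
  have "act R (B n) d (act R (B (Suc n)) d y) = act R (B (Suc n)) (\<lambda>v. lin d (d v)) y"
    using fin d yc by (intro act_act) auto
  also have "\<dots> = act R (B (Suc n)) (\<lambda>v. 0) y"
    using B yc by (intro act_cong) (auto simp: based_complex_def)
  finally show ?thesis
    using fin d yc by (auto simp: cyc_vecs_def act_zero_fun fun_eq_iff intro!: act_vecs)
qed

text \<open>An isomorphism on homology, stated on cycles: \<open>\<Phi>\<close> is linear, detects boundaries and is
  surjective up to boundaries.\<close>

lemma homotopy_equivalence_homology: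
  assumes B: "based_complex B d" and C: "based_complex C e"
    and fin: "\<And>n. finite (B n)" "\<And>n. finite (C n)"
    and eq: "homotopy_equivalent B d C e"
  obtains \<Phi> where "\<And>x y. \<lbrakk>x \<in> vecs R (B n); y \<in> vecs R (B n)\<rbrakk> \<Longrightarrow> \<Phi> (\<lambda>w. x w \<oplus> y w) = (\<lambda>w. \<Phi> x w \<oplus> \<Phi> y w)"
    "\<And>x y. \<lbrakk>x \<in> vecs R (B n); y \<in> vecs R (B n)\<rbrakk> \<Longrightarrow> \<Phi> (\<lambda>w. x w \<ominus> y w) = (\<lambda>w. \<Phi> x w \<ominus> \<Phi> y w)"
    "\<And>a x. \<lbrakk>a \<in> carrier R; x \<in> vecs R (B n)\<rbrakk> \<Longrightarrow> \<Phi> (\<lambda>w. a \<otimes> x w) = (\<lambda>w. a \<otimes> \<Phi> x w)"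
    "\<And>x. x \<in> cyc_vecs B d n \<Longrightarrow> \<Phi> x \<in> cyc_vecs C e n"
    "\<And>x. x \<in> cyc_vecs B d n \<Longrightarrow> \<Phi> x \<in> bdry_vecs C e n \<longleftrightarrow> x \<in> bdry_vecs B d n"
    "\<And>y. y \<in> cyc_vecs C e n \<Longrightarrow> \<exists>x\<in>cyc_vecs B d n. (\<lambda>w. y w \<ominus> \<Phi> x w) \<in> bdry_vecs C e n"
proof -
  obtain F G H K where F: "chain_map B d C e F" and G: "chain_map C e B d G"
    and H: "homotopic_to_id B d (\<lambda>n b. lin (G n) (F n b)) H"
    and K: "homotopic_to_id C e (\<lambda>n c. lin (F n) (G n c)) K"
    using eq unfolding homotopy_equivalent_def by blast
  let ?F = "\<lambda>n. act R (B n) (F n)" and ?G = "\<lambda>n. act R (C n) (G n)"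
  have Fcyc: "?F n x \<in> cyc_vecs C e n" if "x \<in> cyc_vecs B d n" for x
    using that act_chain_map[OF F B fin, of x n] act_chain_map_vecs[OF F fin(2)]
    by (simp add: cyc_vecs_def act_zero_vec_fun)
  have Gcyc: "?G n x \<in> cyc_vecs B d n" if "x \<in> cyc_vecs C e n" for x
    using that act_chain_map[OF G C fin(2,1), of x n] act_chain_map_vecs[OF G fin(1)]
    by (simp add: cyc_vecs_def act_zero_vec_fun)
  have bd: "?F n x \<in> bdry_vecs C e n \<longleftrightarrow> x \<in> bdry_vecs B d n" if x: "x \<in> cyc_vecs B d n" for x
  proof
    assume "x \<in> bdry_vecs B d n"
    then obtain y where y: "y \<in> vecs R (B (Suc n))" "x = act R (B (Suc n)) d y" by (auto simp: bdry_vecs_def)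
    then have "?F n x = act R (C (Suc n)) e (?F (Suc n) y)"
      using act_chain_map[OF F B fin y(1)] by simp
    then show "?F n x \<in> bdry_vecs C e n" using act_chain_map_vecs[OF F fin(2) y(1)] by (auto simp: bdry_vecs_def)
  next
    assume "?F n x \<in> bdry_vecs C e n"
    then obtain y where y: "y \<in> vecs R (C (Suc n))" "?F n x = act R (C (Suc n)) e y" by (auto simp: bdry_vecs_def)
    then have GF: "?G n (?F n x) = act R (B (Suc n)) d (?G (Suc n) y)"
      using act_chain_map[OF G C fin(2,1) y(1)] by simp
    have x': "x \<in> vecs R (B n)" "act R (B n) d x = (\<lambda>_. \<zero>)" using x by (auto simp: cyc_vecs_def)
    let ?z = "\<lambda>w. ?G (Suc n) y w \<oplus> act R (B n) (H n) x w"
    have Gy: "?G (Suc n) y \<in> vecs R (B (Suc n))" by (rule act_chain_map_vecs[OF G fin(1) y(1)])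
    note Hx = act_homotopy[OF F B H fin x']
    have "x = (\<lambda>w. act R (B (Suc n)) d (?G (Suc n) y) w \<oplus> act R (B (Suc n)) d (act R (B n) (H n) x) w)"
      using Hx(2) unfolding GF .
    also have "\<dots> = act R (B (Suc n)) d ?z"
      by (intro ext act_add_vec[symmetric] vecs_closed[OF Gy] vecs_closed[OF Hx(1)])
    finally show "x \<in> bdry_vecs B d n" unfolding bdry_vecs_def using vecs_add[OF Gy Hx(1)] by (rule image_eqI)
  qed
  have sur: "\<exists>x\<in>cyc_vecs B d n. (\<lambda>w. y w \<ominus> ?F n x w) \<in> bdry_vecs C e n" if y: "y \<in> cyc_vecs C e n" for y
  proof (rule bexI[OF _ Gcyc[OF y]])
    have y': "y \<in> vecs R (C n)" "act R (C n) e y = (\<lambda>_. \<zero>)" using y by (auto simp: cyc_vecs_def)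
    note Ky = act_homotopy[OF G C K fin(2,1) y']
    have FG: "?F n (?G n y) \<in> vecs R (C n)" using Fcyc[OF Gcyc[OF y]] by (simp add: cyc_vecs_def)
    have dK: "act R (C (Suc n)) e (act R (C n) (K n) y) w \<in> carrier R" for w
      by (rule act_closed[OF vecs_closed[OF Ky(1)]])
    have "y w \<ominus> ?F n (?G n y) w = act R (C (Suc n)) e (act R (C n) (K n) y) w" for w
    proof -
      have eq: "y w = ?F n (?G n y) w \<oplus> act R (C (Suc n)) e (act R (C n) (K n) y) w"
        using Ky(2) by (rule fun_cong)
      show ?thesis by (subst eq) (rule add_minus_cancel_left[OF vecs_closed[OF FG] dK])
    qed
    then show "(\<lambda>w. y w \<ominus> ?F n (?G n y) w) \<in> bdry_vecs C e n"
      using Ky(1) by (auto simp: bdry_vecs_def)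
  qed
  show ?thesis
  proof (rule that[of "?F n"])
    show "\<And>x y. \<lbrakk>x \<in> vecs R (B n); y \<in> vecs R (B n)\<rbrakk> \<Longrightarrow> ?F n (\<lambda>w. x w \<oplus> y w) = (\<lambda>w. ?F n x w \<oplus> ?F n y w)"
      by (simp add: fun_eq_iff act_add_vec vecs_closed)
    show "\<And>x y. \<lbrakk>x \<in> vecs R (B n); y \<in> vecs R (B n)\<rbrakk> \<Longrightarrow> ?F n (\<lambda>w. x w \<ominus> y w) = (\<lambda>w. ?F n x w \<ominus> ?F n y w)"
      using fin by (simp add: fun_eq_iff act_minus_vec vecs_closed)
    show "\<And>a x. \<lbrakk>a \<in> carrier R; x \<in> vecs R (B n)\<rbrakk> \<Longrightarrow> ?F n (\<lambda>w. a \<otimes> x w) = (\<lambda>w. a \<otimes> ?F n x w)"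
      using fin by (simp add: fun_eq_iff act_smult_vec vecs_closed)
  qed (use Fcyc bd sur in auto)
qed

end

context cyclic_group_algebra
begin

lemma module_Tot: "Module.module k (Tot n)"
  unfolding tot_module_def
  by (rule module_prod_module) (auto simp: cyc_obj_def C_simps module_free_module is_cring)

abbreviation "word_cycles \<equiv> cyc_vecs cyc_basis cyc_d"
abbreviation "word_bdries \<equiv> bdry_vecs cyc_basis cyc_d"
abbreviation "small_cycles \<equiv> cyc_vecs small_basis small_d"
abbreviation "small_bdries \<equiv> bdry_vecs small_basis small_d"
abbreviation "tot_cycles \<equiv> cycles (\<lambda>n. Tot n) (\<lambda>n. tot_d n)"
abbreviation "tot_bdries \<equiv> boundaries (\<lambda>n. Tot n) (\<lambda>n. tot_d n)"

lemma flat_inj: "\<lbrakk>x \<in> carrier (Tot n); y \<in> carrier (Tot n); flat k n x = flat k n y\<rbrakk> \<Longrightarrow> x = y"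
  using flat_bij unfolding bij_betw_def inj_on_def by blast

lemma flat_surj: "y \<in> vecs k (cyc_basis n) \<Longrightarrow> \<exists>x\<in>carrier (Tot n). flat k n x = y"
  using bij_betw_imp_surj_on[OF flat_bij, of n] by (metis imageE)

lemma tot_d_closed: assumes x: "x \<in> carrier (Tot (Suc n))" shows "tot_d (Suc n) x \<in> carrier (Tot n)"
proof -
  have "act k (cyc_basis (Suc n)) cyc_d (flat k (Suc n) x) \<in> vecs k (cyc_basis n)"
    using bdry_vecs_cyc_vecs[OF based_complex_cyc finite_cyc_basis flat_vecs[OF x]] by (simp add: cyc_vecs_def)
  then obtain y where y: "y \<in> carrier (Tot n)" "flat k n y = flat k n (tot_d (Suc n) x)"
    using flat_surj flat_tot_diff[OF x] by metis
  have "y p = tot_d (Suc n) x p" for p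
  proof (cases "p \<le> n")
    case True
    show ?thesis
    proof
      fix w show "y p w = tot_d (Suc n) x p w" using fun_cong[OF y(2), of "(p, w)"] True by (simp add: flat_def)
    qed
  next
    case False
    then show ?thesis using y(1) by (auto simp: Tot_carrier PiE_iff extensional_def tot_diff_def)
  qed
  then have "y = tot_d (Suc n) x" ..
  then show ?thesis using y(1) by simp
qed

lemma cycles_Tot:
  "x \<in> tot_cycles n \<longleftrightarrow> x \<in> carrier (Tot n) \<and> flat k n x \<in> word_cycles n"
proof (cases n)
  case 0
  have "act k (cyc_basis 0) cyc_d y = (\<lambda>_. \<zero>)" for y
  proof -
    have "act k (cyc_basis 0) cyc_d y = act k (cyc_basis 0) (\<lambda>_. 0) y"
      using based_complex_cyc unfolding act_def based_complex_def by (intro ext finsum_cong') auto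
    then show ?thesis by (simp add: act_zero_fun fun_eq_iff)
  qed
  then show ?thesis using 0 flat_vecs[of x 0] by (auto simp: cycles_def cyc_vecs_def)
next
  case (Suc l)
  have z: "\<zero>\<^bsub>Tot l\<^esub> \<in> carrier (Tot l)"
    using module_Tot[of l] by (metis abelian_group.axioms(1) abelian_monoid.zero_closed module.axioms(2))
  have "tot_d (Suc l) x = \<zero>\<^bsub>Tot l\<^esub> \<longleftrightarrow> act k (cyc_basis (Suc l)) cyc_d (flat k (Suc l) x) = (\<lambda>_. \<zero>)"
    if x: "x \<in> carrier (Tot (Suc l))"
    using flat_inj[OF tot_d_closed[OF x] z] flat_zero[of l] flat_tot_diff[OF x] by auto
  then show ?thesis using Suc flat_vecs[of x "Suc l"]
    by (auto simp: cycles_def cyc_vecs_def a_kernel_def kernel_def)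
qed

lemma cycles_submodule: "submodule (tot_cycles n) k (Tot n)"
proof -
  interpret M: Module.module k "Tot n" by (rule module_Tot)
  let ?Z = "tot_cycles n"
  have fin: "finite (cyc_basis n)" by (rule finite_cyc_basis)
  have sm: "a \<odot>\<^bsub>Tot n\<^esub> x \<in> ?Z" if a: "a \<in> carrier k" and x: "x \<in> ?Z" for a x
    using that fin
    by (auto simp: cycles_Tot cyc_vecs_def flat_smult act_smult_vec vecs_closed vecs_smult fun_eq_iff)
  show ?thesis
  proof (rule M.submoduleI)
    show "?Z \<subseteq> carrier (Tot n)" by (auto simp: cycles_Tot)
    show "\<zero>\<^bsub>Tot n\<^esub> \<in> ?Z"
      using flat_vecs[OF M.zero_closed] by (simp add: cycles_Tot cyc_vecs_def flat_zero act_zero_vec fun_eq_iff)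
    fix x assume x: "x \<in> ?Z"
    then have "\<ominus>\<^bsub>Tot n\<^esub> x = (\<ominus> \<one>) \<odot>\<^bsub>Tot n\<^esub> x"
      by (simp add: cycles_Tot M.smult_l_minus)
    then show "\<ominus>\<^bsub>Tot n\<^esub> x \<in> ?Z" using sm[OF _ x] by simp
  next
    fix x y assume "x \<in> ?Z" "y \<in> ?Z"
    then show "x \<oplus>\<^bsub>Tot n\<^esub> y \<in> ?Z"
      using fin by (auto simp: cycles_Tot cyc_vecs_def flat_add act_add_vec vecs_closed vecs_add fun_eq_iff)
  qed (rule sm)
qed

lemma boundaries_Tot:
  assumes "x \<in> carrier (Tot n)"
  shows "x \<in> tot_bdries n \<longleftrightarrow> flat k n x \<in> word_bdries n"
proof
  assume "x \<in> tot_bdries n"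
  then show "flat k n x \<in> word_bdries n"
    by (auto simp: boundaries_def bdry_vecs_def flat_tot_diff flat_vecs)
next
  assume "flat k n x \<in> word_bdries n"
  then obtain y where y: "y \<in> vecs k (cyc_basis (Suc n))" "flat k n x = act k (cyc_basis (Suc n)) cyc_d y"
    by (auto simp: bdry_vecs_def)
  then obtain u where u: "u \<in> carrier (Tot (Suc n))" "flat k (Suc n) u = y" using flat_surj by blast
  then have "x = tot_d (Suc n) u"
    using y flat_inj[OF assms tot_d_closed[OF u(1)]] flat_tot_diff[OF u(1)] by simp
  then show "x \<in> tot_bdries n" using u by (auto simp: boundaries_def)
qed

lemma finite_small_basis: "finite (small_basis n)"
proof -
  have "small_basis n \<subseteq> {..n} \<times> {..n}" by (auto simp: small_basis_def)
  then show ?thesis by (rule finite_subset) simp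
qed

text \<open>It remains to describe the homology of the small complex: any linear map from its cycles onto a
  module that separates exactly the homology classes identifies this module with cyclic homology.\<close>

theorem CM_HC_isomorphic:
  assumes cl: "\<And>s. s \<in> small_cycles n \<Longrightarrow> \<psi> s \<in> carrier M'"
    and surj: "carrier M' \<subseteq> \<psi> ` small_cycles n"
    and add: "\<And>s t. \<lbrakk>s \<in> small_cycles n; t \<in> small_cycles n\<rbrakk> \<Longrightarrow> \<psi> (\<lambda>w. s w \<oplus> t w) = \<psi> s \<oplus>\<^bsub>M'\<^esub> \<psi> t"
    and smult: "\<And>a s. \<lbrakk>a \<in> carrier k; s \<in> small_cycles n\<rbrakk> \<Longrightarrow> \<psi> (\<lambda>w. a \<otimes> s w) = a \<odot>\<^bsub>M'\<^esub> \<psi> s"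
    and ker: "\<And>s t. \<lbrakk>s \<in> small_cycles n; t \<in> small_cycles n\<rbrakk> \<Longrightarrow>
        \<psi> s = \<psi> t \<longleftrightarrow> (\<lambda>w. s w \<ominus> t w) \<in> small_bdries n"
  shows "kmodule_isomorphic k (CM_HC k L \<pi> n) M'"
proof -
  obtain \<Phi> where \<Phi>_add: "\<And>x y. \<lbrakk>x \<in> vecs k (cyc_basis n); y \<in> vecs k (cyc_basis n)\<rbrakk> \<Longrightarrow> \<Phi> (\<lambda>w. x w \<oplus> y w) = (\<lambda>w. \<Phi> x w \<oplus> \<Phi> y w)"
    and \<Phi>_minus: "\<And>x y. \<lbrakk>x \<in> vecs k (cyc_basis n); y \<in> vecs k (cyc_basis n)\<rbrakk> \<Longrightarrow> \<Phi> (\<lambda>w. x w \<ominus> y w) = (\<lambda>w. \<Phi> x w \<ominus> \<Phi> y w)"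
    and \<Phi>_smult: "\<And>a x. \<lbrakk>a \<in> carrier k; x \<in> vecs k (cyc_basis n)\<rbrakk> \<Longrightarrow> \<Phi> (\<lambda>w. a \<otimes> x w) = (\<lambda>w. a \<otimes> \<Phi> x w)"
    and \<Phi>_cyc: "\<And>x. x \<in> word_cycles n \<Longrightarrow> \<Phi> x \<in> small_cycles n"
    and \<Phi>_bdry: "\<And>x. x \<in> word_cycles n \<Longrightarrow> \<Phi> x \<in> small_bdries n \<longleftrightarrow> x \<in> word_bdries n"
    and \<Phi>_surj: "\<And>y. y \<in> small_cycles n \<Longrightarrow> \<exists>x\<in>word_cycles n. (\<lambda>w. y w \<ominus> \<Phi> x w) \<in> small_bdries n"
    using homotopy_equivalence_homology[OF based_complex_cyc based_complex_small finite_cyc_basis finite_small_basis cyc_equivalent_small]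
    by blast
  let ?Z = "tot_cycles n" and ?B = "tot_bdries n"
  interpret M: Module.module k "Tot n" by (rule module_Tot)
  have BZ: "?B \<subseteq> ?Z"
  proof
    fix b assume "b \<in> ?B"
    then obtain u where u: "u \<in> carrier (Tot (Suc n))" "b = tot_d (Suc n) u" by (auto simp: boundaries_def)
    then show "b \<in> ?Z"
      using tot_d_closed flat_tot_diff bdry_vecs_cyc_vecs[OF based_complex_cyc finite_cyc_basis flat_vecs[OF u(1)]]
      by (simp add: cycles_Tot)
  qed
  have Zv: "flat k n x \<in> word_cycles n" "flat k n x \<in> vecs k (cyc_basis n)" "x \<in> carrier (Tot n)" if "x \<in> ?Z" for x
    using that by (auto simp: cycles_Tot flat_vecs)
  have "kmodule_isomorphic k (quot_module ((Tot n)\<lparr>carrier := ?Z\<rparr>) ?B) M'"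
  proof (rule quot_module_isomorphic[where \<psi> = "\<lambda>x. \<psi> (\<Phi> (flat k n x))"])
    show "Module.module k ((Tot n)\<lparr>carrier := ?Z\<rparr>)"
      by (rule submodule.submodule_is_module[OF cycles_submodule module_Tot])
    show "?B \<subseteq> carrier ((Tot n)\<lparr>carrier := ?Z\<rparr>)" using BZ by simp
    show "\<psi> (\<Phi> (flat k n x)) \<in> carrier M'" if "x \<in> carrier ((Tot n)\<lparr>carrier := ?Z\<rparr>)" for x
      using that Zv(1) by (simp add: cl \<Phi>_cyc)
    show "carrier M' \<subseteq> (\<lambda>x. \<psi> (\<Phi> (flat k n x))) ` carrier ((Tot n)\<lparr>carrier := ?Z\<rparr>)"
    proof
      fix \<mu> assume "\<mu> \<in> carrier M'"
      then obtain s where s: "s \<in> small_cycles n" "\<mu> = \<psi> s" using surj by auto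
      obtain y where y: "y \<in> word_cycles n" "(\<lambda>w. s w \<ominus> \<Phi> y w) \<in> small_bdries n"
        using \<Phi>_surj[OF s(1)] by blast
      then obtain x where x: "x \<in> carrier (Tot n)" "flat k n x = y"
        using flat_surj[of y n] by (auto simp: cyc_vecs_def)
      then have "x \<in> ?Z" using y by (simp add: cycles_Tot)
      moreover have "\<psi> s = \<psi> (\<Phi> y)" using ker[OF s(1) \<Phi>_cyc[OF y(1)]] y(2) by simp
      ultimately show "\<mu> \<in> (\<lambda>x. \<psi> (\<Phi> (flat k n x))) ` carrier ((Tot n)\<lparr>carrier := ?Z\<rparr>)"
        using x(2) s(2) by auto
    qed
    show "\<psi> (\<Phi> (flat k n (x \<oplus>\<^bsub>(Tot n)\<lparr>carrier := ?Z\<rparr>\<^esub> y))) = \<psi> (\<Phi> (flat k n x)) \<oplus>\<^bsub>M'\<^esub> \<psi> (\<Phi> (flat k n y))"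
      if "x \<in> carrier ((Tot n)\<lparr>carrier := ?Z\<rparr>)" "y \<in> carrier ((Tot n)\<lparr>carrier := ?Z\<rparr>)" for x y
      using that Zv by (simp add: flat_add \<Phi>_add add \<Phi>_cyc)
    show "\<psi> (\<Phi> (flat k n (a \<odot>\<^bsub>(Tot n)\<lparr>carrier := ?Z\<rparr>\<^esub> x))) = a \<odot>\<^bsub>M'\<^esub> \<psi> (\<Phi> (flat k n x))"
      if "a \<in> carrier k" "x \<in> carrier ((Tot n)\<lparr>carrier := ?Z\<rparr>)" for a x
      using that Zv by (simp add: flat_smult \<Phi>_smult smult \<Phi>_cyc)
    show "\<psi> (\<Phi> (flat k n x)) = \<psi> (\<Phi> (flat k n y)) \<longleftrightarrow> (\<exists>b\<in>?B. x = b \<oplus>\<^bsub>(Tot n)\<lparr>carrier := ?Z\<rparr>\<^esub> y)"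
      if "x \<in> carrier ((Tot n)\<lparr>carrier := ?Z\<rparr>)" "y \<in> carrier ((Tot n)\<lparr>carrier := ?Z\<rparr>)" for x y
    proof -
      have xy: "x \<in> ?Z" "y \<in> ?Z" using that by auto
      let ?d = "\<lambda>w. flat k n x w \<ominus> flat k n y w"
      have c: "flat k n x w \<in> carrier k" "flat k n y w \<in> carrier k" for w
        using vecs_closed[OF Zv(2)[OF xy(1)]] vecs_closed[OF Zv(2)[OF xy(2)]] by auto
      have d: "?d \<in> word_cycles n" using cyc_vecs_minus[OF finite_cyc_basis Zv(1)[OF xy(1)] Zv(1)[OF xy(2)]] .
      have "\<psi> (\<Phi> (flat k n x)) = \<psi> (\<Phi> (flat k n y)) \<longleftrightarrow> \<Phi> ?d \<in> small_bdries n"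
        using ker[OF \<Phi>_cyc \<Phi>_cyc] Zv xy by (simp add: \<Phi>_minus)
      also have "\<dots> \<longleftrightarrow> ?d \<in> word_bdries n" by (rule \<Phi>_bdry[OF d])
      also have "\<dots> \<longleftrightarrow> (\<exists>b\<in>?B. x = b \<oplus>\<^bsub>Tot n\<^esub> y)"
      proof
        assume d': "?d \<in> word_bdries n"
        obtain b where b: "b \<in> carrier (Tot n)" "flat k n b = ?d"
          using flat_surj[of ?d n] d by (auto simp: cyc_vecs_def)
        have bB: "b \<in> ?B" using b d' by (simp add: boundaries_Tot)
        have "flat k n x = flat k n (b \<oplus>\<^bsub>Tot n\<^esub> y)"
          using c by (simp add: flat_add b fun_eq_iff a_minus_def a_assoc l_neg)
        then have "x = b \<oplus>\<^bsub>Tot n\<^esub> y" using flat_inj b(1) Zv(3)[OF xy(1)] Zv(3)[OF xy(2)] by simp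
        then show "\<exists>b\<in>?B. x = b \<oplus>\<^bsub>Tot n\<^esub> y" using bB by blast
      next
        assume "\<exists>b\<in>?B. x = b \<oplus>\<^bsub>Tot n\<^esub> y"
        then obtain b where b: "b \<in> ?B" "x = b \<oplus>\<^bsub>Tot n\<^esub> y" by blast
        have bZ: "b \<in> ?Z" using b(1) BZ by blast
        have "?d = flat k n b"
          using c vecs_closed[OF Zv(2)[OF bZ]] by (simp add: b(2) flat_add fun_eq_iff a_minus_def a_assoc r_neg)
        then show "?d \<in> word_bdries n" using b(1) Zv(3)[OF bZ] by (simp add: boundaries_Tot)
      qed
      finally show ?thesis by simp
    qed
  qed
  then show ?thesis by (simp add: CM_HC_def cyclic_homology_def homology_def)
qed

end

section \<open>A generator with a prescribed power\<close>

text \<open>Units lift along $\mathbb{Z}/N \to \mathbb{Z}/(N/g)$: to $a/g$, which is coprime to $N/g$, one adds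
  the multiple of $N/g$ by the product of the primes that divide $g$ but not $a/g$.\<close>

lemma coprime_representative:
  fixes N a :: nat
  assumes N: "0 < N"
  obtains u where "coprime u N" "(u * gcd N a) mod N = a mod N"
proof -
  define g where "g = gcd N a"
  define N1 where "N1 = N div g"
  define a1 where "a1 = a div g"
  have m: "g \<noteq> 0" using N by (simp add: g_def)
  have Nm: "N = g * N1" and am: "a = g * a1" by (simp_all add: N1_def a1_def g_def)
  have cop: "coprime N1 a1" unfolding N1_def a1_def g_def using N by (intro div_gcd_coprime) auto
  define P where "P = \<Prod>{p. prime p \<and> p dvd g \<and> \<not> p dvd a1}"
  have finP: "finite {p. prime p \<and> p dvd g \<and> \<not> p dvd a1}"
    by (rule finite_subset[of _ "{..g}"]) (use m in \<open>auto dest: dvd_imp_le\<close>)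
  let ?u = "a1 + N1 * P"
  have "coprime ?u N"
  proof (rule ccontr)
    assume "\<not> coprime ?u N"
    then have "gcd ?u N \<noteq> 1" by (simp add: coprime_iff_gcd_eq_1)
    then obtain p where "prime p" "p dvd gcd ?u N" using prime_factor_nat by blast
    then have p: "prime p" "p dvd ?u" "p dvd N" by auto
    show False
    proof (cases "p dvd a1")
      case True
      then have "p dvd N1 * P" using p(2) by (simp add: dvd_add_right_iff)
      moreover have "\<not> p dvd N1" using True cop p(1) by (meson coprime_common_divisor not_prime_unit)
      ultimately have "p dvd P" using p(1) by (simp add: prime_dvd_mult_iff)
      then obtain r where "r \<in> {p. prime p \<and> p dvd g \<and> \<not> p dvd a1}" "p dvd r"
        using p(1) finP unfolding P_def by (auto simp: prime_dvd_prod_iff)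
      then show False using True p(1) primes_dvd_imp_eq by auto
    next
      case False
      show False
      proof (cases "p dvd N1")
        case True
        then show False using False p(2) by (simp add: dvd_add_left_iff)
      next
        case N1: False
        then have "p dvd g" using p(1,3) Nm by (metis prime_dvd_mult_iff)
        then have "p dvd P" unfolding P_def using False p(1) finP by (intro dvd_prodI) auto
        then show False using False p(2) by (simp add: dvd_add_left_iff)
      qed
    qed
  qed
  moreover have "(?u * g) mod N = a mod N"
  proof -
    have "?u * g = g * a1 + g * N1 * P" by (simp add: algebra_simps)
    then have "?u * g = a + N * P" by (simp only: am[symmetric] Nm[symmetric])
    then show ?thesis by simp
  qed
  ultimately show ?thesis using that unfolding g_def by blast
qed

lemma (in group) generator_with_power:
  assumes fin: "finite (carrier G)" and cyc: "cyclic_group G" and pi: "\<pi> \<in> carrier G"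
    and m: "m = subgroup_index G (generate G {\<pi>})"
  obtains \<gamma> N1 where "\<gamma> \<in> carrier G" "carrier G = range (\<lambda>i::int. \<gamma> [^] i)" "ord \<gamma> = m * N1" "0 < m * N1" "\<pi> = \<gamma> [^] m"
proof -
  obtain c where c: "c \<in> carrier G" "carrier G = range (\<lambda>i::int. c [^] i)" using cyc cyclic_group by blast
  have ord_iff: "ord x = order G \<longleftrightarrow> carrier G = range (\<lambda>i::int. x [^] i)" if "x \<in> carrier G" for x
  proof -
    have gen: "generate G {x} = range (\<lambda>i::int. x [^] i)" using generate_pow[OF that] by auto
    have "range (\<lambda>i::int. x [^] i) \<subseteq> carrier G" using that by auto
    then show ?thesis
      using generate_pow_card[OF that] fin unfolding gen order_def by (metis card_subset_eq)
  qed
  let ?N = "order G"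
  have N: "0 < ?N" using fin order_gt_0_iff_finite by blast
  have ordc: "ord c = ?N" using ord_iff c by blast
  obtain i :: int where i: "\<pi> = c [^] i" using pi c(2) by blast
  define a where "a = nat (i mod int ?N)"
  have "\<pi> = c [^] int a"
    using i N c(1) by (simp add: a_def int_pow_eq ordc mod_eq_dvd_iff[symmetric])
  then have a: "\<pi> = c [^] a" by (simp add: int_pow_int)
  have ord_pi: "ord \<pi> = ?N div gcd ?N a" using ord_pow_gen[OF c(1), of a] N by (auto simp: a ordc)
  have "m * card (generate G {\<pi>}) = ?N"
    unfolding m subgroup_index_def by (rule lagrange) (simp add: generate_is_subgroup pi)
  then have mN: "m * (?N div gcd ?N a) = ?N" using generate_pow_card[OF pi] ord_pi by simp
  moreover have "gcd ?N a * (?N div gcd ?N a) = ?N" by simp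
  ultimately have mg: "m = gcd ?N a" using N by (metis mult_cancel2 mult_eq_0_iff less_irrefl)
  obtain u where u: "coprime u ?N" "(u * gcd ?N a) mod ?N = a mod ?N" using coprime_representative[OF N] .
  define \<gamma> where "\<gamma> = c [^] u"
  have \<gamma>: "\<gamma> \<in> carrier G" using c(1) by (simp add: \<gamma>_def)
  have ord\<gamma>: "ord \<gamma> = ?N" using pow_ord_eq_ord_iff[OF fin c(1), of u] u(1) by (simp add: \<gamma>_def ordc)
  have "\<gamma> [^] m = c [^] (u * m)" using c(1) by (simp add: \<gamma>_def nat_pow_pow)
  also have "\<dots> = c [^] a"
  proof -
    have "int (u * m) mod int ?N = int a mod int ?N" using u(2) unfolding mg by (simp only: zmod_int[symmetric])
    then have "c [^] int (u * m) = c [^] int a"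
      unfolding int_pow_eq[OF c(1)] ordc by (simp add: mod_eq_dvd_iff dvd_diff_commute)
    then show ?thesis by (simp only: int_pow_int)
  qed
  finally have "\<pi> = \<gamma> [^] m" by (simp add: a)
  then show ?thesis
    using that[of \<gamma> "?N div gcd ?N a"] \<gamma> ord\<gamma> ord_iff[OF \<gamma>] mN N by simp
qed

section \<open>Homology of the small complex\<close>

context cyclic_group_algebra
begin

lemma act_small_d_odd: assumes "odd n" shows "act k (small_basis n) small_d s = (\<lambda>_. \<zero>)"
proof -
  have "act k (small_basis n) small_d s = act k (small_basis n) (\<lambda>_. 0) s"
    unfolding act_def by (intro ext finsum_cong') (use assms in \<open>auto simp: small_basis_def small_d_def\<close>)
  then show ?thesis by (simp add: act_zero_fun fun_eq_iff)
qed

text \<open>The coordinates of a chain \<open>s\<close> in degree \<open>2 * l\<close> are \<open>s (j, 2 * (l - j))\<close> for \<open>j \<le> l\<close>. Writing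
  \<open>N = m * N1\<close>, the differential is \<open>m\<close> times \<open>step\<close>.\<close>

definition step :: "nat \<Rightarrow> (nat \<times> nat \<Rightarrow> 'a) \<Rightarrow> nat \<Rightarrow> nat \<Rightarrow> 'a" where
  "step N1 s l j = [int N1] \<cdot> s (j, 2 * (l - j)) \<oplus> s (Suc j, 2 * (l - Suc j))"

lemma step_closed: "s \<in> vecs k (small_basis n) \<Longrightarrow> step N1 s l j \<in> carrier k"
  by (simp add: step_def vecs_closed)

lemma small_basis_even: "v \<in> small_basis (2 * l) \<Longrightarrow> \<exists>j\<le>l. v = (j, 2 * (l - j))"
  by (auto simp: small_basis_def)

lemma small_basis_odd: "v \<in> small_basis (Suc (2 * l)) \<Longrightarrow> \<exists>j\<le>l. v = (j, 2 * (l - j) + 1)"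
proof -
  assume "v \<in> small_basis (Suc (2 * l))"
  then obtain j i where "v = (j, i)" "2 * j + i = Suc (2 * l)" by (auto simp: small_basis_def)
  then have "j \<le> l" "v = (j, 2 * (l - j) + 1)" by auto
  then show ?thesis by blast
qed

lemma act_small_d_even:
  assumes s: "s \<in> vecs k (small_basis (2 * l))" and j: "j < l" and N1: "N = m * N1"
  shows "act k (small_basis (2 * l)) small_d s (j, 2 * (l - j) - 1) = [m] \<cdot> step N1 s l j"
proof -
  have sc: "s u \<in> carrier k" for u using s by (rule vecs_closed)
  let ?A = "\<lambda>(j, i). if odd i \<or> i = 0 then 0 else frag_cmul (int N) (frag_of (j, i - 1))"
  let ?B = "\<lambda>(j, i). if odd i \<or> j = 0 then 0 else frag_cmul (int m) (frag_of (j - 1, Suc i))"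
  let ?u = "(j, 2 * (l - j) - 1)"
  have "small_d = (\<lambda>b. ?A b + ?B b)" by (auto simp: small_d_def fun_eq_iff)
  then have "act k (small_basis (2 * l)) small_d s ?u = act k (small_basis (2 * l)) ?A s ?u \<oplus> act k (small_basis (2 * l)) ?B s ?u"
    using sc by (simp only: act_plus)
  also have "act k (small_basis (2 * l)) ?A s ?u = [int N] \<cdot> s (j, 2 * (l - j))"
  proof (rule act_single[OF finite_small_basis])
    fix v assume "v \<in> small_basis (2 * l)"
    then obtain a where v: "v = (a, 2 * (l - a))" "a \<le> l" using small_basis_even by blast
    show "entry (?A v) ?u = (if v = (j, 2 * (l - j)) then int N else 0)"
      using j by (cases "a = j") (auto simp: v(1) lookup_frag_of)
  qed (use j sc in \<open>auto simp: small_basis_def\<close>)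
  also have "act k (small_basis (2 * l)) ?B s ?u = [int m] \<cdot> s (Suc j, 2 * (l - Suc j))"
  proof (rule act_single[OF finite_small_basis])
    fix v assume "v \<in> small_basis (2 * l)"
    then obtain a where v: "v = (a, 2 * (l - a))" "a \<le> l" using small_basis_even by blast
    have e: "Suc (2 * (l - Suc j)) = 2 * (l - j) - 1" using j by simp
    show "entry (?B v) ?u = (if v = (Suc j, 2 * (l - Suc j)) then int m else 0)"
    proof (cases "a = Suc j")
      case True
      then show ?thesis by (simp add: v(1) lookup_frag_of e del: One_nat_def)
    next
      case False
      then have "a = 0 \<or> a - 1 \<noteq> j" by auto
      then show ?thesis using False by (auto simp: v(1) lookup_frag_of)
    qed
  qed (use j sc in \<open>auto simp: small_basis_def\<close>)
  also have "[int N] \<cdot> s (j, 2 * (l - j)) \<oplus> [int m] \<cdot> s (Suc j, 2 * (l - Suc j)) = [int m] \<cdot> step N1 s l j"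
    using sc by (simp add: step_def N1 mult_int_mult mult_int_add_right)
  finally show ?thesis by (simp add: mult_int_of_nat)
qed

lemma small_cycle_iff:
  assumes s: "s \<in> vecs k (small_basis (2 * l))" and N1: "N = m * N1"
  shows "act k (small_basis (2 * l)) small_d s = (\<lambda>_. \<zero>) \<longleftrightarrow> (\<forall>j<l. [m] \<cdot> step N1 s l j = \<zero>)"
proof
  assume "act k (small_basis (2 * l)) small_d s = (\<lambda>_. \<zero>)"
  then show "\<forall>j<l. [m] \<cdot> step N1 s l j = \<zero>" using act_small_d_even[OF s _ N1] by metis
next
  assume *: "\<forall>j<l. [m] \<cdot> step N1 s l j = \<zero>"
  show "act k (small_basis (2 * l)) small_d s = (\<lambda>_. \<zero>)"
  proof
    fix u :: "nat \<times> nat"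
    obtain j i where u: "u = (j, i)" by fastforce
    show "act k (small_basis (2 * l)) small_d s u = \<zero>"
    proof (cases "2 * j + i + 1 = 2 * l")
      case True
      then have "j < l" "i = 2 * (l - j) - 1" by auto
      then show ?thesis using act_small_d_even[OF s _ N1] * u by simp
    next
      case False
      have "entry (small_d v) u = 0" if "v \<in> small_basis (2 * l)" for v
      proof -
        obtain j' where v: "v = (j', 2 * (l - j'))" "j' \<le> l" using small_basis_even[OF \<open>v \<in> small_basis (2 * l)\<close>] by blast
        have "small_d v \<in> chains {(j, i). 2 * j + i + 1 = 2 * l}"
          using v(2) by (auto simp: v(1) small_d_def)
        then have "u \<notin> Poly_Mapping.keys (small_d v)" using False by (auto simp: chains_def u)
        then show ?thesis by (simp add: in_keys_iff)
      qed
      then show ?thesis unfolding act_def by (intro add.finprod_one_eqI) simp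
    qed
  qed
qed

text \<open>The change of coordinates from \<open>x\<close> to its first entry and its steps is triangular with ones on
  the diagonal, so it can be solved recursively.\<close>

lemma solve_steps:
  assumes a: "a \<in> carrier k" and c: "\<And>j. c j \<in> carrier k"
  obtains x where "x 0 = a" "\<And>j. x j \<in> carrier k" "\<And>j. [int N1] \<cdot> x j \<oplus> x (Suc j) = c j"
proof -
  define x where "x = rec_nat a (\<lambda>j y. c j \<ominus> [int N1] \<cdot> y)"
  have x: "x 0 = a" "x (Suc j) = c j \<ominus> [int N1] \<cdot> x j" for j by (simp_all add: x_def)
  have xc: "x j \<in> carrier k" for j by (induction j) (simp_all add: x a c)
  have "[int N1] \<cdot> x j \<oplus> x (Suc j) = c j" for j
    using xc[of j] c[of j] by (simp add: x a_minus_def a_ac r_neg r_neg1)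
  then show ?thesis using that x(1) xc by blast
qed

definition diag :: "nat \<Rightarrow> (nat \<Rightarrow> 'a) \<Rightarrow> nat \<times> nat \<Rightarrow> 'a" where
  "diag n x = (\<lambda>(j, i). if 2 * j + i = n then x j else \<zero>)"

lemma diag_vecs: "(\<And>j. x j \<in> carrier k) \<Longrightarrow> diag n x \<in> vecs k (small_basis n)"
  unfolding vecs_iff[OF finite_small_basis] by (auto simp: diag_def small_basis_def)

lemma step_diag: "j < l \<Longrightarrow> step N1 (diag (2 * l) x) l j = [int N1] \<cdot> x j \<oplus> x (Suc j)"
  by (auto simp: step_def diag_def)

lemma step_add:
  "\<lbrakk>s \<in> vecs k (small_basis n); t \<in> vecs k (small_basis n)\<rbrakk> \<Longrightarrow> step N1 (\<lambda>w. s w \<oplus> t w) l j = step N1 s l j \<oplus> step N1 t l j"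
  by (simp add: step_def vecs_closed mult_int_add_right a_ac)

lemma step_smult:
  "\<lbrakk>a \<in> carrier k; s \<in> vecs k (small_basis n)\<rbrakk> \<Longrightarrow> step N1 (\<lambda>w. a \<otimes> s w) l j = a \<otimes> step N1 s l j"
  by (simp add: step_def vecs_closed r_distr add_pow_rdistr_int)

lemma minus_eq_zero_iff: "\<lbrakk>a \<in> carrier k; b \<in> carrier k\<rbrakk> \<Longrightarrow> a \<ominus> b = \<zero> \<longleftrightarrow> a = b"
  by (metis a_minus_def add.inv_closed add.inv_equality add.inv_inv r_neg)

text \<open>In the coordinates given by the first entry and the \<open>l\<close> steps, a cycle is an arbitrary first entry
  together with steps annihilated by \<open>m\<close>. There are no boundaries, as the differential vanishes in
  odd degrees.\<close>

lemma CM_HC_even: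
  assumes N1: "N = m * N1"
  shows "kmodule_isomorphic k (CM_HC k L \<pi> (2 * l))
    (dsum_module (self_module k) (power_module (ann_module k m) l))"
proof -
  let ?M = "dsum_module (self_module k) (power_module (ann_module k m) l)"
  let ?\<psi> = "\<lambda>s. (s (0, 2 * l), \<lambda>j\<in>{..<l}. step N1 s l j)"
  note M_defs = dsum_module_def self_module_def power_module_def prod_module_def ann_module_def
  have carr: "(a, y) \<in> carrier ?M \<longleftrightarrow> a \<in> carrier k \<and> y \<in> extensional {..<l} \<and>
      (\<forall>j<l. y j \<in> carrier k \<and> [m] \<cdot> y j = \<zero>)" for a y
    by (auto simp: M_defs PiE_iff)
  have cyc: "s \<in> small_cycles (2 * l) \<longleftrightarrow> s \<in> vecs k (small_basis (2 * l)) \<and> (\<forall>j<l. [m] \<cdot> step N1 s l j = \<zero>)" for s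
    using small_cycle_iff[OF _ N1] by (auto simp: cyc_vecs_def)
  show ?thesis
  proof (rule CM_HC_isomorphic[where \<psi> = ?\<psi>])
    fix s assume "s \<in> small_cycles (2 * l)"
    then show "?\<psi> s \<in> carrier ?M" by (auto simp: carr cyc vecs_closed step_closed)
  next
    show "carrier ?M \<subseteq> ?\<psi> ` small_cycles (2 * l)"
    proof
      fix \<mu> assume "\<mu> \<in> carrier ?M"
      then obtain a y where \<mu>: "\<mu> = (a, y)" "a \<in> carrier k" "y \<in> extensional {..<l}"
          "\<forall>j<l. y j \<in> carrier k \<and> [m] \<cdot> y j = \<zero>"
        using carr by (cases \<mu>) auto
      have "(if j < l then y j else \<zero>) \<in> carrier k" for j using \<mu>(4) by simp
      then obtain x where x: "x 0 = a" "\<And>j. x j \<in> carrier k"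
          "\<And>j. [int N1] \<cdot> x j \<oplus> x (Suc j) = (if j < l then y j else \<zero>)"
        using solve_steps[OF \<mu>(2), of "\<lambda>j. if j < l then y j else \<zero>" N1] by blast
      have "diag (2 * l) x \<in> small_cycles (2 * l)" using x \<mu>(4) by (auto simp: cyc diag_vecs step_diag)
      moreover have "?\<psi> (diag (2 * l) x) = \<mu>"
        using x \<mu>(3) by (auto simp: \<mu>(1) step_diag extensional_def fun_eq_iff) (simp add: diag_def)
      ultimately show "\<mu> \<in> ?\<psi> ` small_cycles (2 * l)" by force
    qed
  next
    fix s t assume "s \<in> small_cycles (2 * l)" "t \<in> small_cycles (2 * l)"
    then show "?\<psi> (\<lambda>w. s w \<oplus> t w) = ?\<psi> s \<oplus>\<^bsub>?M\<^esub> ?\<psi> t"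
      by (auto simp: M_defs cyc step_add fun_eq_iff)
  next
    fix a s assume "a \<in> carrier k" "s \<in> small_cycles (2 * l)"
    then show "?\<psi> (\<lambda>w. a \<otimes> s w) = a \<odot>\<^bsub>?M\<^esub> ?\<psi> s"
      by (auto simp: M_defs cyc step_smult fun_eq_iff)
  next
    fix s t assume st: "s \<in> small_cycles (2 * l)" "t \<in> small_cycles (2 * l)"
    then have c: "s w \<in> carrier k" "t w \<in> carrier k" for w by (auto simp: cyc vecs_closed)
    have "(\<lambda>_. \<zero>) \<in> vecs k (small_basis (Suc (2 * l)))" by (simp add: vecs_iff finite_small_basis)
    then have "small_bdries (2 * l) = {\<lambda>_. \<zero>}" by (auto simp: bdry_vecs_def act_small_d_odd)
    then have "(\<lambda>w. s w \<ominus> t w) \<in> small_bdries (2 * l) \<longleftrightarrow> s = t"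
      using c by (auto simp: fun_eq_iff minus_eq_zero_iff)
    moreover have "s = t" if eq: "?\<psi> s = ?\<psi> t"
    proof -
      have 0: "s (0, 2 * l) = t (0, 2 * l)" using eq by simp
      have st_step: "step N1 s l j = step N1 t l j" if "j < l" for j
        using eq that by (auto simp: fun_eq_iff restrict_def split: if_splits)
      have "j \<le> l \<Longrightarrow> s (j, 2 * (l - j)) = t (j, 2 * (l - j))" for j
      proof (induction j)
        case (Suc j)
        then have "[int N1] \<cdot> s (j, 2 * (l - j)) \<oplus> s (Suc j, 2 * (l - Suc j))
            = [int N1] \<cdot> s (j, 2 * (l - j)) \<oplus> t (Suc j, 2 * (l - Suc j))"
          using st_step[of j] by (simp add: step_def)
        then show ?case using c by simp
      qed (use 0 in simp)
      then have "s v = t v" if "v \<in> small_basis (2 * l)" for v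
        using small_basis_even[OF that] by blast
      moreover have "s v = t v" if "v \<notin> small_basis (2 * l)" for v
        using st that vecs_zero[of s "small_basis (2 * l)" v] vecs_zero[of t "small_basis (2 * l)" v] by (simp add: cyc)
      ultimately show "s = t" by blast
    qed
    ultimately show "?\<psi> s = ?\<psi> t \<longleftrightarrow> (\<lambda>w. s w \<ominus> t w) \<in> small_bdries (2 * l)" by blast
  qed
qed

lemma multiples_subgroup: "abelian_subgroup ((\<lambda>a. [m] \<cdot> a) ` carrier k) k"
proof (rule abelian_subgroupI3[OF additive_subgroupI])
  have "m_inv (add_monoid k) x = \<ominus> x" for x by (simp add: a_inv_def)
  then show "subgroup ((\<lambda>a. [m] \<cdot> a) ` carrier k) (add_monoid k)"
  proof (intro add.subgroupI)
    show "(\<lambda>a. [m] \<cdot> a) ` carrier k \<subseteq> carrier k" by auto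
    show "(\<lambda>a. [m] \<cdot> a) ` carrier k \<noteq> {}" by auto
    fix x assume "x \<in> (\<lambda>a. [m] \<cdot> a) ` carrier k"
    then obtain a where a: "a \<in> carrier k" "x = [m] \<cdot> a" by auto
    have "\<ominus> x = [m] \<cdot> (\<ominus> a)"
      using a by (metis add.nat_pow_inv)
    then show "\<ominus> x \<in> (\<lambda>a. [m] \<cdot> a) ` carrier k" using a by auto
    fix y assume "y \<in> (\<lambda>a. [m] \<cdot> a) ` carrier k"
    then obtain b where b: "b \<in> carrier k" "y = [m] \<cdot> b" by auto
    have "x \<oplus> y = [m] \<cdot> (a \<oplus> b)" using a b by (simp add: add.nat_pow_distrib)
    then show "x \<oplus> y \<in> (\<lambda>a. [m] \<cdot> a) ` carrier k" using a b by auto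
  qed
qed (rule abelian_group_axioms)

text \<open>All chains of odd degree are cycles. The boundaries are \<open>m\<close> times the possible families of steps,
  and by \<open>solve_steps\<close> every family of coefficients is one.\<close>

lemma CM_HC_odd:
  assumes N1: "N = m * N1"
  shows "kmodule_isomorphic k (CM_HC k L \<pi> (Suc (2 * l))) (power_module (mod_multiples_module k m) (Suc l))"
proof -
  define I where "I = (\<lambda>a. [m] \<cdot> a) ` carrier k"
  interpret I: abelian_subgroup I k unfolding I_def by (rule multiples_subgroup)
  let ?M = "power_module (mod_multiples_module k m) (Suc l)"
  let ?c = "\<lambda>s j. s (j, 2 * (l - j) + 1)"
  let ?\<psi> = "\<lambda>s. \<lambda>j\<in>{..<Suc l}. I +> ?c s j"
  have coset: "I +>\<^bsub>self_module k\<^esub> a = I +> a" for a by (simp add: a_r_coset_def' self_module_def)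
  have setadd: "set_add (self_module k) A B = A <+> B" for A B by (simp add: set_add_def' self_module_def)
  have Q: "carrier (mod_multiples_module k m) = (\<lambda>a. I +> a) ` carrier k"
    by (auto simp: mod_multiples_module_def quot_module_def A_RCOSETS_def' coset I_def[symmetric])
      (auto simp: self_module_def)
  have coset_eq: "I +> a = I +> b \<longleftrightarrow> a \<ominus> b \<in> I" if "a \<in> carrier k" "b \<in> carrier k" for a b
  proof -
    have "a \<in> I +> b \<longleftrightarrow> a \<ominus> b \<in> I" using I.a_rcos_module[OF that(2,1)] by (simp only: a_minus_def)
    moreover have "a \<in> I +> b" if "I +> a = I +> b" using I.a_rcos_self[OF \<open>a \<in> carrier k\<close>] that by (simp only:)
    moreover have "a \<in> I +> b \<Longrightarrow> I +> a = I +> b"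
      using a_repr_independence[OF _ that(2) I.a_subgroup] by (rule sym)
    ultimately show ?thesis by blast
  qed
  have Qadd: "(I +> a) \<oplus>\<^bsub>mod_multiples_module k m\<^esub> (I +> b) = I +> (a \<oplus> b)"
    if "a \<in> carrier k" "b \<in> carrier k" for a b
    using that by (simp add: mod_multiples_module_def quot_module_def setadd I.a_rcos_sum)
  have Qsmult: "a \<odot>\<^bsub>mod_multiples_module k m\<^esub> (I +> b) = I +> (a \<otimes> b)"
    if a: "a \<in> carrier k" and b: "b \<in> carrier k" for a b
  proof -
    have 1: "I +> (a \<otimes> y) = I +> (a \<otimes> b)" if y: "y \<in> I +> b" for y
    proof -
      obtain h where h: "h \<in> carrier k" "y = [m] \<cdot> h \<oplus> b" using y by (auto simp: a_r_coset_def' I_def)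
      have "a \<otimes> y \<ominus> a \<otimes> b = a \<otimes> ([m] \<cdot> h)"
        using a b h by (simp add: r_distr add_minus_cancel_left a_comm add_pow_rdistr)
      also have "\<dots> = [m] \<cdot> (a \<otimes> h)" using a h by (simp add: add_pow_rdistr)
      finally have "a \<otimes> y \<ominus> a \<otimes> b \<in> I" using a h by (auto simp: I_def)
      moreover have "y \<in> carrier k" using h b by simp
      ultimately show ?thesis using a b by (simp add: coset_eq)
    qed
    have 2: "b \<in> I +> b" using b by (rule I.a_rcos_self)
    have "a \<odot>\<^bsub>mod_multiples_module k m\<^esub> (I +> b) = (\<Union>y\<in>I +> b. I +> (a \<otimes> y))"
      by (simp add: mod_multiples_module_def quot_module_def I_def[symmetric] coset) (simp add: self_module_def)
    also have "\<dots> = I +> (a \<otimes> b)" using 1 2 by blast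
    finally show ?thesis .
  qed
  have carr: "carrier ?M = (\<Pi>\<^sub>E j\<in>{..<Suc l}. (\<lambda>a. I +> a) ` carrier k)"
    by (simp add: power_module_def prod_module_def Q)
  have cyc: "small_cycles (Suc (2 * l)) = vecs k (small_basis (Suc (2 * l)))"
    by (simp add: cyc_vecs_def act_small_d_odd)
  show ?thesis
  proof (rule CM_HC_isomorphic[where \<psi> = ?\<psi>])
    fix s assume "s \<in> small_cycles (Suc (2 * l))"
    then show "?\<psi> s \<in> carrier ?M" by (auto simp: carr cyc vecs_closed)
  next
    show "carrier ?M \<subseteq> ?\<psi> ` small_cycles (Suc (2 * l))"
    proof
      fix \<mu> assume \<mu>: "\<mu> \<in> carrier ?M"
      then have "\<forall>j. \<exists>a. a \<in> carrier k \<and> (j < Suc l \<longrightarrow> \<mu> j = I +> a)"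
        unfolding carr PiE_iff by (metis imageE lessThan_iff zero_closed)
      then obtain r where r: "\<And>j. r j \<in> carrier k" "\<And>j. j < Suc l \<Longrightarrow> \<mu> j = I +> r j" by metis
      have "diag (Suc (2 * l)) r \<in> small_cycles (Suc (2 * l))" using r(1) by (simp add: cyc diag_vecs)
      moreover have "?\<psi> (diag (Suc (2 * l)) r) = \<mu>"
      proof
        fix j
        show "?\<psi> (diag (Suc (2 * l)) r) j = \<mu> j"
          using \<mu> r(2)[of j] by (cases "j < Suc l") (auto simp: carr PiE_iff extensional_def diag_def)
      qed
      ultimately show "\<mu> \<in> ?\<psi> ` small_cycles (Suc (2 * l))" by force
    qed
  next
    fix s t assume "s \<in> small_cycles (Suc (2 * l))" "t \<in> small_cycles (Suc (2 * l))"
    then show "?\<psi> (\<lambda>w. s w \<oplus> t w) = ?\<psi> s \<oplus>\<^bsub>?M\<^esub> ?\<psi> t"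
      by (auto simp: power_module_def prod_module_def cyc Qadd vecs_closed fun_eq_iff)
  next
    fix a s assume "a \<in> carrier k" "s \<in> small_cycles (Suc (2 * l))"
    then show "?\<psi> (\<lambda>w. a \<otimes> s w) = a \<odot>\<^bsub>?M\<^esub> ?\<psi> s"
      by (auto simp: power_module_def prod_module_def cyc Qsmult vecs_closed fun_eq_iff)
  next
    fix s t assume st: "s \<in> small_cycles (Suc (2 * l))" "t \<in> small_cycles (Suc (2 * l))"
    then have sv: "s \<in> vecs k (small_basis (Suc (2 * l)))" "t \<in> vecs k (small_basis (Suc (2 * l)))" by (auto simp: cyc)
    have c: "s w \<in> carrier k" "t w \<in> carrier k" for w using sv by (auto simp: vecs_closed)
    let ?d = "\<lambda>w. s w \<ominus> t w"
    have dv: "?d \<in> vecs k (small_basis (Suc (2 * l)))" by (rule vecs_minus[OF sv])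
    have "?\<psi> s = ?\<psi> t \<longleftrightarrow> (\<forall>j<Suc l. ?d (j, 2 * (l - j) + 1) \<in> I)"
      using c by (auto simp: coset_eq fun_eq_iff restrict_def split: if_splits)
    also have "\<dots> \<longleftrightarrow> ?d \<in> small_bdries (Suc (2 * l))"
    proof
      assume "?d \<in> small_bdries (Suc (2 * l))"
      then obtain y where y: "y \<in> vecs k (small_basis (2 * Suc l))" "?d = act k (small_basis (2 * Suc l)) small_d y"
        by (auto simp: bdry_vecs_def)
      show "\<forall>j<Suc l. ?d (j, 2 * (l - j) + 1) \<in> I"
      proof (intro allI impI)
        fix j assume j: "j < Suc l"
        then have e: "2 * (l - j) + 1 = 2 * (Suc l - j) - 1" by simp
        have "?d (j, 2 * (l - j) + 1) = [m] \<cdot> step N1 y (Suc l) j"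
          unfolding fun_cong[OF y(2)] e by (rule act_small_d_even[OF y(1) j N1])
        then show "?d (j, 2 * (l - j) + 1) \<in> I" unfolding I_def using step_closed[OF y(1)] by blast
      qed
    next
      assume "\<forall>j<Suc l. ?d (j, 2 * (l - j) + 1) \<in> I"
      then have "\<forall>j. \<exists>a. a \<in> carrier k \<and> (j < Suc l \<longrightarrow> ?d (j, 2 * (l - j) + 1) = [m] \<cdot> a)"
        unfolding I_def by (metis imageE zero_closed)
      then obtain r where r: "\<And>j. r j \<in> carrier k" "\<And>j. j < Suc l \<Longrightarrow> ?d (j, 2 * (l - j) + 1) = [m] \<cdot> r j"
        by metis
      obtain x where x: "x 0 = \<zero>" "\<And>j. x j \<in> carrier k" "\<And>j. [int N1] \<cdot> x j \<oplus> x (Suc j) = r j"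
        using solve_steps[OF zero_closed, of r N1] r(1) by blast
      let ?y = "diag (2 * Suc l) x"
      have y: "?y \<in> vecs k (small_basis (2 * Suc l))" by (rule diag_vecs) (rule x(2))
      have av: "act k (small_basis (2 * Suc l)) small_d ?y \<in> vecs k (small_basis (Suc (2 * l)))"
        using bdry_vecs_cyc_vecs[OF based_complex_small finite_small_basis, of ?y "Suc (2 * l)"] y by (simp add: cyc)
      have "?d u = act k (small_basis (2 * Suc l)) small_d ?y u" for u
      proof (cases "u \<in> small_basis (Suc (2 * l))")
        case False
        then show ?thesis using vecs_zero[OF dv] vecs_zero[OF av] by simp
      next
        case True
        then obtain j where j: "j < Suc l" "u = (j, 2 * (l - j) + 1)"
          using small_basis_odd less_Suc_eq_le by blast
        have e: "2 * (l - j) + 1 = 2 * (Suc l - j) - 1" using j by simp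
        have "act k (small_basis (2 * Suc l)) small_d ?y u = [m] \<cdot> step N1 ?y (Suc l) j"
          unfolding j(2) e by (rule act_small_d_even[OF y j(1) N1])
        also have "step N1 ?y (Suc l) j = r j" by (simp only: step_diag[OF j(1)] x(3))
        finally show ?thesis using r(2)[OF j(1)] j(2) by simp
      qed
      then have "?d = act k (small_basis (2 * Suc l)) small_d ?y" ..
      then show "?d \<in> small_bdries (Suc (2 * l))" unfolding bdry_vecs_def using y by auto
    qed
    finally show "?\<psi> s = ?\<psi> t \<longleftrightarrow> ?d \<in> small_bdries (Suc (2 * l))" .
  qed
qed

end

theorem proposition3p8:
  fixes k :: "('a, 'r) ring_scheme"
    and G :: "('g, 'h) monoid_scheme"
    and \<pi> :: 'g and m\<^sub>\<pi> n :: nat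
  assumes "cring k"
    and "group G" and "finite (carrier G)" and "cyclic_group G"
    and "\<pi> \<in> carrier G"
    and "m\<^sub>\<pi> = subgroup_index G (generate G {\<pi>})"
  shows "(even n \<longrightarrow>
            kmodule_isomorphic k (CM_HC k G \<pi> n)
              (dsum_module (self_module k) (power_module (ann_module k m\<^sub>\<pi>) (n div 2)))) \<and>
         (odd n \<longrightarrow>
            kmodule_isomorphic k (CM_HC k G \<pi> n)
              (power_module (mod_multiples_module k m\<^sub>\<pi>) ((n + 1) div 2)))"
proof -
  obtain \<gamma> N1 where \<gamma>: "\<gamma> \<in> carrier G" "carrier G = range (\<lambda>i::int. \<gamma> [^]\<^bsub>G\<^esub> i)"
      "group.ord G \<gamma> = m\<^sub>\<pi> * N1" "0 < m\<^sub>\<pi> * N1" "\<pi> = \<gamma> [^]\<^bsub>G\<^esub> m\<^sub>\<pi>"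
    using group.generator_with_power[OF assms(2-6)] by blast
  interpret cyclic_group_algebra k G "m\<^sub>\<pi> * N1" m\<^sub>\<pi> \<gamma> \<pi>
    by (intro cyclic_group_algebra.intro group_algebra.intro group_algebra_axioms.intro
        cyclic_quotient.intro cyclic_quotient_axioms.intro homogeneous.intro assms \<gamma>)
  show ?thesis
  proof (intro conjI impI)
    assume "even n"
    then show "kmodule_isomorphic k (CM_HC k G \<pi> n)
              (dsum_module (self_module k) (power_module (ann_module k m\<^sub>\<pi>) (n div 2)))"
      using CM_HC_even[OF refl, of "n div 2"] by simp
  next
    assume "odd n"
    then obtain l where "n = Suc (2 * l)" by (auto elim: oddE)
    then show "kmodule_isomorphic k (CM_HC k G \<pi> n)
              (power_module (mod_multiples_module k m\<^sub>\<pi>) ((n + 1) div 2))"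
      using CM_HC_odd[OF refl, of l] by simp
  qed
qed

end
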